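(* Let $0<\varepsilon<1$ and $0<\delta<1$, and let $d\ge 1$ be an integer. Let $n = pr$ with $p$ a positive integer and $r$ a power of two, and let $\mathbf{\Omega}\in\mathbb{R}^{l\times n}$ be the block SRHT matrix with $p$ blocks of size $l\times r$, whose sampling matrix samples uniformly at random with replacement. If $$ n \;\ge\; l \;\ge\; 3.7\,\varepsilon^{-2}\left(\sqrt{d}+4\sqrt{\log\tfrac{n}{\delta}+6.3}\right)^2 \log\tfrac{5d}{\delta},$$ then $\mathbf{\Omega}$ is an $(\varepsilon,\delta,d)$ oblivious $\ell_2$-subspace embedding (OSE).
   Context: Here $\log$ is the natural logarithm. OSE: for $0\le\varepsilon<1$ and $0<\delta<1$, a random matrix $\mathbf{\Omega}\in\mathbb{R}^{l\times n}$ is an $(\varepsilon,\delta,d)$ oblivious $\ell_2$-subspace embedding (OSE) if for any fixed $d$-dimensional subspace $V\subseteq\mathbb{R}^n$, with probability at least $1-\delta$ it holds that for all $\mathbf{x}\in V$, $\left|\,\|\mathbf{x}\|_2^2-\|\mathbf{\Omega}\mathbf{x}\|_2^2\right|\le\varepsilon\|\mathbf{x}\|_2^2$. Block SRHT (block sub-sampled randomized Hadamard transform): $n=pr$ with $r$ a power of two, and $$\mathbf{\Omega}=[\,\mathbf{\Omega}^{(1)}\ \mathbf{\Omega}^{(2)}\ \cdots\ \mathbf{\Omega}^{(p)}\,]\in\mathbb{R}^{l\times n},\qquad \mathbf{\Omega}^{(i)}=\sqrt{\tfrac{r}{l}}\;\widetilde{\mathbf{D}}^{(i)}\,\mathbf{R}\,\mathbf{H}\,\mathbf{D}^{(i)}\in\mathbb{R}^{l\times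 r},\quad 1\le i\le p,$$ where: - $\mathbf{H}$ is the $r\times r$ Walsh–Hadamard matrix rescaled by $1/\sqrt r$, i.e. $\mathbf{H}=\frac{1}{\sqrt r}\begin{bmatrix}1&1\\1&-1\end{bmatrix}\otimes\cdots\otimes\begin{bmatrix}1&1\\1&-1\end{bmatrix}$ with $\log_2 r$ factors (for $r=1$, $\mathbf{H}=[1]$); - $\mathbf{R}\in\mathbb{R}^{l\times r}$ is a single random sampling matrix, the same for all blocks $i$: $\mathbf{R}\mathbf{x}=(x_{i_1},\dots,x_{i_l})$, with indices $i_1,\dots,i_l$ drawn independently and uniformly at random (with replacement) from $\{1,\dots,r\}$; - $\mathbf{D}^{(i)}\in\mathbb{R}^{r\times r}$ and $\widetilde{\mathbf{D}}^{(i)}\in\mathbb{R}^{l\times l}$, $1\le i\le p$, are diagonal matrices whose diagonal entries are i.i.d. Rademacher variables (values $\pm1$ with probability $1/2$ each). All the random matrices $\mathbf{R},\mathbf{D}^{(1)},\dots,\mathbf{D}^{(p)},\widetilde{\mathbf{D}}^{(1)},\dots,\widetilde{\mathbf{D}}^{(p)}$ are mutually independent. *)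

theory Defs
  imports "HOL-Probability.Probability" "Jordan_Normal_Form.VS_Connect"
begin

text \<open>Matrices and vectors are those of \<^theory>\<open>Jordan_Normal_Form.Matrix\<close>, since the
  dimensions vary. All indices start at 0.\<close>

definition norm2_vec :: "real Matrix.vec \<Rightarrow> real" where
  "norm2_vec x = L2_set (\<lambda>i. vec_index x i) {..<dim_vec x}"

text \<open>The linear subspaces of \<open>\<real>\<^sup>n\<close> of dimension \<open>d\<close>. Passing to \<open>V\<close> as a vector space
  in its own right amounts to replacing the carrier of \<open>\<real>\<^sup>n\<close>.\<close>

definition subspaces_of_dim :: "nat \<Rightarrow> nat \<Rightarrow> real Matrix.vec set set" where
  "subspaces_of_dim n d =
     {V. VectorSpace.subspace class_ring V (module_vec TYPE(real) n) \<and>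
         vectorspace.dim class_ring ((module_vec TYPE(real) n)\<lparr>carrier := V\<rparr>) = d}"

definition random_matrix ::
    "'w measure \<Rightarrow> nat \<Rightarrow> nat \<Rightarrow> ('w \<Rightarrow> real Matrix.mat) \<Rightarrow> bool" where
  "random_matrix M l n \<Omega> \<longleftrightarrow>
     (\<forall>\<omega>\<in>space M. \<Omega> \<omega> \<in> carrier_mat l n) \<and>
     (\<forall>i<l. \<forall>j<n. (\<lambda>\<omega>. index_mat (\<Omega> \<omega>) (i, j)) \<in> borel_measurable M)"

text \<open>Oblivious subspace embeddings. A non-measurable event would have measure 0, so the
  probability bound (with \<open>\<delta> < 1\<close>) also asserts that the event is measurable.\<close>

definition OSE ::
    "'w measure \<Rightarrow> nat \<Rightarrow> nat \<Rightarrow> real \<Rightarrow> real \<Rightarrow> nat \<Rightarrow> ('w \<Rightarrow> real Matrix.mat) \<Rightarrow> bool" where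
  "OSE M l n \<epsilon> \<delta> d \<Omega> \<longleftrightarrow>
     prob_space M \<and> random_matrix M l n \<Omega> \<and>
     (\<forall>V \<in> subspaces_of_dim n d.
        measure M {\<omega> \<in> space M.
          \<forall>x\<in>V. \<bar>(norm2_vec x)\<^sup>2 - (norm2_vec (\<Omega> \<omega> *\<^sub>v x))\<^sup>2\<bar> \<le> \<epsilon> * (norm2_vec x)\<^sup>2} \<ge> 1 - \<delta>)"

definition kronecker_product ::
    "real Matrix.mat \<Rightarrow> real Matrix.mat \<Rightarrow> real Matrix.mat" where
  "kronecker_product A B =
     Matrix.mat (dim_row A * dim_row B) (dim_col A * dim_col B)
       (\<lambda>(i, j). index_mat A (i div dim_row B, j div dim_col B) *
                 index_mat B (i mod dim_row B, j mod dim_col B))"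

primrec hadamard_unscaled :: "nat \<Rightarrow> real Matrix.mat" where
  "hadamard_unscaled 0 = 1\<^sub>m 1"
| "hadamard_unscaled (Suc k) =
     kronecker_product (mat_of_rows_list 2 [[1, 1], [1, -1]]) (hadamard_unscaled k)"

text \<open>The orthogonal Walsh-Hadamard matrix of size \<open>2^k\<close>.\<close>

definition walsh_hadamard :: "nat \<Rightarrow> real Matrix.mat" where
  "walsh_hadamard k = (1 / sqrt (2 ^ k)) \<cdot>\<^sub>m hadamard_unscaled k"

definition sampling_matrix :: "nat \<Rightarrow> nat \<Rightarrow> (nat \<Rightarrow> nat) \<Rightarrow> real Matrix.mat" where
  "sampling_matrix l r s = Matrix.mat l r (\<lambda>(a, j). if j = s a then 1 else 0)"

text \<open>The block SRHT matrix with \<open>p\<close> blocks of size \<open>l \<times> 2^k\<close>, for given sampled indices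
  \<open>s a\<close> (\<open>a < l\<close>), given diagonals \<open>u i\<close> of length \<open>2^k\<close> (the matrix \<open>D\<close> of block \<open>i\<close>), and
  given diagonals \<open>v i\<close> of length \<open>l\<close> (the matrix \<open>D\<close> with a tilde of block \<open>i\<close>).\<close>

definition srht_block ::
    "nat \<Rightarrow> nat \<Rightarrow> (nat \<Rightarrow> nat) \<Rightarrow> (nat \<Rightarrow> real) \<Rightarrow> (nat \<Rightarrow> real) \<Rightarrow> real Matrix.mat" where
  "srht_block k l s u v =
     sqrt (real (2 ^ k) / real l) \<cdot>\<^sub>m
       (mat_diag l v * sampling_matrix l (2 ^ k) s * walsh_hadamard k * mat_diag (2 ^ k) u)"

definition block_srht_matrix ::
    "nat \<Rightarrow> nat \<Rightarrow> nat \<Rightarrow> (nat \<Rightarrow> nat) \<Rightarrow> (nat \<Rightarrow> nat \<Rightarrow> real) \<Rightarrow> (nat \<Rightarrow> nat \<Rightarrow> real)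
       \<Rightarrow> real Matrix.mat" where
  "block_srht_matrix p k l s u v =
     Matrix.mat l (p * 2 ^ k)
       (\<lambda>(a, j). index_mat (srht_block k l s (u (j div 2 ^ k)) (v (j div 2 ^ k)))
                   (a, j mod 2 ^ k))"

definition rademacher :: "'w measure \<Rightarrow> ('w \<Rightarrow> real) \<Rightarrow> bool" where
  "rademacher M X \<longleftrightarrow>
     X \<in> borel_measurable M \<and>
     measure M {\<omega> \<in> space M. X \<omega> = 1} = 1 / 2 \<and>
     measure M {\<omega> \<in> space M. X \<omega> = -1} = 1 / 2"

definition uniform_index :: "'w measure \<Rightarrow> nat \<Rightarrow> ('w \<Rightarrow> nat) \<Rightarrow> bool" where
  "uniform_index M r S \<longleftrightarrow>
     S \<in> measurable M (count_space UNIV) \<and>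
     (\<forall>j<r. measure M {\<omega> \<in> space M. S \<omega> = j} = 1 / real r)"

text \<open>Names for the scalar random variables that a block SRHT is built from. The sampled
  indices and the diagonal entries are i.i.d. within each random matrix and the random
  matrices are mutually independent; together this is the joint independence of all these
  scalars. The sampled indices are coerced to \<^typ>\<open>real\<close> there because the constant
  \<open>indep_vars\<close> takes a family of random variables of a single type.\<close>

datatype srht_source = Sampled nat | Diag nat nat | DiagTilde nat nat

definition srht_sources ::
    "nat \<Rightarrow> nat \<Rightarrow> nat \<Rightarrow> srht_source set" where
  "srht_sources p r l =
     {Sampled a |a. a < l} \<union> {Diag i j |i j. i < p \<and> j < r} \<union> {DiagTilde i a |i a. i < p \<and> a < l}"

definition block_SRHT ::
    "'w measure \<Rightarrow> nat \<Rightarrow> nat \<Rightarrow> nat \<Rightarrow> ('w \<Rightarrow> real Matrix.mat) \<Rightarrow> bool" where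
  "block_SRHT M p k l \<Omega> \<longleftrightarrow>
     prob_space M \<and>
     (\<exists>S U V.
        (\<forall>a<l. uniform_index M (2 ^ k) (S a)) \<and>
        (\<forall>i<p. \<forall>j<2 ^ k. rademacher M (U i j)) \<and>
        (\<forall>i<p. \<forall>a<l. rademacher M (V i a)) \<and>
        prob_space.indep_vars M (\<lambda>_. borel)
          (\<lambda>c. case c of
                 Sampled a \<Rightarrow> (\<lambda>\<omega>. real (S a \<omega>))
               | Diag i j \<Rightarrow> U i j
               | DiagTilde i a \<Rightarrow> V i a)
          (srht_sources p (2 ^ k) l) \<and>
        (\<forall>\<omega>\<in>space M. \<Omega> \<omega> =
           block_srht_matrix p k l (\<lambda>a. S a \<omega>) (\<lambda>i j. U i j \<omega>) (\<lambda>i a. V i a \<omega>)))"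

end

theory Submission
  imports Defs "HOL-Real_Asymp.Real_Asymp" "Jordan_Normal_Form.Gram_Schmidt"
begin

text \<open>
  Let \<open>Q\<close> be an orthonormal basis of \<open>V\<close>. Conditionally on the matrices \<open>D\<close>, the rows \<open>y\<^sub>a\<close> of
  \<open>sqrt l\<close> times \<open>\<Omega> Q\<close> are i.i.d. with covariance \<open>I\<close>, and \<open>\<Omega> Q\<close> is an approximate isometry
  when all eigenvalues of the mean of the \<open>y\<^sub>a y\<^sub>a\<^sup>T\<close> lie in \<open>[1 - \<epsilon>, 1 + \<epsilon>]\<close>. This is a matrix
  Chernoff bound. The Golden--Thompson inequality is only needed for perturbations of rank one, where it
  has an elementary proof: \<open>tr exp (X + y y\<^sup>T)\<close> is expanded into scalar products of moments
  \<open>\<langle>y, X\<^sup>m y\<rangle>\<close>, and these are log-convex in \<open>m\<close>.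

  Each single row is \<open>Q\<^sup>T \<xi>\<close> for a uniform sign vector \<open>\<xi>\<close>, so its norm exceeds \<open>sqrt d + t\<close> with
  probability at most \<open>exp (- t\<^sup>2 / 4)\<close>, by comparison with a Gaussian vector. Hence for most \<open>D\<close> only
  a tiny fraction of the possible rows is long; the long rows are replaced by \<open>0\<close> in the Chernoff bound, which
  changes the covariance by at most \<open>\<epsilon> / 100\<close>. All random variables take finitely many values, so
  probabilities are computed by counting.
\<close>

subsection \<open>Positive semidefinite operators and rank-one perturbations\<close>

text \<open>The obstacle is that long rows are rare but not impossible. A Chernoff bound needs a
  uniform bound on the norms, and the worst-case squared norm is of order \<open>d * n\<close>; a
  union bound over all \<open>r * 2 ^ p\<close> possible rows would add a term growing with
  \<open>p\<close> to the logarithm. Only \<open>l \<le> n\<close> rows are drawn, so it is enough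
  that the fraction \<gamma> of long rows be so small that most likely none of them is hit, and that
  \<gamma> times \<open>d * n\<close> be far below \<epsilon>. The choice \<gamma> = \<delta> / (5
  n^3) achieves both. To obtain it from Markov's inequality, a single row must be long with
  probability of order (\<delta> / n)^4, and this is where the factor 4 before the inner square root
  of the hypothesis comes from: its square, divided by 4, multiplies the logarithm by four.

  Operator exponentials are encoded by numerical series: \<open>trace_exp d X\<close> stands for tr
  exp X and \<open>form_exp d X y\<close> for the form of exp X at \<open>y\<close>. Every estimate
  thus becomes an inequality between moments, and the trace plays the part of the largest
  eigenvalue.\<close>

definition ip :: "nat \<Rightarrow> (nat \<Rightarrow> real) \<Rightarrow> (nat \<Rightarrow> real) \<Rightarrow> real" where
  "ip d x y = (\<Sum>i<d. x i * y i)"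

text \<open>Linearity need not be assumed: symmetry implies it as far as \<^const>\<open>ip\<close> can tell, and nothing
  else is ever observed of an operator.\<close>

definition psd :: "nat \<Rightarrow> ((nat \<Rightarrow> real) \<Rightarrow> nat \<Rightarrow> real) \<Rightarrow> bool" where
  "psd d X \<longleftrightarrow> (\<forall>x z. ip d x (X z) = ip d (X x) z) \<and> (\<forall>x. 0 \<le> ip d x (X x))"

definition rank1_update ::
    "nat \<Rightarrow> (nat \<Rightarrow> real) \<Rightarrow> ((nat \<Rightarrow> real) \<Rightarrow> nat \<Rightarrow> real) \<Rightarrow> (nat \<Rightarrow> real) \<Rightarrow> nat \<Rightarrow> real" where
  "rank1_update d y X = (\<lambda>x i. X x i + ip d y x * y i)"

definition std_vec :: "nat \<Rightarrow> nat \<Rightarrow> real" where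
  "std_vec i = (\<lambda>j. if j = i then 1 else 0)"

definition op_trace :: "nat \<Rightarrow> ((nat \<Rightarrow> real) \<Rightarrow> nat \<Rightarrow> real) \<Rightarrow> real" where
  "op_trace d X = (\<Sum>i<d. ip d (std_vec i) (X (std_vec i)))"

definition trace_exp :: "nat \<Rightarrow> ((nat \<Rightarrow> real) \<Rightarrow> nat \<Rightarrow> real) \<Rightarrow> real" where
  "trace_exp d X = (\<Sum>q. op_trace d (X ^^ q) / fact q)"

definition form_exp :: "nat \<Rightarrow> ((nat \<Rightarrow> real) \<Rightarrow> nat \<Rightarrow> real) \<Rightarrow> (nat \<Rightarrow> real) \<Rightarrow> real" where
  "form_exp d X y = (\<Sum>q. ip d y ((X ^^ q) y) / fact q)"

lemma ip_commute: "ip d x y = ip d y x"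
  by (simp add: ip_def mult.commute)

lemma ip_add_right: "ip d x (\<lambda>i. y i + z i) = ip d x y + ip d x z"
  by (simp add: ip_def sum.distrib algebra_simps)

lemma ip_scale_right: "ip d x (\<lambda>i. a * y i) = a * ip d x y"
  by (simp add: ip_def sum_distrib_left algebra_simps)

lemma ip_scale_left: "ip d (\<lambda>i. a * y i) x = a * ip d y x"
  by (simp add: ip_def sum_distrib_left algebra_simps)

lemma ip_sum_right: "ip d x (\<lambda>i. \<Sum>j\<in>J. a j * z j i) = (\<Sum>j\<in>J. a j * ip d x (z j))"
proof -
  have "ip d x (\<lambda>i. \<Sum>j\<in>J. a j * z j i) = (\<Sum>i<d. \<Sum>j\<in>J. a j * (x i * z j i))"
    by (simp add: ip_def sum_distrib_left algebra_simps)
  also have "\<dots> = (\<Sum>j\<in>J. a j * ip d x (z j))"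
    unfolding ip_def sum_distrib_left by (rule sum.swap)
  finally show ?thesis .
qed

lemma ip_self_nonneg: "0 \<le> ip d x x"
  by (simp add: ip_def sum_nonneg)

lemma ip_std_vec: "i < d \<Longrightarrow> ip d (std_vec i) x = x i"
  by (simp add: ip_def std_vec_def if_distrib[of "\<lambda>u. u * _"] cong: if_cong)

lemma ip_expand: "ip d x y = (\<Sum>i<d. x i * ip d (std_vec i) y)"
  by (simp add: ip_std_vec) (simp add: ip_def)

lemma psd_sym: "psd d X \<Longrightarrow> ip d x (X z) = ip d (X x) z"
  by (simp add: psd_def)

lemma psd_nonneg: "psd d X \<Longrightarrow> 0 \<le> ip d x (X x)"
  unfolding psd_def by blast

lemma psd_id: "psd d (\<lambda>x. x)"
  by (simp add: psd_def ip_self_nonneg)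

lemma psd_rank1_update:
  assumes "psd d X" shows "psd d (rank1_update d y X)"
  unfolding psd_def rank1_update_def
proof (intro conjI allI)
  fix x z
  have a: "ip d u (\<lambda>i. X w i + ip d y w * y i) = ip d u (X w) + ip d y w * ip d u y" for u w
    using ip_add_right[of d u "X w" "\<lambda>i. ip d y w * y i"] by (simp add: ip_scale_right)
  show "ip d x (\<lambda>i. X z i + ip d y z * y i) = ip d (\<lambda>i. X x i + ip d y x * y i) z"
    using psd_sym[OF assms, of x z] a[of x z] a[of z x] ip_commute[of d] by (simp add: mult.commute)
  show "0 \<le> ip d x (\<lambda>i. X x i + ip d y x * y i)"
    using psd_nonneg[OF assms, of x] by (simp add: a ip_commute[of d x y])
qed

lemma ip_rank1_update:
  "ip d x (rank1_update d y X z) = ip d x (X z) + ip d y z * ip d x y"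
  unfolding rank1_update_def by (simp only: ip_add_right ip_scale_right)

lemma psd_cauchy_schwarz:
  assumes "psd d X" shows "(ip d u (X w))\<^sup>2 \<le> ip d u (X u) * ip d w (X w)"
proof -
  define a b c where "a = ip d w (X w)" and "b = ip d u (X w)" and "c = ip d u (X u)"
  have q: "0 \<le> c + 2 * t * b + t\<^sup>2 * a" for t
  proof -
    let ?v = "\<lambda>i. u i + t * w i"
    have e: "ip d ?v z = ip d u z + t * ip d w z" for z
      using ip_add_right[of d z u "\<lambda>i. t * w i"] by (simp add: ip_scale_right ip_commute[of d _ z])
    \<comment> \<open>\<open>X\<close> is not known to be linear, so \<open>X ?v\<close> is never
      expanded: symmetry moves the operator onto \<open>u\<close> and \<open>w\<close>, and only the
      bare argument \<open>?v\<close> of \<open>ip\<close> is split.\<close>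
    have "ip d ?v (X ?v) = ip d u (X ?v) + t * ip d w (X ?v)" by (rule e)
    also have "\<dots> = ip d ?v (X u) + t * ip d ?v (X w)"
      by (simp only: psd_sym[OF assms, of u ?v] psd_sym[OF assms, of w ?v] ip_commute[of d "X _" ?v])
    also have "\<dots> = c + t * ip d w (X u) + t * (b + t * a)"
      by (simp only: e a_def b_def c_def)
    also have "ip d w (X u) = b"
      unfolding b_def by (simp add: psd_sym[OF assms, of w u] ip_commute)
    finally show ?thesis
      using psd_nonneg[OF assms, of ?v] by (simp add: algebra_simps power2_eq_square)
  qed
  have ac: "a \<ge> 0" "c \<ge> 0" unfolding a_def c_def by (rule psd_nonneg[OF assms])+
  have "b\<^sup>2 \<le> c * a"
  proof (cases "a = 0")
    case True
    have "b = 0"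
    proof (rule ccontr)
      assume "b \<noteq> 0"
      \<comment> \<open>With \<open>a = 0\<close> the quadratic degenerates to
        \<open>c + 2 * t * b\<close>, and this \<open>t\<close> gives it the value -1.\<close>
      then show False using q[of "-(c+1)/(2*b)"] True by (simp add: field_simps)
    qed
    then show ?thesis using True by simp
  next
    case False
    then have "a > 0" using ac by simp
    then show ?thesis using q[of "-b/a"] by (simp add: field_simps power2_eq_square)
  qed
  then show ?thesis by (simp add: a_def b_def c_def)
qed

section \<open>Powers and moments of a positive semidefinite operator\<close>

lemma psd_funpow_sym:
  assumes "psd d X" shows "ip d x ((X ^^ q) z) = ip d ((X ^^ q) x) z"
proof (induction q arbitrary: x z)
  case (Suc q)
  have "ip d x ((X ^^ Suc q) z) = ip d (X x) ((X ^^ q) z)" by (simp add: psd_sym[OF assms])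
  also have "\<dots> = ip d ((X ^^ q) (X x)) z" by (rule Suc)
  finally show ?case by (simp add: funpow_swap1)
qed simp

lemma psd_funpow_shift:
  assumes "psd d X" shows "ip d ((X ^^ i) x) ((X ^^ j) z) = ip d x ((X ^^ (i + j)) z)"
  by (simp add: psd_funpow_sym[OF assms, symmetric] funpow_add)

text \<open>Splitting the power in the middle leaves the squared norm of \<open>(X ^^ k) x\<close>
  for even \<open>q\<close> and the form of \<open>X\<close> at that vector for odd
  \<open>q\<close>.\<close>

lemma psd_funpow:
  assumes "psd d X" shows "psd d (X ^^ q)"
proof -
  have "0 \<le> ip d x ((X ^^ q) x)" for x
  proof (cases "even q")
    case True
    then obtain k where "q = k + k" by (metis evenE mult_2)
    then have "ip d x ((X ^^ q) x) = ip d ((X ^^ k) x) ((X ^^ k) x)"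
      by (simp add: psd_funpow_shift[OF assms])
    then show ?thesis by (simp add: ip_self_nonneg)
  next
    case False
    then obtain k where "q = k + Suc k" by (metis add_Suc_right mult_2 oddE Suc_eq_plus1)
    then have "ip d x ((X ^^ q) x) = ip d ((X ^^ k) x) ((X ^^ Suc k) x)"
      by (simp only: psd_funpow_shift[OF assms])
    then show ?thesis using psd_nonneg[OF assms, of "(X ^^ k) x"] by simp
  qed
  then show ?thesis by (simp add: psd_def psd_funpow_sym[OF assms])
qed

text \<open>Cauchy-Schwarz for the vectors \<open>(X ^^ k) y\<close> and
  \<open>(X ^^ Suc k) y\<close>, in the Euclidean form for even \<open>m\<close> and in the form of
  \<open>X\<close> for odd \<open>m\<close>.\<close>

lemma psd_moment_log_convex:
  assumes "psd d X"
  shows "(ip d y ((X ^^ Suc m) y))\<^sup>2 \<le> ip d y ((X ^^ m) y) * ip d y ((X ^^ Suc (Suc m)) y)"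
proof (cases "even m")
  case True
  then obtain k where m: "m = k + k" by (metis evenE mult_2)
  show ?thesis
    using psd_cauchy_schwarz[OF psd_id, of d "(X ^^ k) y" "(X ^^ Suc k) y"]
    unfolding psd_funpow_shift[OF assms] m by simp
next
  case False
  then obtain k where m: "m = k + Suc k" by (metis add_Suc_right mult_2 oddE Suc_eq_plus1)
  have s: "X ((X ^^ j) y) = (X ^^ Suc j) y" for j by simp
  show ?thesis
    using psd_cauchy_schwarz[OF assms, of "(X ^^ k) y" "(X ^^ Suc k) y"]
    unfolding s psd_funpow_shift[OF assms] m by simp
qed

text \<open>The ratios \<open>f (Suc m) / f m\<close> are nondecreasing; this is written without
  division because terms may vanish.\<close>

lemma log_convex_shift:
  fixes f :: "nat \<Rightarrow> real"
  assumes nn: "\<And>m. 0 \<le> f m" and lc: "\<And>m. (f (Suc m))\<^sup>2 \<le> f m * f (Suc (Suc m))"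
  shows "i \<le> j \<Longrightarrow> f (Suc i) * f j \<le> f i * f (Suc j)"
proof (induction j rule: dec_induct)
  case base then show ?case by (simp add: mult.commute)
next
  case (step j)
  show ?case
  proof (cases "f j = 0")
    case True
    \<comment> \<open>Log-convexity propagates a zero to the next term, so the left-hand side of the
      goal vanishes.\<close>
    then have "f (Suc j) = 0" using lc[of j] by simp
    then show ?thesis using nn by (simp add: mult_nonneg_nonneg)
  next
    case False
    then have pos: "f j > 0" using nn[of j] by simp
    have "f j * (f (Suc i) * f (Suc j)) = (f (Suc i) * f j) * f (Suc j)" by simp
    also have "\<dots> \<le> (f i * f (Suc j)) * f (Suc j)"
      using step.IH nn by (intro mult_right_mono) auto
    also have "\<dots> = f i * (f (Suc j))\<^sup>2" by (simp add: power2_eq_square)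
    also have "\<dots> \<le> f i * (f j * f (Suc (Suc j)))"
      using lc nn by (intro mult_left_mono) auto
    also have "\<dots> = f j * (f i * f (Suc (Suc j)))" by simp
    finally show ?thesis using pos by simp
  qed
qed

text \<open>The two indices are pushed apart one unit at a time, with fixed sum, until the smaller
  one reaches 0; no push decreases the product.\<close>

lemma log_convex_mult_le:
  fixes f :: "nat \<Rightarrow> real"
  assumes nn: "\<And>m. 0 \<le> f m" and lc: "\<And>m. (f (Suc m))\<^sup>2 \<le> f m * f (Suc (Suc m))"
  shows "f i * f j \<le> f 0 * f (i + j)"
proof -
  have *: "i \<le> j \<Longrightarrow> f i * f j \<le> f 0 * f (i + j)" for i j
  proof (induction i arbitrary: j)
    case (Suc i)
    have "f (Suc i) * f j \<le> f i * f (Suc j)"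
      using Suc.prems by (intro log_convex_shift[where f = f] nn lc) auto
    also have "\<dots> \<le> f 0 * f (i + Suc j)" using Suc.prems by (intro Suc.IH) auto
    finally show ?case by simp
  qed simp
  show ?thesis using *[of i j] *[of j i] by (cases "i \<le> j") (auto simp: mult.commute add.commute)
qed

lemma psd_moment_mult_le:
  assumes "psd d X"
  shows "ip d y ((X ^^ i) y) * ip d y ((X ^^ j) y) \<le> ip d y y * ip d y ((X ^^ (i + j)) y)"
  using log_convex_mult_le[of "\<lambda>m. ip d y ((X ^^ m) y)" i j, OF psd_nonneg[OF psd_funpow[OF assms]]
      psd_moment_log_convex[OF assms]] by simp

lemma op_trace_nonneg: "psd d X \<Longrightarrow> 0 \<le> op_trace d X"
  unfolding op_trace_def by (intro sum_nonneg psd_nonneg)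

text \<open>Stands in for bounding the largest eigenvalue by the trace. Cauchy-Schwarz is used
  twice, for the Euclidean form and then, for each basis vector, for the form of \<open>P\<close>; a
  common factor \<open>A\<close> cancels at the end.\<close>

lemma psd_form_le_trace:
  assumes "psd d P" shows "ip d x (P x) \<le> ip d x x * op_trace d P"
proof -
  define A where "A = ip d x (P x)"
  have A0: "A \<ge> 0" unfolding A_def by (rule psd_nonneg[OF assms])
  have "ip d x (P x) = ip d x (\<lambda>i. ip d (std_vec i) (P x))"
    using ip_expand[of d x "P x"] by (simp add: ip_def)
  then have "A\<^sup>2 = (ip d x (\<lambda>i. ip d (std_vec i) (P x)))\<^sup>2" by (simp add: A_def)
  also have "\<dots> \<le> ip d x x * (\<Sum>i<d. (ip d (std_vec i) (P x))\<^sup>2)"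
    using psd_cauchy_schwarz[OF psd_id, of d x "\<lambda>i. ip d (std_vec i) (P x)"]
    by (simp add: ip_def power2_eq_square)
  also have "\<dots> \<le> ip d x x * (\<Sum>i<d. ip d (std_vec i) (P (std_vec i)) * A)"
    unfolding A_def
    by (intro mult_left_mono ip_self_nonneg sum_mono psd_cauchy_schwarz assms)
  also have "\<dots> = A * (ip d x x * op_trace d P)"
    by (simp add: op_trace_def sum_distrib_left sum_distrib_right algebra_simps)
  finally have "A * A \<le> A * (ip d x x * op_trace d P)" by (simp add: power2_eq_square)
  then have "A \<le> ip d x x * op_trace d P \<or> A = 0"
    using A0 by (auto simp: mult_le_cancel_left)
  moreover have "0 \<le> ip d x x * op_trace d P"
    by (intro mult_nonneg_nonneg ip_self_nonneg op_trace_nonneg assms)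
  ultimately show ?thesis by (auto simp: A_def)
qed

lemma psd_moment_Suc_le:
  assumes "psd d X"
  shows "ip d y ((X ^^ Suc q) y) \<le> op_trace d X * ip d y ((X ^^ q) y)"
proof (cases "even q")
  case True
  then obtain k where q: "q = k + k" by (metis evenE mult_2)
  have s: "X ((X ^^ j) y) = (X ^^ Suc j) y" for j by simp
  show ?thesis
    using psd_form_le_trace[OF assms, of "(X ^^ k) y"]
    unfolding s psd_funpow_shift[OF assms] q by (simp add: mult.commute)
next
  case False
  then obtain k where q: "q = k + Suc k" by (metis add_Suc_right mult_2 oddE Suc_eq_plus1)
  have s: "X ((X ^^ j) y) = (X ^^ Suc j) y" for j by simp
  define g where "g m = ip d y ((X ^^ m) y)" for m
  have nn: "g m \<ge> 0" for m unfolding g_def by (rule psd_nonneg[OF psd_funpow[OF assms]])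
  have T: "0 \<le> op_trace d X" by (rule op_trace_nonneg[OF assms])
  have lc: "(g (Suc q))\<^sup>2 \<le> g q * g (Suc (Suc q))"
    unfolding g_def by (rule psd_moment_log_convex[OF assms])
  \<comment> \<open>For odd \<open>q\<close> the trace bound is directly available only one index
    higher; log-convexity carries it back down to \<open>q\<close>.\<close>
  have "g (Suc (Suc q)) \<le> op_trace d X * g (Suc q)"
    using psd_form_le_trace[OF assms, of "(X ^^ Suc k) y"]
    unfolding s psd_funpow_shift[OF assms] q g_def by (simp add: mult.commute)
  then have "g (Suc q) * g (Suc q) \<le> g q * (op_trace d X * g (Suc q))"
    using lc nn[of q] by (metis mult_left_mono order_trans power2_eq_square)
  then have "g (Suc q) * g (Suc q) \<le> g (Suc q) * (op_trace d X * g q)"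
    by (simp only: ac_simps)
  then have "g (Suc q) \<le> op_trace d X * g q \<or> g (Suc q) = 0"
    using nn[of "Suc q"] by (auto simp: mult_le_cancel_left)
  then show ?thesis using nn[of q] T by (auto simp: g_def)
qed

lemma psd_moment_le:
  assumes "psd d X"
  shows "ip d y ((X ^^ q) y) \<le> op_trace d X ^ q * ip d y y"
proof (induction q)
  case (Suc q)
  have "ip d y ((X ^^ Suc q) y) \<le> op_trace d X * ip d y ((X ^^ q) y)"
    by (rule psd_moment_Suc_le[OF assms])
  also have "\<dots> \<le> op_trace d X * (op_trace d X ^ q * ip d y y)"
    by (intro mult_left_mono Suc op_trace_nonneg assms)
  finally show ?case by simp
qed simp

section \<open>Exponential series of moments\<close>

lemma form_exp_summable:
  assumes "psd d X" shows "summable (\<lambda>q. ip d y ((X ^^ q) y) / fact q)"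
proof (rule summable_comparison_test')
  show "summable (\<lambda>q. ip d y y * (inverse (fact q) * op_trace d X ^ q))"
    by (intro summable_mult summable_exp)
  show "norm (ip d y ((X ^^ q) y) / fact q) \<le> ip d y y * (inverse (fact q) * op_trace d X ^ q)" for q
    using psd_moment_le[OF assms, of y q] psd_nonneg[OF psd_funpow[OF assms, of q], of y]
    by (simp add: field_simps)
qed

lemma trace_exp_summable:
  assumes "psd d X" shows "summable (\<lambda>q. op_trace d (X ^^ q) / fact q)"
  unfolding op_trace_def sum_divide_distrib
  by (intro summable_sum form_exp_summable assms)

lemma form_exp_nonneg: "psd d X \<Longrightarrow> 0 \<le> form_exp d X y"
  unfolding form_exp_def
  by (intro suminf_nonneg form_exp_summable divide_nonneg_nonneg psd_nonneg psd_funpow) auto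

lemma form_exp_scale: 
  assumes "psd d X" shows "form_exp d X (\<lambda>i. c * y i) = c\<^sup>2 * form_exp d X y"
proof -
  have "ip d (\<lambda>i. c * y i) ((X ^^ q) (\<lambda>i. c * y i)) = c\<^sup>2 * ip d y ((X ^^ q) y)" for q
  proof -
    have "ip d (\<lambda>i. c * y i) ((X ^^ q) (\<lambda>i. c * y i)) = c * ip d y ((X ^^ q) (\<lambda>i. c * y i))"
      by (rule ip_scale_left)
    also have "ip d y ((X ^^ q) (\<lambda>i. c * y i)) = c * ip d y ((X ^^ q) y)"
      by (simp add: psd_funpow_sym[OF assms] ip_scale_right)
    finally show ?thesis by (simp add: power2_eq_square)
  qed
  then show ?thesis unfolding form_exp_def
    using suminf_mult[OF form_exp_summable[OF assms, of y], of "c\<^sup>2"] by simp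
qed

lemma form_exp_le_trace_exp:
  assumes "psd d X" shows "form_exp d X y \<le> ip d y y * trace_exp d X"
proof -
  have "form_exp d X y \<le> (\<Sum>q. ip d y y * (op_trace d (X ^^ q) / fact q))"
    unfolding form_exp_def
    using psd_form_le_trace[OF psd_funpow[OF assms]]
    by (intro suminf_le form_exp_summable summable_mult trace_exp_summable assms)
       (auto intro!: divide_right_mono)
  then show ?thesis
    unfolding trace_exp_def using suminf_mult[OF trace_exp_summable[OF assms]] by simp
qed

lemma trace_exp_nonneg: "psd d X \<Longrightarrow> 0 \<le> trace_exp d X"
  unfolding trace_exp_def
  by (intro suminf_nonneg trace_exp_summable divide_nonneg_nonneg op_trace_nonneg psd_funpow) auto

section \<open>Mixed words in an operator and its rank-one update\<close>

lemma mixed_moment_step: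
  fixes y :: "nat \<Rightarrow> real"
  assumes "psd d X"
  defines "A \<equiv> rank1_update d y X"
  shows "ip d u ((X ^^ i) ((A ^^ Suc j) v)) =
    ip d u ((X ^^ Suc i) ((A ^^ j) v)) + ip d u ((X ^^ i) y) * ip d y ((A ^^ j) v)"
proof -
  have "ip d u ((X ^^ i) (A w)) = ip d u ((X ^^ Suc i) w) + ip d u ((X ^^ i) y) * ip d y w" for w
  proof -
    have "ip d u ((X ^^ i) (A w)) = ip d ((X ^^ i) u) (A w)"
      by (rule psd_funpow_sym[OF assms(1)])
    also have "\<dots> = ip d ((X ^^ i) u) (X w) + ip d y w * ip d ((X ^^ i) u) y"
      unfolding A_def by (rule ip_rank1_update)
    finally show ?thesis
      by (simp add: psd_funpow_sym[OF assms(1), symmetric] funpow_swap1)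
  qed
  then show ?thesis by simp
qed

text \<open>The two words differ in one factor, \<open>X\<close> against
  \<open>A = X + y y^T\<close>, and the extra term is a product of two nonnegative moments.\<close>

lemma mixed_moment_nonneg_mono:
  fixes y :: "nat \<Rightarrow> real"
  assumes "psd d X"
  defines "A \<equiv> rank1_update d y X"
  shows "ip d y ((X ^^ Suc i) ((A ^^ j) y)) \<le> ip d y ((X ^^ i) ((A ^^ Suc j) y))"
proof -
  have "psd d A" unfolding A_def by (rule psd_rank1_update[OF assms(1)])
  then have "0 \<le> ip d y ((X ^^ i) y) * ip d y ((A ^^ j) y)"
    by (intro mult_nonneg_nonneg psd_nonneg psd_funpow assms(1))
  then show ?thesis unfolding A_def mixed_moment_step[OF assms(1)] by simp
qed

lemma mixed_moment_ge:
  assumes "psd d X"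
  shows "ip d y ((X ^^ (i + j)) y) \<le> ip d y ((X ^^ i) ((rank1_update d y X ^^ j) y))"
proof (induction j arbitrary: i)
  case (Suc j)
  then show ?case
    using Suc[of "Suc i"] mixed_moment_nonneg_mono[OF assms, where y = y and i = i and j = j] by simp
qed simp

lemma mixed_moment_le:
  assumes "psd d X"
  shows "ip d y ((X ^^ i) ((rank1_update d y X ^^ j) y)) \<le> ip d y ((rank1_update d y X ^^ (i + j)) y)"
proof (induction i arbitrary: j)
  case (Suc i)
  then show ?case
    using Suc[of "Suc j"] mixed_moment_nonneg_mono[OF assms, where y = y and i = i and j = j] by simp
qed simp

text \<open>The scalar form of the Golden--Thompson inequality for a rank-one perturbation: the right-hand
  side is what the binomial theorem would give if \<open>X\<close> and \<open>y y\<^sup>T\<close> commuted. The noncommuting words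
  are controlled by \<open>psd_moment_mult_le\<close>, a Chebyshev-type correlation inequality for
  the moments \<open>\<langle>y, X\<^sup>m y\<rangle>\<close>.\<close>

lemma mixed_moment_binomial:
  assumes "psd d X"
  shows "ip d y ((X ^^ i) ((rank1_update d y X ^^ j) y))
    \<le> (\<Sum>k\<le>j. real (j choose k) * ip d y y ^ k * ip d y ((X ^^ (i + j - k)) y))"
proof (induction j arbitrary: i)
  case 0
  show ?case by simp
next
  case (Suc j)
  let ?A = "rank1_update d y X"
  define \<beta> where "\<beta> = ip d y y"
  define b where "b m = ip d y ((X ^^ m) y)" for m
  have b0: "0 \<le> b m" for m unfolding b_def by (intro psd_nonneg psd_funpow assms)
  have \<beta>0: "0 \<le> \<beta>" unfolding \<beta>_def by (rule ip_self_nonneg)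
  have bb: "b m * b m' \<le> \<beta> * b (m + m')" for m m'
    unfolding b_def \<beta>_def by (rule psd_moment_mult_le[OF assms])
  have "ip d y ((X ^^ i) ((?A ^^ Suc j) y))
      = ip d y ((X ^^ Suc i) ((?A ^^ j) y)) + b i * ip d y ((X ^^ 0) ((?A ^^ j) y))"
    unfolding mixed_moment_step[OF assms] b_def by simp
  also have "\<dots> \<le> (\<Sum>k\<le>j. real (j choose k) * \<beta> ^ k * b (Suc i + j - k))
      + b i * (\<Sum>k\<le>j. real (j choose k) * \<beta> ^ k * b (0 + j - k))"
    unfolding \<beta>_def b_def[of "_ - _"]
    by (intro add_mono Suc mult_left_mono b0)
  also have "b i * (\<Sum>k\<le>j. real (j choose k) * \<beta> ^ k * b (0 + j - k))
      = (\<Sum>k\<le>j. real (j choose k) * \<beta> ^ k * (b i * b (j - k)))"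
    by (simp add: sum_distrib_left ac_simps)
  also have "\<dots> \<le> (\<Sum>k\<le>j. real (j choose k) * \<beta> ^ k * (\<beta> * b (i + (j - k))))"
    by (intro sum_mono mult_left_mono bb mult_nonneg_nonneg zero_le_power \<beta>0) auto
  also have "\<dots> = (\<Sum>k\<le>j. real (j choose k) * \<beta> ^ Suc k * b (i + Suc j - Suc k))"
    by (intro sum.cong) (auto simp: ac_simps)
  also have "(\<Sum>k\<le>j. real (j choose k) * \<beta> ^ k * b (Suc i + j - k)) +
      (\<Sum>k\<le>j. real (j choose k) * \<beta> ^ Suc k * b (i + Suc j - Suc k))
    = (\<Sum>k\<le>Suc j. real (Suc j choose k) * \<beta> ^ k * b (i + Suc j - k))"
  proof -
    have "(\<Sum>k\<le>j. real (j choose k) * \<beta> ^ k * b (Suc i + j - k))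
        = (\<Sum>k\<le>Suc j. real (j choose k) * \<beta> ^ k * b (i + Suc j - k))"
      by simp
    also have "\<dots> = b (i + Suc j)
        + (\<Sum>k\<le>j. real (j choose Suc k) * \<beta> ^ Suc k * b (i + Suc j - Suc k))"
      by (subst sum.atMost_Suc_shift) simp
    moreover have "(\<Sum>k\<le>j. real (Suc j choose Suc k) * (\<beta> ^ Suc k * b (i + Suc j - Suc k)))
        = (\<Sum>k\<le>j. real (j choose k) * (\<beta> ^ Suc k * b (i + Suc j - Suc k)))
          + (\<Sum>k\<le>j. real (j choose Suc k) * (\<beta> ^ Suc k * b (i + Suc j - Suc k)))"
      by (simp only: binomial_Suc_Suc of_nat_add distrib_right sum.distrib)
    moreover have "(\<Sum>k\<le>Suc j. real (Suc j choose k) * \<beta> ^ k * b (i + Suc j - k))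
        = b (i + Suc j) + (\<Sum>k\<le>j. real (Suc j choose Suc k) * (\<beta> ^ Suc k * b (i + Suc j - Suc k)))"
      by (subst sum.atMost_Suc_shift) (simp only: mult.assoc binomial_n_0 power_0 of_nat_1 mult_1 diff_zero)
    ultimately show ?thesis by (simp only: mult.assoc add.assoc)
  qed
  finally show ?case by (simp add: \<beta>_def b_def)
qed

text \<open>The binomial bound, divided by \<open>fact q\<close>, is the \<open>q\<close>-th term of
  the Cauchy product of the series for \<open>exp (ip d y y)\<close> and for
  \<open>form_exp d X y\<close>.\<close>

lemma form_exp_rank1_update_le:
  assumes "psd d X"
  shows "form_exp d (rank1_update d y X) y \<le> exp (ip d y y) * form_exp d X y"
proof -
  let ?A = "rank1_update d y X"
  define \<beta> where "\<beta> = ip d y y"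
  define f g where "f k = \<beta> ^ k / fact k" and "g q = ip d y ((X ^^ q) y) / fact q" for k q
  have \<beta>0: "0 \<le> \<beta>" unfolding \<beta>_def by (rule ip_self_nonneg)
  have f: "f sums exp \<beta>" using exp_converges[of \<beta>] by (simp add: f_def[abs_def] divide_inverse mult.commute)
  have f0: "0 \<le> f k" for k using \<beta>0 by (simp add: f_def)
  have g: "summable g" unfolding g_def by (rule form_exp_summable[OF assms])
  have g0: "0 \<le> g k" for k unfolding g_def by (simp add: psd_nonneg psd_funpow assms)
  have prod: "(\<lambda>q. \<Sum>k\<le>q. f k * g (q - k)) sums (exp \<beta> * form_exp d X y)"
  proof -
    have "form_exp d X y = suminf g" unfolding form_exp_def g_def ..
    moreover have "summable (\<lambda>k. norm (f k))" "summable (\<lambda>k. norm (g k))"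
      using f g f0 g0 by (simp_all add: sums_iff)
    ultimately show ?thesis
      using Cauchy_product_sums[of f g] f by (simp add: sums_iff)
  qed
  have "form_exp d ?A y \<le> (\<Sum>q. \<Sum>k\<le>q. f k * g (q - k))"
    unfolding form_exp_def
  proof (intro suminf_le form_exp_summable psd_rank1_update assms)
    show "summable (\<lambda>q. \<Sum>k\<le>q. f k * g (q - k))" using prod by (rule sums_summable)
    fix q
    have "ip d y ((?A ^^ q) y) \<le> (\<Sum>k\<le>q. real (q choose k) * \<beta> ^ k * ip d y ((X ^^ (q - k)) y))"
      using mixed_moment_binomial[OF assms, of y 0 q] by (simp add: \<beta>_def)
    then have "ip d y ((?A ^^ q) y) / fact q
        \<le> (\<Sum>k\<le>q. real (q choose k) * \<beta> ^ k * ip d y ((X ^^ (q - k)) y)) / fact q"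
      by (simp add: divide_right_mono)
    also have "\<dots> = (\<Sum>k\<le>q. f k * g (q - k))"
      unfolding sum_divide_distrib
      by (intro sum.cong) (auto simp: f_def g_def binomial_fact field_simps)
    finally show "ip d y ((?A ^^ q) y) / fact q \<le> (\<Sum>k\<le>q. f k * g (q - k))" .
  qed
  then show ?thesis using prod by (simp add: sums_iff \<beta>_def)
qed

section \<open>Trace increments under a rank-one update\<close>

lemma op_trace_mixed_step:
  fixes y :: "nat \<Rightarrow> real"
  assumes "psd d X"
  defines "A \<equiv> rank1_update d y X"
  shows "op_trace d (\<lambda>v. (X ^^ i) ((A ^^ Suc j) v))
     = op_trace d (\<lambda>v. (X ^^ Suc i) ((A ^^ j) v)) + ip d y ((X ^^ i) ((A ^^ j) y))"
proof -
  have A: "psd d A" unfolding A_def by (rule psd_rank1_update[OF assms(1)])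
  have "(\<Sum>e<d. ip d (std_vec e) ((X ^^ i) y) * ip d y ((A ^^ j) (std_vec e)))
      = (\<Sum>e<d. ((X ^^ i) y) e * ((A ^^ j) y) e)"
    using psd_funpow_sym[OF A, of y j] by (intro sum.cong) (auto simp: ip_std_vec ip_commute[of d _ "std_vec _"])
  also have "\<dots> = ip d y ((X ^^ i) ((A ^^ j) y))"
    using psd_funpow_sym[OF assms(1), of y i] by (simp add: ip_def)
  finally show ?thesis
    unfolding op_trace_def A_def mixed_moment_step[OF assms(1)] by (simp add: sum.distrib)
qed

text \<open>Telescopes along the words \<open>X^(q-j) A^j\<close>, from \<open>X^q\<close> at
  \<open>j = 0\<close> to \<open>A^q\<close> at \<open>j = q\<close>; each exchange of one factor
  leaves a single mixed moment.\<close>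

lemma op_trace_diff:
  fixes y :: "nat \<Rightarrow> real"
  assumes "psd d X"
  defines "A \<equiv> rank1_update d y X"
  shows "op_trace d (A ^^ q) - op_trace d (X ^^ q) = (\<Sum>j<q. ip d y ((X ^^ (q - Suc j)) ((A ^^ j) y)))"
proof -
  have "j \<le> q \<Longrightarrow> op_trace d (\<lambda>v. (X ^^ (q - j)) ((A ^^ j) v)) - op_trace d (X ^^ q)
      = (\<Sum>m<j. ip d y ((X ^^ (q - Suc m)) ((A ^^ m) y)))" for j
  proof (induction j)
    case (Suc j)
    then have "q - j = Suc (q - Suc j)" by simp
    then show ?case
      using Suc op_trace_mixed_step[OF assms(1), where y = y and i = "q - Suc j" and j = j] by (simp add: A_def del: funpow.simps)
  qed (simp add: op_trace_def)
  from this[of q] show ?thesis by simp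
qed

text \<open>Each of the \<open>Suc q\<close> mixed moments in the telescoped difference lies between
  the pure moments of \<open>X\<close> and of \<open>A\<close>.\<close>

lemma op_trace_diff_bounds:
  fixes y :: "nat \<Rightarrow> real"
  assumes "psd d X"
  defines "A \<equiv> rank1_update d y X"
  shows "real (Suc q) * ip d y ((X ^^ q) y) \<le> op_trace d (A ^^ Suc q) - op_trace d (X ^^ Suc q)"
    and "op_trace d (A ^^ Suc q) - op_trace d (X ^^ Suc q) \<le> real (Suc q) * ip d y ((A ^^ q) y)"
proof -
  have "(\<Sum>j<Suc q. ip d y ((X ^^ q) y)) \<le> (\<Sum>j<Suc q. ip d y ((X ^^ (Suc q - Suc j)) ((A ^^ j) y)))"
    using mixed_moment_ge[OF assms(1), of y "q - _" "_"]
    by (intro sum_mono) (metis A_def diff_Suc_Suc le_add_diff_inverse2 lessThan_iff less_Suc_eq_le)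
  then show "real (Suc q) * ip d y ((X ^^ q) y) \<le> op_trace d (A ^^ Suc q) - op_trace d (X ^^ Suc q)"
    unfolding A_def op_trace_diff[OF assms(1)] by simp
  have "(\<Sum>j<Suc q. ip d y ((X ^^ (Suc q - Suc j)) ((A ^^ j) y))) \<le> (\<Sum>j<Suc q. ip d y ((A ^^ q) y))"
    using mixed_moment_le[OF assms(1), of y "q - _" "_"]
    by (intro sum_mono) (metis A_def diff_Suc_Suc le_add_diff_inverse2 lessThan_iff less_Suc_eq_le)
  then show "op_trace d (A ^^ Suc q) - op_trace d (X ^^ Suc q) \<le> real (Suc q) * ip d y ((A ^^ q) y)"
    unfolding A_def op_trace_diff[OF assms(1)] by simp
qed

text \<open>This expresses convexity of \<open>tr exp (X + s y y^T)\<close> in \<open>s\<close>: the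
  increment over the unit interval lies between the derivatives at its two ends, which are the two
  values of \<open>form_exp\<close>.\<close>

lemma trace_exp_diff_bounds:
  fixes y :: "nat \<Rightarrow> real"
  assumes "psd d X"
  defines "A \<equiv> rank1_update d y X"
  shows "form_exp d X y \<le> trace_exp d A - trace_exp d X"
    and "trace_exp d A - trace_exp d X \<le> form_exp d A y"
proof -
  have A: "psd d A" unfolding A_def by (rule psd_rank1_update[OF assms(1)])
  define D where "D q = op_trace d (A ^^ q) / fact q - op_trace d (X ^^ q) / fact q" for q
  have sD: "summable D" unfolding D_def
    by (intro summable_diff trace_exp_summable A assms(1))
  have "trace_exp d A - trace_exp d X = (\<Sum>q. D q)"
    unfolding trace_exp_def D_def
    by (rule suminf_diff) (intro trace_exp_summable A assms(1))+
  also have "\<dots> = (\<Sum>q. D (Suc q))"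
  proof -
    have "D 0 = 0" by (simp add: D_def op_trace_def)
    then show ?thesis using suminf_split_head[OF sD] by simp
  qed
  finally have e: "trace_exp d A - trace_exp d X = (\<Sum>q. D (Suc q))" .
  have s: "summable (\<lambda>q. D (Suc q))" using sD by (simp add: summable_Suc_iff)
  \<comment> \<open>The \<open>Suc q\<close> mixed moments of the difference cancel one factor of
    \<open>fact (Suc q)\<close>, so after the index shift the increments can be compared term by
    term with the series of \<open>form_exp\<close>.\<close>
  have D: "D (Suc q) = (op_trace d (A ^^ Suc q) - op_trace d (X ^^ Suc q)) / (real (Suc q) * fact q)" for q
    by (simp only: D_def diff_divide_distrib fact_Suc of_nat_mult of_nat_fact)
  have lo: "ip d y ((X ^^ q) y) / fact q \<le> D (Suc q)" for q
  proof -
    have "ip d y ((X ^^ q) y) / fact q = real (Suc q) * ip d y ((X ^^ q) y) / (real (Suc q) * fact q)"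
      by simp
    also have "\<dots> \<le> D (Suc q)"
      unfolding D A_def by (intro divide_right_mono op_trace_diff_bounds assms(1)) auto
    finally show ?thesis .
  qed
  have hi: "D (Suc q) \<le> ip d y ((A ^^ q) y) / fact q" for q
  proof -
    have "D (Suc q) \<le> real (Suc q) * ip d y ((A ^^ q) y) / (real (Suc q) * fact q)"
      unfolding D A_def by (intro divide_right_mono op_trace_diff_bounds assms(1)) auto
    then show ?thesis by simp
  qed
  show "form_exp d X y \<le> trace_exp d A - trace_exp d X"
    unfolding e form_exp_def by (intro suminf_le lo s form_exp_summable assms(1))
  show "trace_exp d A - trace_exp d X \<le> form_exp d A y"
    unfolding e form_exp_def by (intro suminf_le hi s form_exp_summable A)
qed

section \<open>From infinitesimal steps to a whole rank-one update\<close>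

lemma rank1_update_scale:
  "rank1_update d (\<lambda>i. s * y i) X = (\<lambda>x i. X x i + s\<^sup>2 * (ip d y x * y i))"
  unfolding rank1_update_def ip_scale_left by (simp add: power2_eq_square ac_simps)

lemma rank1_update_twice:
  "rank1_update d (\<lambda>i. s * y i) (rank1_update d (\<lambda>i. t * y i) X)
    = rank1_update d (\<lambda>i. sqrt (s\<^sup>2 + t\<^sup>2) * y i) X"
  unfolding rank1_update_scale by (intro ext) (simp add: algebra_simps)

text \<open>The sum is geometric. Both signs of \<open>c\<close> occur, positive for the upper and
  negative for the lower update bound.\<close>

lemma riemann_sum_exp_tendsto:
  fixes c :: real
  assumes "c \<noteq> 0"
  shows "(\<lambda>N. (\<Sum>j<N. exp (real (Suc j) * c / real N)) / real N) \<longlonglongrightarrow> (exp c - 1) / c"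
proof (rule Lim_transform_eventually)
  have "(\<lambda>N::nat. exp (c / real N)) \<longlonglongrightarrow> 1" "(\<lambda>N::nat. real N * (exp (c / real N) - 1)) \<longlonglongrightarrow> c"
    by real_asymp+
  then have "(\<lambda>N::nat. exp (c / real N) * (exp c - 1) / (real N * (exp (c / real N) - 1)))
      \<longlonglongrightarrow> 1 * (exp c - 1) / c"
    using assms by (intro tendsto_intros)
  then show "(\<lambda>N::nat. exp (c / real N) * (exp c - 1) / (real N * (exp (c / real N) - 1)))
      \<longlonglongrightarrow> (exp c - 1) / c"
    by simp
  show "\<forall>\<^sub>F N in sequentially. exp (c / real N) * (exp c - 1) / (real N * (exp (c / real N) - 1))
      = (\<Sum>j<N. exp (real (Suc j) * c / real N)) / real N"
    using eventually_gt_at_top[of 0]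
  proof eventually_elim
    case (elim N)
    let ?x = "exp (c / real N)"
    have x: "?x \<noteq> 1" using assms elim by simp
    have p: "?x ^ N = exp c" using elim by (simp flip: exp_of_nat_mult)
    have "(\<Sum>j<N. exp (real (Suc j) * c / real N)) = (\<Sum>j<N. ?x * ?x ^ j)"
      by (intro sum.cong) (auto simp: add_divide_distrib distrib_right exp_add simp flip: exp_of_nat_mult)
    also have "\<dots> = ?x * ((exp c - 1) / (?x - 1))"
      by (simp add: sum_distrib_left[symmetric] geometric_sum[OF x] p)
    finally show ?case by simp
  qed
qed

text \<open>Splitting \<open>y y\<^sup>T\<close> into \<open>N\<close> equal pieces turns the crude one-step bounds into Riemann sums of
  \<open>exp\<close>, whose limits are the sharp constants of the matrix Chernoff bound.\<close>

locale psd_line =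
  fixes d :: nat and X :: "(nat \<Rightarrow> real) \<Rightarrow> nat \<Rightarrow> real" and y :: "nat \<Rightarrow> real"
    and b :: real and N :: nat
  assumes X: "psd d X" and b: "ip d y y \<le> b" and N: "N > 0"
begin

text \<open>Equally spaced points on the segment from \<open>X\<close> to \<open>X + y y^T\<close>;
  the square root appears because \<open>rank1_update\<close> is quadratic in its vector.\<close>

definition L :: "nat \<Rightarrow> (nat \<Rightarrow> real) \<Rightarrow> nat \<Rightarrow> real" where
  "L j = rank1_update d (\<lambda>i. sqrt (real j / real N) * y i) X"

abbreviation w :: "nat \<Rightarrow> real" where "w \<equiv> \<lambda>i. sqrt (1 / real N) * y i"

lemma L_psd: "psd d (L j)"
  unfolding L_def by (rule psd_rank1_update[OF X])

lemma L_0: "L 0 = X"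
  by (simp add: L_def rank1_update_def ip_def)

lemma L_N: "L N = rank1_update d y X"
  using N by (simp add: L_def)

lemma L_Suc: "L (Suc j) = rank1_update d w (L j)"
proof -
  have "1 / real N + real j / real N = real (Suc j) / real N"
    by (simp add: add_divide_distrib)
  then show ?thesis unfolding L_def rank1_update_twice by simp
qed

lemma form_exp_w: "psd d Z \<Longrightarrow> form_exp d Z w = form_exp d Z y / real N"
  by (simp only: form_exp_scale) simp

lemma form_exp_L_Suc: "form_exp d (L (Suc j)) y \<le> exp (b / real N) * form_exp d (L j) y"
proof -
  have "form_exp d (L (Suc j)) w \<le> exp (ip d w w) * form_exp d (L j) w"
    unfolding L_Suc by (rule form_exp_rank1_update_le[OF L_psd])
  also have "\<dots> \<le> exp (b / real N) * form_exp d (L j) w"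
    using b N by (intro mult_right_mono form_exp_nonneg L_psd)
      (simp add: ip_scale_left ip_scale_right divide_right_mono flip: mult.assoc)
  finally show ?thesis
    unfolding form_exp_w[OF L_psd] using N by (simp add: field_simps)
qed

lemma form_exp_L_mono:
  "i \<le> j \<Longrightarrow> form_exp d (L j) y \<le> exp (real (j - i) * b / real N) * form_exp d (L i) y"
proof (induction j rule: dec_induct)
  case (step j)
  have "form_exp d (L (Suc j)) y \<le> exp (b / real N) * form_exp d (L j) y"
    by (rule form_exp_L_Suc)
  also have "\<dots> \<le> exp (b / real N) * (exp (real (j - i) * b / real N) * form_exp d (L i) y)"
    by (intro mult_left_mono step.IH) simp
  also have "\<dots> = exp (real (Suc j - i) * b / real N) * form_exp d (L i) y"
    using step.hyps by (simp add: exp_add[symmetric] Suc_diff_le add_divide_distrib distrib_right)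
  finally show ?case .
qed simp

lemma trace_exp_telescope:
  "trace_exp d (rank1_update d y X) - trace_exp d X = (\<Sum>j<N. trace_exp d (L (Suc j)) - trace_exp d (L j))"
  using sum_lessThan_telescope[of "\<lambda>j. trace_exp d (L j)" N] by (simp only: L_N L_0)

text \<open>Convexity bounds the increment on each piece by the derivative at its right end, and
  that derivative has grown since the start of the segment by at most the exponential
  weight.\<close>

lemma trace_exp_upper:
  "trace_exp d (rank1_update d y X) - trace_exp d X
    \<le> (\<Sum>j<N. exp (real (Suc j) * b / real N)) / real N * form_exp d X y"
proof -
  have "trace_exp d (rank1_update d y X) - trace_exp d X
      \<le> (\<Sum>j<N. exp (real (Suc j) * b / real N) / real N * form_exp d X y)"
    unfolding trace_exp_telescope
  proof (intro sum_mono)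
    fix j
    have "trace_exp d (L (Suc j)) - trace_exp d (L j) \<le> form_exp d (L (Suc j)) y / real N"
      using trace_exp_diff_bounds(2)[OF L_psd[of j], of w]
      unfolding L_Suc[symmetric] form_exp_w[OF L_psd] .
    also have "\<dots> \<le> exp (real (Suc j) * b / real N) * form_exp d X y / real N"
      using form_exp_L_mono[of 0 "Suc j"] by (intro divide_right_mono) (simp_all add: L_0)
    finally show "trace_exp d (L (Suc j)) - trace_exp d (L j)
        \<le> exp (real (Suc j) * b / real N) / real N * form_exp d X y" by simp
  qed
  then show ?thesis by (simp add: sum_distrib_right sum_divide_distrib)
qed

text \<open>Here the derivative at the left end of each piece is compared with the derivative at the
  end of the whole segment, so the weights decay with the distance to that end.\<close>

lemma trace_exp_lower:
  "(\<Sum>j<N. exp (real (Suc j) * - b / real N)) / real N * form_exp d (rank1_update d y X) y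
    \<le> trace_exp d (rank1_update d y X) - trace_exp d X"
proof -
  have "(\<Sum>j<N. exp (real (Suc j) * - b / real N) / real N * form_exp d (rank1_update d y X) y)
      = (\<Sum>j<N. exp (real (N - j) * - b / real N) / real N * form_exp d (rank1_update d y X) y)"
    by (subst sum.nat_diff_reindex[symmetric]) (intro sum.cong, auto)
  also have "\<dots> \<le> trace_exp d (rank1_update d y X) - trace_exp d X"
    unfolding trace_exp_telescope
  proof (intro sum_mono)
    fix j assume "j \<in> {..<N}"
    then have "form_exp d (L N) y \<le> exp (real (N - j) * b / real N) * form_exp d (L j) y"
      by (intro form_exp_L_mono) auto
    then have "exp (real (N - j) * - b / real N) * form_exp d (L N) y
        \<le> exp (real (N - j) * - b / real N) * (exp (real (N - j) * b / real N) * form_exp d (L j) y)"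
      by (intro mult_left_mono) auto
    also have "\<dots> = form_exp d (L j) y" by (simp add: exp_add[symmetric] flip: mult.assoc)
    finally have "exp (real (N - j) * - b / real N) * form_exp d (L N) y / real N
        \<le> form_exp d (L j) y / real N" by (intro divide_right_mono) auto
    also have "\<dots> \<le> trace_exp d (L (Suc j)) - trace_exp d (L j)"
      using trace_exp_diff_bounds(1)[OF L_psd[of j], of w]
      unfolding L_Suc[symmetric] form_exp_w[OF L_psd] .
    finally show "exp (real (N - j) * - b / real N) / real N * form_exp d (rank1_update d y X) y
        \<le> trace_exp d (L (Suc j)) - trace_exp d (L j)" by (simp add: L_N)
  qed
  finally show ?thesis by (simp add: sum_distrib_right sum_divide_distrib)
qed

end

text \<open>For commuting operators this is the chord bound
  \<open>exp x \<le> 1 + (exp b - 1) / b * x\<close> on the interval from 0 to \<open>b\<close>. The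
  constant arises here as the integral of \<open>exp (b * s)\<close> over the unit interval.\<close>

lemma trace_exp_update_le:
  assumes "psd d X" "ip d y y \<le> b" "0 < b"
  shows "trace_exp d (rank1_update d y X) \<le> trace_exp d X + (exp b - 1) / b * form_exp d X y"
proof -
  have "trace_exp d (rank1_update d y X) - trace_exp d X \<le> (exp b - 1) / b * form_exp d X y"
  proof (rule LIMSEQ_le_const)
    show "(\<lambda>N. (\<Sum>j<N. exp (real (Suc j) * b / real N)) / real N * form_exp d X y)
        \<longlonglongrightarrow> (exp b - 1) / b * form_exp d X y"
      using assms by (intro tendsto_mult_right riemann_sum_exp_tendsto) auto
    show "\<exists>M. \<forall>N\<ge>M. trace_exp d (rank1_update d y X) - trace_exp d X
        \<le> (\<Sum>j<N. exp (real (Suc j) * b / real N)) / real N * form_exp d X y"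
      using assms by (intro exI[of _ 1] allI impI psd_line.trace_exp_upper psd_line.intro) auto
  qed
  then show ?thesis by simp
qed

text \<open>Read backwards, this is the gain from removing a vector. The form is taken at the larger
  operator, the one that is known before the subtraction in the lower tail.\<close>

lemma trace_exp_update_ge:
  assumes "psd d X" "ip d y y \<le> b" "0 < b"
  shows "trace_exp d X + (1 - exp (- b)) / b * form_exp d (rank1_update d y X) y
    \<le> trace_exp d (rank1_update d y X)"
proof -
  have "(exp (- b) - 1) / (- b) * form_exp d (rank1_update d y X) y
      \<le> trace_exp d (rank1_update d y X) - trace_exp d X"
  proof (rule LIMSEQ_le_const2)
    show "(\<lambda>N. (\<Sum>j<N. exp (real (Suc j) * - b / real N)) / real N * form_exp d (rank1_update d y X) y)
        \<longlonglongrightarrow> (exp (- b) - 1) / (- b) * form_exp d (rank1_update d y X) y"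
      using assms by (intro tendsto_mult_right riemann_sum_exp_tendsto) auto
    show "\<exists>M. \<forall>N\<ge>M. (\<Sum>j<N. exp (real (Suc j) * - b / real N)) / real N
          * form_exp d (rank1_update d y X) y
        \<le> trace_exp d (rank1_update d y X) - trace_exp d X"
      using assms by (intro exI[of _ 1] allI impI psd_line.trace_exp_lower psd_line.intro) auto
  qed
  moreover have "(exp (- b) - 1) / (- b) = (1 - exp (- b)) / b"
    using assms(3) by (simp add: field_simps)
  ultimately show ?thesis by (simp only: le_diff_eq add.commute)
qed

text \<open>A Jensen inequality for powers: the moment inequality with exponents 1 and
  \<open>q\<close> contributes one factor \<open>t\<close> per step.\<close>

lemma psd_power_ge:
  assumes "psd d X" "t * ip d x x \<le> ip d x (X x)" "0 < ip d x x" "0 \<le> t"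
  shows "t ^ q * ip d x x \<le> ip d x ((X ^^ q) x)"
proof (induction q)
  case (Suc q)
  have "ip d x x * (t * ip d x ((X ^^ q) x)) \<le> ip d x (X x) * ip d x ((X ^^ q) x)"
    using assms(2) psd_nonneg[OF psd_funpow[OF assms(1)], of x q]
    by (metis mult.assoc mult.commute mult_right_mono)
  also have "\<dots> \<le> ip d x x * ip d x ((X ^^ Suc q) x)"
    using psd_moment_mult_le[OF assms(1), of x 1 q] by simp
  finally have "t * ip d x ((X ^^ q) x) \<le> ip d x ((X ^^ Suc q) x)"
    using assms(3) by (simp only: mult_le_cancel_left_pos)
  moreover have "t * (t ^ q * ip d x x) \<le> t * ip d x ((X ^^ q) x)"
    by (intro mult_left_mono Suc assms)
  ultimately show ?case by simp
qed simp

text \<open>Converts a large quadratic form in a single direction into a large trace exponential, as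
  needed on the event side of Markov's inequality.\<close>

lemma trace_exp_ge:
  assumes "psd d X" "t * ip d x x \<le> ip d x (X x)" "0 < ip d x x" "0 \<le> t"
  shows "exp t \<le> trace_exp d X"
proof -
  have "t ^ q \<le> op_trace d (X ^^ q)" for q
  proof -
    have "t ^ q * ip d x x \<le> ip d x x * op_trace d (X ^^ q)"
      using psd_power_ge[OF assms] psd_form_le_trace[OF psd_funpow[OF assms(1)]] order_trans by blast
    then show ?thesis using assms(3) by (simp add: mult.commute)
  qed
  then have "(\<Sum>q. t ^ q / fact q) \<le> trace_exp d X"
    unfolding trace_exp_def using summable_exp[of t]
    by (intro suminf_le trace_exp_summable assms divide_right_mono) (simp_all add: divide_inverse mult.commute)
  moreover have "(\<Sum>q. t ^ q / fact q) = exp t"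
    using sums_unique[OF exp_converges[of t]] by (simp add: divide_inverse mult.commute)
  ultimately show ?thesis by simp
qed

subsection \<open>The matrix Chernoff bound\<close>

text \<open>The counting form of conditioning on the first \<open>m\<close> draws.\<close>

lemma sum_PiE_lessThan_Suc:
  "(\<Sum>f\<in>PiE {..<Suc m} (\<lambda>_. R). F f) = (\<Sum>f\<in>PiE {..<m} (\<lambda>_. R). \<Sum>\<rho>\<in>R. F (f(m := \<rho>)))"
proof -
  have "(\<Sum>f\<in>PiE {..<Suc m} (\<lambda>_. R). F f) = (\<Sum>(\<rho>, f)\<in>R \<times> PiE {..<m} (\<lambda>_. R). F (f(m := \<rho>)))"
    unfolding lessThan_Suc PiE_insert_eq
    by (subst sum.reindex[OF inj_combinator]) (auto simp: case_prod_unfold)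
  then show ?thesis by (simp add: sum.cartesian_product[symmetric] sum.swap[of _ R])
qed

definition scaled_id :: "real \<Rightarrow> (nat \<Rightarrow> real) \<Rightarrow> nat \<Rightarrow> real" where
  "scaled_id K = (\<lambda>x i. K * x i)"

lemma funpow_scaled_id: "(scaled_id K ^^ q) x = (\<lambda>i. K ^ q * x i)"
  by (induction q) (auto simp: scaled_id_def)

lemma psd_scaled_id: "0 \<le> K \<Longrightarrow> psd d (scaled_id K)"
  by (simp add: psd_def scaled_id_def ip_scale_right ip_scale_left ip_self_nonneg)

lemma trace_exp_scaled_id: "trace_exp d (scaled_id K) = real d * exp K"
proof -
  have "op_trace d (scaled_id K ^^ q) = real d * K ^ q" for q
  proof -
    have "ip d (std_vec i) (std_vec i) = 1" if "i < d" for i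
      using that by (simp add: ip_std_vec) (simp add: std_vec_def)
    then show ?thesis by (simp add: op_trace_def funpow_scaled_id ip_scale_right)
  qed
  then have "trace_exp d (scaled_id K) = (\<Sum>q. real d * (K ^ q / fact q))"
    by (simp add: trace_exp_def)
  also have "\<dots> = real d * exp K"
    using exp_converges[of K] by (intro sums_unique[symmetric] sums_mult) (simp add: divide_inverse mult.commute)
  finally show ?thesis .
qed

text \<open>The running operator of the Chernoff argument: \<open>s\<close> is 1 for the upper tail,
  where the rank-one operators of the sample are added, and -1 for the lower tail, where they are
  subtracted.\<close>

definition add_gram :: "nat \<Rightarrow> ((nat \<Rightarrow> real) \<Rightarrow> nat \<Rightarrow> real) \<Rightarrow> real \<Rightarrow> nat \<Rightarrow> (nat \<Rightarrow> nat \<Rightarrow> real)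
    \<Rightarrow> (nat \<Rightarrow> real) \<Rightarrow> nat \<Rightarrow> real" where
  "add_gram d X s m w = (\<lambda>x i. X x i + s * (\<Sum>j<m. ip d (w j) x * w j i))"

lemma add_gram_0: "add_gram d X s 0 w = X"
  by (simp add: add_gram_def)

lemma add_gram_Suc_pos: "add_gram d X 1 (Suc m) w = rank1_update d (w m) (add_gram d X 1 m w)"
  by (simp add: add_gram_def rank1_update_def fun_eq_iff)

lemma add_gram_Suc_neg: "rank1_update d (w m) (add_gram d X (- 1) (Suc m) w) = add_gram d X (- 1) m w"
  by (simp add: add_gram_def rank1_update_def fun_eq_iff)

lemma ip_add_gram:
  "ip d x (add_gram d X s m w z) = ip d x (X z) + s * (\<Sum>j<m. ip d (w j) x * ip d (w j) z)"
proof -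
  have "ip d x (add_gram d X s m w z) = ip d x (X z) + s * ip d x (\<lambda>i. \<Sum>j<m. ip d (w j) z * w j i)"
    unfolding add_gram_def by (simp only: ip_add_right ip_scale_right)
  also have "ip d x (\<lambda>i. \<Sum>j<m. ip d (w j) z * w j i) = (\<Sum>j<m. ip d (w j) z * ip d x (w j))"
    by (rule ip_sum_right)
  finally show ?thesis by (simp add: ip_commute[of d x] mult.commute)
qed

lemma add_gram_cong:
  "(\<And>j. j < m \<Longrightarrow> w j = w' j) \<Longrightarrow> add_gram d X s m w = add_gram d X s m w'"
  by (simp add: add_gram_def)

lemma psd_add_gram_pos: "psd d X \<Longrightarrow> psd d (add_gram d X 1 m w)"
  by (induction m) (simp_all add: add_gram_0 add_gram_Suc_pos psd_rank1_update)

lemma psd_add_gram_neg: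
  assumes "(\<Sum>j<m. ip d (w j) (w j)) \<le> K"
  shows "psd d (add_gram d (scaled_id K) (- 1) m w)"
proof -
  have "0 \<le> ip d x (add_gram d (scaled_id K) (- 1) m w x)" for x
  proof -
    have "(\<Sum>j<m. ip d (w j) x * ip d (w j) x) \<le> (\<Sum>j<m. ip d (w j) (w j) * ip d x x)"
      using psd_cauchy_schwarz[OF psd_id, of d] by (intro sum_mono) (simp add: power2_eq_square)
    also have "\<dots> \<le> K * ip d x x"
      unfolding sum_distrib_right[symmetric] by (intro mult_right_mono assms ip_self_nonneg)
    finally show ?thesis
      by (simp add: ip_add_gram scaled_id_def ip_scale_right)
  qed
  moreover have "ip d x (add_gram d (scaled_id K) (- 1) m w z) = ip d (add_gram d (scaled_id K) (- 1) m w x) z" for x z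
    by (subst ip_commute[of d _ z]) (simp add: ip_add_gram scaled_id_def ip_scale_right ip_commute[of d x z] mult.commute)
  ultimately show ?thesis by (simp add: psd_def)
qed

lemma card_markov:
  assumes "finite A" "\<And>f. f \<in> A \<Longrightarrow> 0 \<le> F f" "\<And>f. f \<in> A \<Longrightarrow> Q f \<Longrightarrow> c \<le> F f"
  shows "real (card {f \<in> A. Q f}) * c \<le> (\<Sum>f\<in>A. (F f :: real))"
proof -
  have "real (card {f \<in> A. Q f}) * c = (\<Sum>f\<in>{f \<in> A. Q f}. c)" by simp
  also have "\<dots> \<le> (\<Sum>f\<in>{f \<in> A. Q f}. F f)" using assms(3) by (intro sum_mono) auto
  also have "\<dots> \<le> (\<Sum>f\<in>A. F f)" using assms by (intro sum_mono2) auto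
  finally show ?thesis .
qed

text \<open>\<open>C\<close> is the total over \<open>R\<close>, not the mean, so averages stay
  sums. The free parameter of the Laplace transform is absorbed into the scaling of
  \<open>z\<close>, and hence into \<open>C\<close> and the threshold \<open>b\<close>.\<close>

locale isotropic_sample =
  fixes d :: nat and R :: "'r set" and z :: "'r \<Rightarrow> nat \<Rightarrow> real" and C b :: real
  assumes fin: "finite R" and ne: "R \<noteq> {}"
    and iso: "\<And>i j. i < d \<Longrightarrow> j < d \<Longrightarrow> (\<Sum>\<rho>\<in>R. z \<rho> i * z \<rho> j) = (if i = j then C else 0)"
    and b: "0 < b"
begin

text \<open>Long vectors become 0 instead of being discarded, so the sample space remains the full
  product and the draws remain independent.\<close>

definition trunc :: "'r \<Rightarrow> nat \<Rightarrow> real" where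
  "trunc \<rho> = (if ip d (z \<rho>) (z \<rho>) \<le> b then z \<rho> else (\<lambda>_. 0))"

text \<open>The trace of the part of the covariance that truncation removes, not normalized; it also
  bounds that part as an operator.\<close>

definition excess :: real where
  "excess = (\<Sum>\<rho>\<in>{\<rho> \<in> R. b < ip d (z \<rho>) (z \<rho>)}. ip d (z \<rho>) (z \<rho>))"

definition tuples :: "nat \<Rightarrow> (nat \<Rightarrow> 'r) set" where
  "tuples m = PiE {..<m} (\<lambda>_. R)"

lemma finite_tuples: "finite (tuples m)"
  unfolding tuples_def by (intro finite_PiE fin) auto

lemma ip_zero: "ip d (\<lambda>_. 0) x = 0" "ip d x (\<lambda>_. 0) = 0"
  by (simp_all add: ip_def)

lemma ip_trunc_le: "ip d (trunc \<rho>) (trunc \<rho>) \<le> b"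
  using b by (simp add: trunc_def ip_zero)

text \<open>Isotropy says that the rank-one operators of all \<open>z \<rho>\<close> add up to
  \<open>C\<close> times the identity; tested against \<open>P\<close>, this produces the
  trace.\<close>

lemma sum_form:
  assumes "psd d P" shows "(\<Sum>\<rho>\<in>R. ip d (z \<rho>) (P (z \<rho>))) = C * op_trace d P"
proof -
  have "ip d (z \<rho>) (P (z \<rho>)) = (\<Sum>i<d. \<Sum>j<d. P (std_vec i) j * (z \<rho> i * z \<rho> j))" for \<rho>
  proof -
    have "ip d (z \<rho>) (P (z \<rho>)) = (\<Sum>i<d. z \<rho> i * ip d (P (std_vec i)) (z \<rho>))"
      by (subst ip_expand) (simp add: psd_sym[OF assms])
    then show ?thesis by (simp add: ip_def sum_distrib_left ac_simps)
  qed
  then have "(\<Sum>\<rho>\<in>R. ip d (z \<rho>) (P (z \<rho>)))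
      = (\<Sum>i<d. \<Sum>j<d. P (std_vec i) j * (\<Sum>\<rho>\<in>R. z \<rho> i * z \<rho> j))"
    by (simp add: sum_distrib_left sum.swap[of _ R])
  also have "\<dots> = (\<Sum>i<d. P (std_vec i) i * C)"
    by (intro sum.cong) (auto simp: iso if_distrib cong: if_cong)
  finally show ?thesis
    by (simp add: op_trace_def ip_std_vec sum_distrib_left mult.commute)
qed

lemma sum_form_exp:
  assumes "psd d X" shows "(\<Sum>\<rho>\<in>R. form_exp d X (z \<rho>)) = C * trace_exp d X"
proof -
  have "(\<Sum>\<rho>\<in>R. form_exp d X (z \<rho>)) = (\<Sum>q. \<Sum>\<rho>\<in>R. ip d (z \<rho>) ((X ^^ q) (z \<rho>)) / fact q)"
    unfolding form_exp_def by (rule suminf_sum[symmetric]) (rule form_exp_summable[OF assms])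
  also have "\<dots> = (\<Sum>q. C * (op_trace d (X ^^ q) / fact q))"
    by (simp add: sum_divide_distrib[symmetric] sum_form[OF psd_funpow[OF assms]])
  finally show ?thesis
    unfolding trace_exp_def suminf_mult[OF trace_exp_summable[OF assms]] .
qed

lemma form_exp_trunc:
  assumes "psd d X"
  shows "form_exp d X (trunc \<rho>) = (if ip d (z \<rho>) (z \<rho>) \<le> b then form_exp d X (z \<rho>) else 0)"
proof -
  have "form_exp d X (\<lambda>_. 0) = 0" using form_exp_scale[OF assms, of 0] by simp
  then show ?thesis by (simp add: trunc_def)
qed

lemma sum_form_exp_trunc_le:
  assumes "psd d X" shows "(\<Sum>\<rho>\<in>R. form_exp d X (trunc \<rho>)) \<le> C * trace_exp d X"
  unfolding sum_form_exp[OF assms, symmetric]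
  by (intro sum_mono) (simp add: form_exp_trunc[OF assms] form_exp_nonneg[OF assms])

text \<open>Each truncated vector loses at most its squared length times the trace exponential, by
  \<open>form_exp_le_trace_exp\<close>.\<close>

lemma sum_form_exp_trunc_ge:
  assumes "psd d X" shows "(C - excess) * trace_exp d X \<le> (\<Sum>\<rho>\<in>R. form_exp d X (trunc \<rho>))"
proof -
  let ?B = "{\<rho> \<in> R. b < ip d (z \<rho>) (z \<rho>)}"
  have "C * trace_exp d X = (\<Sum>\<rho>\<in>R. form_exp d X (trunc \<rho>))
      + (\<Sum>\<rho>\<in>R. if b < ip d (z \<rho>) (z \<rho>) then form_exp d X (z \<rho>) else 0)"
    unfolding sum_form_exp[OF assms, symmetric] sum.distrib[symmetric]
    by (intro sum.cong) (auto simp: form_exp_trunc[OF assms])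
  also have "(\<Sum>\<rho>\<in>R. if b < ip d (z \<rho>) (z \<rho>) then form_exp d X (z \<rho>) else 0)
      = (\<Sum>\<rho>\<in>?B. form_exp d X (z \<rho>))"
    by (simp add: sum.inter_filter fin)
  also have "\<dots> \<le> (\<Sum>\<rho>\<in>?B. ip d (z \<rho>) (z \<rho>) * trace_exp d X)"
    by (intro sum_mono form_exp_le_trace_exp assms)
  finally show ?thesis by (simp add: excess_def sum_distrib_right left_diff_distrib)
qed

lemma card_R_pos: "0 < real (card R)"
  using fin ne by (simp add: card_gt_0_iff)

lemma one_plus_le_exp: "real (card R) + u \<le> real (card R) * exp (u / real (card R))"
proof -
  have "real (card R) + u = real (card R) * (1 + u / real (card R))"
    using card_R_pos by (simp add: field_simps)
  then show ?thesis using card_R_pos exp_ge_add_one_self by simp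
qed

lemma add_gram_upd: "add_gram d X s m (\<lambda>j. trunc ((f(m := \<rho>)) j)) = add_gram d X s m (\<lambda>j. trunc (f j))"
  by (intro add_gram_cong) auto

text \<open>The last draw is averaged with the earlier ones fixed. By isotropy the mean gain is a
  multiple of the trace exponential already present, so each draw costs a scalar factor.\<close>

lemma sum_trace_exp_upper:
  assumes X: "psd d X"
  defines "h \<equiv> (exp b - 1) / b"
  shows "(\<Sum>f\<in>tuples m. trace_exp d (add_gram d X 1 m (\<lambda>j. trunc (f j))))
    \<le> (real (card R) * exp (h * C / real (card R))) ^ m * trace_exp d X"
proof (induction m)
  case 0 then show ?case by (simp add: tuples_def add_gram_0)
next
  case (Suc m)
  let ?c = "real (card R) * exp (h * C / real (card R))"
  have h0: "0 \<le> h" using b by (simp add: h_def)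
  have "(\<Sum>f\<in>tuples (Suc m). trace_exp d (add_gram d X 1 (Suc m) (\<lambda>j. trunc (f j))))
     = (\<Sum>f\<in>tuples m. \<Sum>\<rho>\<in>R. trace_exp d (rank1_update d (trunc \<rho>) (add_gram d X 1 m (\<lambda>j. trunc (f j)))))"
    by (simp add: tuples_def sum_PiE_lessThan_Suc add_gram_Suc_pos add_gram_upd del: fun_upd_apply) simp
  also have "\<dots> \<le> (\<Sum>f\<in>tuples m. ?c * trace_exp d (add_gram d X 1 m (\<lambda>j. trunc (f j))))"
  proof (intro sum_mono)
    fix f
    let ?X = "add_gram d X 1 m (\<lambda>j. trunc (f j))"
    have P: "psd d ?X" by (rule psd_add_gram_pos[OF X])
    have "(\<Sum>\<rho>\<in>R. trace_exp d (rank1_update d (trunc \<rho>) ?X))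
        \<le> (\<Sum>\<rho>\<in>R. trace_exp d ?X + h * form_exp d ?X (trunc \<rho>))"
      unfolding h_def by (intro sum_mono trace_exp_update_le P ip_trunc_le b)
    also have "\<dots> = real (card R) * trace_exp d ?X + h * (\<Sum>\<rho>\<in>R. form_exp d ?X (trunc \<rho>))"
      by (simp add: sum.distrib sum_distrib_left)
    also have "\<dots> \<le> real (card R) * trace_exp d ?X + h * (C * trace_exp d ?X)"
      by (intro add_left_mono mult_left_mono sum_form_exp_trunc_le P h0)
    also have "\<dots> = (real (card R) + h * C) * trace_exp d ?X" by (simp add: algebra_simps)
    also have "\<dots> \<le> ?c * trace_exp d ?X"
      by (intro mult_right_mono one_plus_le_exp trace_exp_nonneg P)
    finally show "(\<Sum>\<rho>\<in>R. trace_exp d (rank1_update d (trunc \<rho>) ?X)) \<le> ?c * trace_exp d ?X" .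
  qed
  also have "\<dots> \<le> ?c * (?c ^ m * trace_exp d X)"
    unfolding sum_distrib_left[symmetric] by (intro mult_left_mono Suc) simp
  finally show ?case by simp
qed

text \<open>For the lower tail the sample is subtracted from a large multiple of the identity, so that all
  operators stay positive semidefinite.\<close>

lemma sum_trace_exp_lower:
  assumes K: "real n * b \<le> K" and "m \<le> n"
  defines "h \<equiv> (1 - exp (- b)) / b"
  shows "(\<Sum>f\<in>tuples m. trace_exp d (add_gram d (scaled_id K) (- 1) m (\<lambda>j. trunc (f j))))
    \<le> (real (card R) * exp (- h * (C - excess) / real (card R))) ^ m * trace_exp d (scaled_id K)"
  using \<open>m \<le> n\<close>
proof (induction m)
  case 0 then show ?case by (simp add: tuples_def add_gram_0)
next
  case (Suc m)
  let ?L = "\<lambda>m f. add_gram d (scaled_id K) (- 1) m (\<lambda>j. trunc (f j))"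
  let ?c = "real (card R) * exp (- h * (C - excess) / real (card R))"
  have h0: "0 \<le> h" using b by (simp add: h_def)
  have P: "psd d (?L k f)" if "k \<le> n" for k and f :: "nat \<Rightarrow> 'r"
  proof (rule psd_add_gram_neg)
    have "(\<Sum>j<k. ip d (trunc (f j)) (trunc (f j))) \<le> (\<Sum>j<k. b)"
      by (intro sum_mono ip_trunc_le)
    also have "\<dots> \<le> real n * b" using that b by simp
    finally show "(\<Sum>j<k. ip d (trunc (f j)) (trunc (f j))) \<le> K" using K by simp
  qed
  have "(\<Sum>f\<in>tuples (Suc m). trace_exp d (?L (Suc m) f))
     = (\<Sum>f\<in>tuples m. \<Sum>\<rho>\<in>R. trace_exp d (?L (Suc m) (f(m := \<rho>))))"
    by (simp only: tuples_def sum_PiE_lessThan_Suc)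
  also have "\<dots> \<le> (\<Sum>f\<in>tuples m. ?c * trace_exp d (?L m f))"
  proof (intro sum_mono)
    fix f
    have Pm: "psd d (?L m f)" using Suc.prems by (intro P) simp
    have "(\<Sum>\<rho>\<in>R. trace_exp d (?L (Suc m) (f(m := \<rho>))))
        \<le> (\<Sum>\<rho>\<in>R. trace_exp d (?L m f) - h * form_exp d (?L m f) (trunc \<rho>))"
    proof (intro sum_mono)
      fix \<rho>
      have u: "rank1_update d (trunc \<rho>) (?L (Suc m) (f(m := \<rho>))) = ?L m f"
        using add_gram_Suc_neg[of d "\<lambda>j. trunc ((f(m := \<rho>)) j)" m "scaled_id K"]
        unfolding add_gram_upd by simp
      show "trace_exp d (?L (Suc m) (f(m := \<rho>))) \<le> trace_exp d (?L m f) - h * form_exp d (?L m f) (trunc \<rho>)"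
        using trace_exp_update_ge[OF P[OF Suc.prems] ip_trunc_le b, of "f(m := \<rho>)" \<rho>]
        unfolding u h_def by simp
    qed
    also have "\<dots> = real (card R) * trace_exp d (?L m f) - h * (\<Sum>\<rho>\<in>R. form_exp d (?L m f) (trunc \<rho>))"
      by (simp add: sum_subtractf sum_distrib_left)
    also have "\<dots> \<le> real (card R) * trace_exp d (?L m f) - h * ((C - excess) * trace_exp d (?L m f))"
      by (intro diff_left_mono mult_left_mono sum_form_exp_trunc_ge Pm h0)
    also have "\<dots> = (real (card R) + (- h * (C - excess))) * trace_exp d (?L m f)"
      by (simp add: algebra_simps)
    also have "\<dots> \<le> ?c * trace_exp d (?L m f)"
      by (intro mult_right_mono one_plus_le_exp trace_exp_nonneg Pm)
    finally show "(\<Sum>\<rho>\<in>R. trace_exp d (?L (Suc m) (f(m := \<rho>)))) \<le> ?c * trace_exp d (?L m f)" .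
  qed
  also have "\<dots> \<le> ?c * (?c ^ m * trace_exp d (scaled_id K))"
    unfolding sum_distrib_left[symmetric] using Suc by (intro mult_left_mono) simp_all
  finally show ?case by simp
qed

text \<open>Markov's inequality for the trace exponential, started at the zero operator; this start
  is the source of the dimension factor \<open>d\<close>.\<close>

lemma matrix_chernoff_upper:
  assumes "0 \<le> t"
  defines "h \<equiv> (exp b - 1) / b"
  shows "real (card {f \<in> tuples m. \<exists>x. 0 < ip d x x \<and>
        t * ip d x x \<le> (\<Sum>j<m. (ip d (trunc (f j)) x)\<^sup>2)})
    \<le> (real (card R) * exp (h * C / real (card R))) ^ m * (real d * exp (- t))"
    (is "real (card {f \<in> _. ?Q f}) \<le> ?rhs")
proof -
  have P: "psd d (add_gram d (scaled_id 0) 1 m w)" for w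
    by (intro psd_add_gram_pos psd_scaled_id) simp
  have "real (card {f \<in> tuples m. ?Q f}) * exp t
      \<le> (\<Sum>f\<in>tuples m. trace_exp d (add_gram d (scaled_id 0) 1 m (\<lambda>j. trunc (f j))))"
  proof (rule card_markov)
    fix f assume "?Q f"
    then obtain x where x: "0 < ip d x x" "t * ip d x x \<le> (\<Sum>j<m. (ip d (trunc (f j)) x)\<^sup>2)" by blast
    show "exp t \<le> trace_exp d (add_gram d (scaled_id 0) 1 m (\<lambda>j. trunc (f j)))"
    proof (rule trace_exp_ge[OF P _ x(1) assms(1)])
      show "t * ip d x x \<le> ip d x (add_gram d (scaled_id 0) 1 m (\<lambda>j. trunc (f j)) x)"
        using x(2) by (simp add: ip_add_gram scaled_id_def ip_zero power2_eq_square)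
    qed
  qed (simp_all add: finite_tuples trace_exp_nonneg P)
  also have "\<dots> \<le> (real (card R) * exp (h * C / real (card R))) ^ m * trace_exp d (scaled_id 0)"
    unfolding h_def by (intro sum_trace_exp_upper psd_scaled_id) simp
  finally show ?thesis by (simp add: trace_exp_scaled_id exp_minus field_simps)
qed

lemma matrix_chernoff_lower:
  assumes "0 \<le> t"
  defines "h \<equiv> (1 - exp (- b)) / b"
  shows "real (card {f \<in> tuples m. \<exists>x. 0 < ip d x x \<and>
        (\<Sum>j<m. (ip d (trunc (f j)) x)\<^sup>2) \<le> t * ip d x x})
    \<le> (real (card R) * exp (- h * (C - excess) / real (card R))) ^ m * (real d * exp t)"
    (is "real (card {f \<in> _. ?Q f}) \<le> ?rhs")
proof -
  \<comment> \<open>Room for subtracting \<open>m\<close> vectors of squared norm at most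
    \<open>b\<close>, with \<open>K - t\<close> still nonnegative. The factor \<open>exp K\<close>
    cancels between the two sides of Markov's inequality.\<close>
  define K where "K = real m * b + t"
  let ?L = "\<lambda>f. add_gram d (scaled_id K) (- 1) m (\<lambda>j. trunc (f j))"
  have P: "psd d (?L f)" for f
  proof (rule psd_add_gram_neg)
    have "(\<Sum>j<m. ip d (trunc (f j)) (trunc (f j))) \<le> (\<Sum>j<m. b)"
      by (intro sum_mono ip_trunc_le)
    then show "(\<Sum>j<m. ip d (trunc (f j)) (trunc (f j))) \<le> K" using assms(1) by (simp add: K_def)
  qed
  have "real (card {f \<in> tuples m. ?Q f}) * exp (K - t) \<le> (\<Sum>f\<in>tuples m. trace_exp d (?L f))"
  proof (rule card_markov)
    fix f assume "?Q f"
    then obtain x where x: "0 < ip d x x" "(\<Sum>j<m. (ip d (trunc (f j)) x)\<^sup>2) \<le> t * ip d x x" by blast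
    show "exp (K - t) \<le> trace_exp d (?L f)"
    proof (rule trace_exp_ge[OF P _ x(1)])
      show "(K - t) * ip d x x \<le> ip d x (?L f x)"
        using x(2) by (simp add: ip_add_gram scaled_id_def ip_scale_right power2_eq_square algebra_simps)
      show "0 \<le> K - t" using b by (simp add: K_def)
    qed
  qed (simp_all add: finite_tuples trace_exp_nonneg P)
  also have "\<dots> \<le> (real (card R) * exp (- h * (C - excess) / real (card R))) ^ m * trace_exp d (scaled_id K)"
    unfolding h_def using assms(1) by (intro sum_trace_exp_lower[where n = m]) (simp_all add: K_def)
  finally show ?thesis by (simp add: trace_exp_scaled_id exp_diff field_simps)
qed

end

subsection \<open>The norm of a random signed sum\<close>

text \<open>The series are compared term by term: the odd powers cancel, and
  \<open>2 ^ m * fact m \<le> fact (2 * m)\<close> handles the even ones.\<close>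

lemma exp_plus_exp_minus_le: "exp a + exp (- a) \<le> 2 * exp (a\<^sup>2 / 2)" for a :: real
proof -
  have s: "exp x = (\<Sum>q. x ^ q / fact q)" "summable (\<lambda>q. x ^ q / fact q)" for x :: real
    using exp_converges[of x] by (simp_all add: sums_iff divide_inverse mult.commute)
  have c: "(\<lambda>n. (if even n then 2 * a ^ n / fact n else 0)) sums (exp a + exp (- a))"
  proof -
    have "(\<lambda>q. a ^ q / fact q + (- a) ^ q / fact q) sums (exp a + exp (- a))"
      using s[of a] s[of "- a"] by (intro sums_add) (simp_all add: sums_iff)
    moreover have "a ^ q / fact q + (- a) ^ q / fact q = (if even q then 2 * a ^ q / fact q else 0)" for q
      by (auto simp: uminus_power_if)
    ultimately show ?thesis by simp
  qed
  have c2: "(\<lambda>m. 2 * a ^ (2 * m) / fact (2 * m)) sums (exp a + exp (- a))"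
  proof -
    have "(\<lambda>m. (if even (2 * m) then 2 * a ^ (2 * m) / fact (2 * m) else 0)) sums (exp a + exp (- a))"
      using c by (subst sums_mono_reindex[of "\<lambda>m. 2 * m"]) (auto simp: strict_mono_def elim!: evenE)
    then show ?thesis by simp
  qed
  have f: "2 ^ m * fact m \<le> (fact (2 * m) :: real)" for m
  proof (induction m)
    case (Suc m)
    have "2 ^ Suc m * fact (Suc m) = (2 * real (Suc m)) * (2 ^ m * fact m)" by simp
    also have "\<dots> \<le> (real (2 * m + 2) * real (2 * m + 1)) * fact (2 * m)"
      using Suc by (intro mult_mono) (simp_all add: algebra_simps)
    also have "\<dots> = fact (2 * Suc m)" by (simp add: algebra_simps)
    finally show ?case .
  qed simp
  have "exp a + exp (- a) = (\<Sum>m. 2 * a ^ (2 * m) / fact (2 * m))" using c2 by (simp add: sums_iff)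
  also have "\<dots> \<le> (\<Sum>m. 2 * ((a\<^sup>2 / 2) ^ m / fact m))"
  proof (intro suminf_le)
    show "summable (\<lambda>m. 2 * a ^ (2 * m) / fact (2 * m))" using c2 by (simp add: sums_iff)
    show "summable (\<lambda>m. 2 * ((a\<^sup>2 / 2) ^ m / fact m))" by (intro summable_mult s)
    fix m
    have "a ^ (2 * m) / fact (2 * m) \<le> a ^ (2 * m) / (2 ^ m * fact m)"
      using f[of m] by (intro divide_left_mono) auto
    then show "2 * a ^ (2 * m) / fact (2 * m) \<le> 2 * ((a\<^sup>2 / 2) ^ m / fact m)"
      by (simp add: power_mult power_divide)
  qed
  also have "\<dots> = 2 * exp (a\<^sup>2 / 2)" unfolding s(1) by (intro suminf_mult s)
  finally show ?thesis .
qed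

lemma sum_sign_exp_linear_le:
  fixes \<alpha> :: "'j \<Rightarrow> real"
  assumes "finite J"
  shows "(\<Sum>\<xi>\<in>PiE J (\<lambda>_. {-1, 1}). exp (\<Sum>j\<in>J. \<xi> j * \<alpha> j)) \<le> 2 ^ card J * exp ((\<Sum>j\<in>J. (\<alpha> j)\<^sup>2) / 2)"
proof -
  have "(\<Sum>\<xi>\<in>PiE J (\<lambda>_. {-1, 1}). exp (\<Sum>j\<in>J. \<xi> j * \<alpha> j))
      = (\<Sum>\<xi>\<in>PiE J (\<lambda>_. {-1, 1}). \<Prod>j\<in>J. exp (\<xi> j * \<alpha> j))"
    by (simp add: exp_sum assms)
  also have "\<dots> = (\<Prod>j\<in>J. \<Sum>e\<in>{-1, 1}. exp (e * \<alpha> j))"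
    by (rule prod_sum_PiE[symmetric]) (use assms in auto)
  also have "\<dots> = (\<Prod>j\<in>J. exp (\<alpha> j) + exp (- \<alpha> j))" by (simp add: add.commute)
  also have "\<dots> \<le> (\<Prod>j\<in>J. 2 * exp ((\<alpha> j)\<^sup>2 / 2))"
    by (intro prod_mono) (auto simp: exp_plus_exp_minus_le)
  also have "\<dots> = 2 ^ card J * exp ((\<Sum>j\<in>J. (\<alpha> j)\<^sup>2) / 2)"
    by (simp add: prod.distrib exp_sum assms sum_divide_distrib)
  finally show ?thesis .
qed

section \<open>Gaussian integrals and the moment generating function of the squared norm\<close>

lemma nn_integral_normal_density: "0 < \<sigma> \<Longrightarrow> (\<integral>\<^sup>+ x. ennreal (normal_density \<mu> \<sigma> x) \<partial>lborel) = 1"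
  by (simp add: nn_integral_eq_integral normal_density_nonneg)

abbreviation gaussian :: "real measure" where
  "gaussian \<equiv> density lborel (\<lambda>x. ennreal (std_normal_density x))"

lemma gaussian_exp_linear: "(\<integral>\<^sup>+ x. ennreal (exp (a * x)) \<partial>gaussian) = ennreal (exp (a\<^sup>2 / 2))"
proof -
  have "std_normal_density x * exp (a * x) = exp (a\<^sup>2 / 2) * normal_density a 1 x" for x
  proof -
    have "- x\<^sup>2 / 2 + a * x = a\<^sup>2 / 2 + - (x - a)\<^sup>2 / 2" by (simp add: power2_eq_square field_simps)
    then have "exp (- x\<^sup>2 / 2) * exp (a * x) = exp (a\<^sup>2 / 2) * exp (- (x - a)\<^sup>2 / 2)"
      by (simp only: exp_add[symmetric])
    then show ?thesis by (simp add: normal_density_def)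
  qed
  then have "(\<integral>\<^sup>+ x. ennreal (exp (a * x)) \<partial>gaussian) = (\<integral>\<^sup>+ x. ennreal (exp (a\<^sup>2 / 2)) * ennreal (normal_density a 1 x) \<partial>lborel)"
    by (simp add: nn_integral_density ennreal_mult[symmetric])
  also have "\<dots> = ennreal (exp (a\<^sup>2 / 2))"
    by (simp add: nn_integral_cmult nn_integral_normal_density)
  finally show ?thesis .
qed

text \<open>The weighted density is \<open>\<sigma>\<close> times a centered normal density with
  variance \<open>1 / (1 - 2 * s)\<close>.\<close>

lemma gaussian_exp_square:
  assumes "s < 1 / 2"
  shows "(\<integral>\<^sup>+ x. ennreal (exp (s * x\<^sup>2)) \<partial>gaussian) = ennreal (1 / sqrt (1 - 2 * s))"
proof -
  define \<sigma> where "\<sigma> = 1 / sqrt (1 - 2 * s)"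
  have \<sigma>: "0 < \<sigma>" "\<sigma>\<^sup>2 = 1 / (1 - 2 * s)" using assms by (simp_all add: \<sigma>_def power_divide)
  have "std_normal_density x * exp (s * x\<^sup>2) = \<sigma> * normal_density 0 \<sigma> x" for x
  proof -
    have "- x\<^sup>2 / 2 + s * x\<^sup>2 = - (x - 0)\<^sup>2 / (2 * \<sigma>\<^sup>2)"
      using assms by (simp add: \<sigma>(2) field_simps)
    then have "exp (- x\<^sup>2 / 2) * exp (s * x\<^sup>2) = exp (- (x - 0)\<^sup>2 / (2 * \<sigma>\<^sup>2))"
      by (simp only: exp_add[symmetric])
    moreover have "1 / sqrt (2 * pi) = \<sigma> * (1 / sqrt (2 * pi * \<sigma>\<^sup>2))"
      using \<sigma>(1) by (simp add: real_sqrt_mult)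
    ultimately show ?thesis by (simp add: normal_density_def)
  qed
  then have "(\<integral>\<^sup>+ x. ennreal (exp (s * x\<^sup>2)) \<partial>gaussian) = (\<integral>\<^sup>+ x. ennreal \<sigma> * ennreal (normal_density 0 \<sigma> x) \<partial>lborel)"
    using \<sigma>(1) by (simp add: nn_integral_density ennreal_mult[symmetric])
  also have "\<dots> = ennreal \<sigma>"
    using \<sigma>(1) by (simp add: nn_integral_cmult nn_integral_normal_density)
  finally show ?thesis by (simp add: \<sigma>_def)
qed

text \<open>Decoupling by a Gaussian vector: \<open>exp (s \<bar>z\<bar>\<^sup>2)\<close> is the expectation of \<open>exp (sqrt (2 s) \<langle>g, z\<rangle>)\<close>,
  and \<open>cosh a \<le> exp (a\<^sup>2 / 2)\<close> then replaces the signs by a second Gaussian integral.\<close>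

lemma sign_chaos_mgf:
  fixes q :: "'j \<Rightarrow> nat \<Rightarrow> real"
  assumes J: "finite J" and s: "0 \<le> s" "s < 1 / 2"
    and orth: "\<And>c c'. c < d \<Longrightarrow> c' < d \<Longrightarrow> (\<Sum>j\<in>J. q j c * q j c') = (if c = c' then 1 else 0)"
  shows "(\<Sum>\<xi>\<in>PiE J (\<lambda>_. {-1, 1}). exp (s * (\<Sum>c<d. (\<Sum>j\<in>J. \<xi> j * q j c)\<^sup>2)))
    \<le> 2 ^ card J * (1 / sqrt (1 - 2 * s)) ^ d"
proof -
  define r where "r = sqrt (2 * s)"
  have r2: "r\<^sup>2 = 2 * s" using s by (simp add: r_def)
  define G where "G = PiM {..<d} (\<lambda>_. gaussian)"
  interpret g: prob_space gaussian by (rule prob_space_normal_density) simp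
  interpret product_sigma_finite "\<lambda>_::nat. gaussian" ..
  have G: "(\<integral>\<^sup>+ x. (\<Prod>c<d. f c (x c)) \<partial>G) = (\<Prod>c<d. \<integral>\<^sup>+ x. f c x \<partial>gaussian)"
    if [measurable]: "\<And>c. f c \<in> borel_measurable borel" for f :: "nat \<Rightarrow> real \<Rightarrow> ennreal"
    unfolding G_def by (rule product_nn_integral_prod) auto
  have mc: "(\<lambda>x. x c) \<in> borel_measurable G" if "c < d" for c
    using measurable_component_singleton[of c "{..<d}" "\<lambda>_. gaussian"] that
    by (simp add: G_def cong: measurable_cong_sets)
  have [measurable]: "(\<lambda>x. \<Sum>c<d. q j c * x c) \<in> borel_measurable G" for j
    by (intro borel_measurable_sum borel_measurable_times borel_measurable_const mc) auto
  have msq: "(\<lambda>x. exp (s * (x c)\<^sup>2)) \<in> borel_measurable G" if "c < d" for c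
    using mc[OF that] by measurable
  have quad: "(\<Sum>j\<in>J. (r * (\<Sum>c<d. q j c * x c))\<^sup>2) = 2 * s * (\<Sum>c<d. (x c)\<^sup>2)" for x :: "nat \<Rightarrow> real"
  proof -
    have "(\<Sum>j\<in>J. (\<Sum>c<d. q j c * x c)\<^sup>2) = (\<Sum>j\<in>J. \<Sum>c<d. \<Sum>c'<d. x c * x c' * (q j c * q j c'))"
      by (simp add: power2_eq_square sum_product ac_simps)
    also have "\<dots> = (\<Sum>c<d. \<Sum>c'<d. x c * x c' * (\<Sum>j\<in>J. q j c * q j c'))"
      by (simp add: sum_distrib_left sum.swap[of _ J])
    also have "\<dots> = (\<Sum>c<d. (x c)\<^sup>2)"
      by (intro sum.cong) (auto simp: orth power2_eq_square if_distrib cong: if_cong)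
    finally show ?thesis by (simp add: power_mult_distrib r2 sum_distrib_left[symmetric])
  qed
  have step1: "ennreal (exp (s * (\<Sum>c<d. (\<Sum>j\<in>J. \<xi> j * q j c)\<^sup>2)))
      = (\<integral>\<^sup>+ x. ennreal (exp (\<Sum>j\<in>J. \<xi> j * (r * (\<Sum>c<d. q j c * x c)))) \<partial>G)" for \<xi> :: "'j \<Rightarrow> real"
  proof -
    define y where "y c = (\<Sum>j\<in>J. \<xi> j * q j c)" for c
    have e: "(\<Sum>j\<in>J. \<xi> j * (r * (\<Sum>c<d. q j c * x c))) = (\<Sum>c<d. (r * y c) * x c)" for x :: "nat \<Rightarrow> real"
      by (simp add: y_def sum_distrib_left sum_distrib_right sum.swap[of _ J] ac_simps)
    have "ennreal (exp (s * (\<Sum>c<d. (y c)\<^sup>2))) = (\<Prod>c<d. ennreal (exp ((r * y c)\<^sup>2 / 2)))"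
      by (simp add: prod_ennreal exp_sum[symmetric] sum_distrib_left power_mult_distrib r2)
    also have "\<dots> = (\<integral>\<^sup>+ x. (\<Prod>c<d. ennreal (exp ((r * y c) * x c))) \<partial>G)"
      unfolding gaussian_exp_linear[symmetric] by (rule G[symmetric]) measurable
    finally show ?thesis by (simp add: y_def[symmetric] e prod_ennreal exp_sum)
  qed
  have "ennreal (\<Sum>\<xi>\<in>PiE J (\<lambda>_. {-1, 1}). exp (s * (\<Sum>c<d. (\<Sum>j\<in>J. \<xi> j * q j c)\<^sup>2)))
      = (\<Sum>\<xi>\<in>PiE J (\<lambda>_. {-1, 1}). \<integral>\<^sup>+ x. ennreal (exp (\<Sum>j\<in>J. \<xi> j * (r * (\<Sum>c<d. q j c * x c)))) \<partial>G)"
    by (simp add: step1[symmetric] sum_ennreal)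
  also have "\<dots> = (\<integral>\<^sup>+ x. (\<Sum>\<xi>\<in>PiE J (\<lambda>_. {-1, 1}). ennreal (exp (\<Sum>j\<in>J. \<xi> j * (r * (\<Sum>c<d. q j c * x c))))) \<partial>G)"
    by (rule nn_integral_sum[symmetric])
       measurable
  also have "\<dots> \<le> (\<integral>\<^sup>+ x. ennreal (2 ^ card J) * (\<Prod>c<d. ennreal (exp (s * (x c)\<^sup>2))) \<partial>G)"
  proof (rule nn_integral_mono)
    fix x
    have "(\<Sum>\<xi>\<in>PiE J (\<lambda>_. {-1, 1}). exp (\<Sum>j\<in>J. \<xi> j * (r * (\<Sum>c<d. q j c * x c))))
        \<le> 2 ^ card J * exp (s * (\<Sum>c<d. (x c)\<^sup>2))"
      using sum_sign_exp_linear_le[OF J, of "\<lambda>j. r * (\<Sum>c<d. q j c * x c)"] unfolding quad by simp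
    then have "ennreal (\<Sum>\<xi>\<in>PiE J (\<lambda>_. {-1, 1}). exp (\<Sum>j\<in>J. \<xi> j * (r * (\<Sum>c<d. q j c * x c))))
        \<le> ennreal (2 ^ card J * exp (s * (\<Sum>c<d. (x c)\<^sup>2)))"
      by (rule ennreal_leI)
    also have "\<dots> = ennreal (2 ^ card J) * (\<Prod>c<d. ennreal (exp (s * (x c)\<^sup>2)))"
      by (simp add: prod_ennreal exp_sum sum_distrib_left ennreal_mult prod_nonneg)
    finally show "(\<Sum>\<xi>\<in>PiE J (\<lambda>_. {-1, 1}). ennreal (exp (\<Sum>j\<in>J. \<xi> j * (r * (\<Sum>c<d. q j c * x c)))))
        \<le> ennreal (2 ^ card J) * (\<Prod>c<d. ennreal (exp (s * (x c)\<^sup>2)))"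
      by (subst sum_ennreal) simp_all
  qed
  also have "\<dots> = ennreal (2 ^ card J) * (\<integral>\<^sup>+ x. (\<Prod>c<d. ennreal (exp (s * (x c)\<^sup>2))) \<partial>G)"
    by (rule nn_integral_cmult)
       (intro borel_measurable_prod_ennreal measurable_compose[OF _ measurable_ennreal] msq, simp)
  also have "(\<integral>\<^sup>+ x. (\<Prod>c<d. ennreal (exp (s * (x c)\<^sup>2))) \<partial>G) = (\<Prod>c<d. ennreal (1 / sqrt (1 - 2 * s)))"
    by (subst G) (simp_all only: gaussian_exp_square[OF s(2)], measurable)
  also have "ennreal (2 ^ card J) * \<dots> = ennreal (2 ^ card J * (1 / sqrt (1 - 2 * s)) ^ d)"
    using s by (simp add: ennreal_power ennreal_mult[symmetric])
  finally show ?thesis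
    using s by (subst (asm) ennreal_le_iff) auto
qed

text \<open>Squared, the claim reads \<open>1 / (1 - 2 * s) \<le> exp (2 * s + 4 * s^2)\<close>, and
  for \<open>s \<le> 1 / 4\<close> the quadratic Taylor polynomial of the exponential is already
  large enough.\<close>

lemma inverse_sqrt_le_exp:
  assumes "0 \<le> s" "s \<le> 1 / 4" shows "1 / sqrt (1 - 2 * s) \<le> exp (s + 2 * s\<^sup>2)"
proof -
  have "1 / (1 - 2 * s) \<le> 1 + (2 * s + 4 * s\<^sup>2) + (2 * s + 4 * s\<^sup>2)\<^sup>2 / 2"
  proof -
    have "1 \<le> (1 + (2 * s + 4 * s\<^sup>2) + (2 * s + 4 * s\<^sup>2)\<^sup>2 / 2) * (1 - 2 * s)"
    proof -
      have "(1 + (2 * s + 4 * s\<^sup>2) + (2 * s + 4 * s\<^sup>2)\<^sup>2 / 2) * (1 - 2 * s) - 1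
          = 2 * s\<^sup>2 * (1 - 2 * s - 4 * s\<^sup>2 - 8 * s ^ 3)"
        by (simp add: power2_eq_square power3_eq_cube field_simps)
      moreover have "s\<^sup>2 \<le> (1/4)\<^sup>2" "s ^ 3 \<le> (1/4) ^ 3" using assms by (intro power_mono; simp)+
      then have "0 \<le> 1 - 2 * s - 4 * s\<^sup>2 - 8 * s ^ 3" using assms by (simp add: power_divide)
      ultimately show ?thesis by (smt (verit) mult_nonneg_nonneg zero_le_power2)
    qed
    then show ?thesis using assms by (simp add: divide_le_eq)
  qed
  also have "\<dots> \<le> exp (2 * s + 4 * s\<^sup>2)"
    using exp_lower_Taylor_quadratic[of "2 * s + 4 * s\<^sup>2"] assms by simp
  finally have "sqrt (1 / (1 - 2 * s)) \<le> sqrt (exp (2 * s + 4 * s\<^sup>2))" by (rule real_sqrt_le_mono)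
  also have "sqrt (exp (2 * s + 4 * s\<^sup>2)) = exp (s + 2 * s\<^sup>2)"
    by (rule real_sqrt_unique) (simp_all add: power2_eq_square exp_add[symmetric])
  finally show ?thesis by (simp add: real_sqrt_divide)
qed

lemma sign_chaos_tail:
  fixes q :: "'j \<Rightarrow> nat \<Rightarrow> real"
  assumes J: "finite J" and t: "0 < t"
    and orth: "\<And>c c'. c < d \<Longrightarrow> c' < d \<Longrightarrow> (\<Sum>j\<in>J. q j c * q j c') = (if c = c' then 1 else 0)"
  shows "real (card {\<xi> \<in> PiE J (\<lambda>_. {-1, 1}). (sqrt (real d) + t)\<^sup>2 < (\<Sum>c<d. (\<Sum>j\<in>J. \<xi> j * q j c)\<^sup>2)})
    \<le> 2 ^ card J * exp (- t\<^sup>2 / 4)"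
proof -
  define a where "a = sqrt (real d)"
  have a: "0 \<le> a" "a\<^sup>2 = real d" by (simp_all add: a_def)
  \<comment> \<open>Chosen so that \<open>s * (a + t) = t / 4\<close>, which keeps
    \<open>s \<le> 1 / 4\<close> and \<open>a * s \<le> t / 4\<close>. The second-order term
    \<open>2 * (a * s)^2\<close> is then at most \<open>a * s * t / 2\<close>, and the exponent
    stays below \<open>- (s * (a + t) * t) = - t^2 / 4\<close>.\<close>
  define s where "s = t / (4 * (a + t))"
  have at: "0 < a + t" using a t by simp
  have s: "0 \<le> s" "s \<le> 1 / 4" using a t at by (simp_all add: s_def field_simps)
  have st: "s * (a + t) = t / 4"
  proof -
    have "u * c / (4 * u) = c / 4" if "0 < u" for u c :: real using that by simp
    from this[OF at, of t] show ?thesis unfolding s_def by (simp only: times_divide_eq_left mult.commute[of t])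
  qed
  define \<Xi> where "\<Xi> = PiE J (\<lambda>_. {-1, 1 :: real})"
  define F where "F \<xi> = (\<Sum>c<d. (\<Sum>j\<in>J. \<xi> j * q j c)\<^sup>2)" for \<xi> :: "'j \<Rightarrow> real"
  have fin: "finite \<Xi>" unfolding \<Xi>_def by (intro finite_PiE J) auto
  have "real (card {\<xi> \<in> \<Xi>. (a + t)\<^sup>2 < F \<xi>}) * exp (s * (a + t)\<^sup>2) = (\<Sum>\<xi>\<in>{\<xi> \<in> \<Xi>. (a + t)\<^sup>2 < F \<xi>}. exp (s * (a + t)\<^sup>2))"
    by simp
  also have "\<dots> \<le> (\<Sum>\<xi>\<in>{\<xi> \<in> \<Xi>. (a + t)\<^sup>2 < F \<xi>}. exp (s * F \<xi>))"
    using s by (intro sum_mono) (auto intro!: mult_left_mono)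
  also have "\<dots> \<le> (\<Sum>\<xi>\<in>\<Xi>. exp (s * F \<xi>))"
    by (intro sum_mono2 fin) auto
  also have "\<dots> \<le> 2 ^ card J * (1 / sqrt (1 - 2 * s)) ^ d"
    unfolding \<Xi>_def F_def using s by (intro sign_chaos_mgf J orth) auto
  also have "\<dots> \<le> 2 ^ card J * exp (s + 2 * s\<^sup>2) ^ d"
    using s by (intro mult_left_mono power_mono inverse_sqrt_le_exp) auto
  also have "\<dots> = 2 ^ card J * exp (a\<^sup>2 * (s + 2 * s\<^sup>2))" by (simp add: a(2) exp_of_nat_mult[symmetric])
  finally have "real (card {\<xi> \<in> \<Xi>. (a + t)\<^sup>2 < F \<xi>}) \<le> 2 ^ card J * exp (a\<^sup>2 * (s + 2 * s\<^sup>2) - s * (a + t)\<^sup>2)"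
    by (simp add: exp_diff field_simps)
  also have "\<dots> \<le> 2 ^ card J * exp (- t\<^sup>2 / 4)"
  proof -
    have "s * a + s * t = t / 4" using st by (simp only: distrib_left)
    moreover have "0 \<le> s * t" using s t by simp
    ultimately have "a * s \<le> t / 4" by (simp only: mult.commute[of a s])
    then have "2 * (a * s) * (a * s) \<le> 2 * (a * s) * (t / 4)" using a s by (intro mult_left_mono) auto
    moreover have "a\<^sup>2 * (s + 2 * s\<^sup>2) - s * (a + t)\<^sup>2 = 2 * (a * s) * (a * s) - 2 * (a * s * t) - s * t * t"
      by (simp add: power2_eq_square algebra_simps)
    moreover have "a * s * t + s * t * t = t\<^sup>2 / 4"
    proof -
      have "a * s * t + s * t * t = s * (a + t) * t" by (simp add: algebra_simps)
      then show ?thesis by (simp add: st power2_eq_square)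
    qed
    moreover have "0 \<le> a * s * t" using a s t by simp
    ultimately have "a\<^sup>2 * (s + 2 * s\<^sup>2) - s * (a + t)\<^sup>2 \<le> - t\<^sup>2 / 4" by argo
    then show ?thesis by simp
  qed
  finally show ?thesis by (simp add: \<Xi>_def F_def a_def)
qed

subsection \<open>Rows of the block SRHT\<close>

text \<open>The sum factors over the coordinates, and for \<open>i\<close> different from
  \<open>i'\<close> coordinate \<open>i\<close> contributes the factor -1 + 1.\<close>

lemma sum_sign_pair:
  assumes "finite I" "i \<in> I" "i' \<in> I"
  shows "(\<Sum>v\<in>PiE I (\<lambda>_. {-1, 1 :: real}). v i * v i') = (if i = i' then 2 ^ card I else 0)"
proof -
  define g where "g x e = (if x = i then e else 1) * (if x = i' then e else 1)" for x and e :: real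
  have "v i * v i' = (\<Prod>x\<in>I. g x (v x))" for v
    using assms by (simp add: g_def prod.distrib prod.delta)
  then have "(\<Sum>v\<in>PiE I (\<lambda>_. {-1, 1 :: real}). v i * v i') = (\<Sum>v\<in>PiE I (\<lambda>_. {-1, 1}). \<Prod>x\<in>I. g x (v x))"
    by (intro sum.cong) simp_all
  also have "\<dots> = (\<Prod>x\<in>I. \<Sum>e\<in>{-1, 1}. g x e)"
    by (rule prod_sum_PiE[symmetric]) (use assms in auto)
  also have "\<dots> = (if i = i' then 2 ^ card I else 0)"
  proof (cases "i = i'")
    case True
    then have "(\<Sum>e\<in>{-1, 1}. g x e) = 2" for x by (simp add: g_def)
    then show ?thesis using True by simp
  next
    case False
    then have "(\<Sum>e\<in>{-1, 1}. g i e) = 0" by (simp add: g_def)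
    then have "(\<Prod>x\<in>I. \<Sum>e\<in>{-1, 1}. g x e) = 0" using assms by (intro prod_zero bexI[of _ i])
    then show ?thesis using False by simp
  qed
  finally show ?thesis .
qed

lemma sum_swap_pairs:
  "(\<Sum>s\<in>A. \<Sum>v\<in>B. \<Sum>x\<in>C. \<Sum>y\<in>D. F s v x y) = (\<Sum>x\<in>C. \<Sum>y\<in>D. \<Sum>s\<in>A. \<Sum>v\<in>B. F s v x y)"
proof -
  have "(\<Sum>a\<in>A \<times> B. \<Sum>c\<in>C \<times> D. F (fst a) (snd a) (fst c) (snd c))
      = (\<Sum>c\<in>C \<times> D. \<Sum>a\<in>A \<times> B. F (fst a) (snd a) (fst c) (snd c))"
    by (rule sum.swap)
  then show ?thesis by (simp only: sum.cartesian_product' fst_conv snd_conv)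
qed

lemma sum_sum_mult:
  fixes w :: real
  shows "(\<Sum>s\<in>A. \<Sum>v\<in>B. w * (f v * g s)) = w * ((\<Sum>v\<in>B. f v) * (\<Sum>s\<in>A. g s))"
proof -
  have "(\<Sum>s\<in>A. \<Sum>v\<in>B. w * (f v * g s)) = (\<Sum>s\<in>A. (w * (\<Sum>v\<in>B. f v)) * g s)"
    by (simp add: sum_distrib_left sum_distrib_right mult.assoc)
  then show ?thesis by (simp only: sum_distrib_left[symmetric] mult.assoc)
qed

text \<open>Row \<open>a\<close> of \<open>sqrt l\<close> times the block SRHT, applied to an orthonormal basis \<open>q\<close> of the subspace, depends
  only on the diagonals \<open>u\<close> of the matrices \<open>D\<close>, and on the sampled index and the \<open>p\<close> signs (the
  \<open>a\<close>-th entries of the diagonals of the matrices \<open>D\<close> with a tilde), which make up an element of \<open>R\<close>.\<close>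

locale srht_rows =
  fixes p r d :: nat and \<sigma> :: "nat \<Rightarrow> nat \<Rightarrow> real" and q :: "nat \<times> nat \<Rightarrow> nat \<Rightarrow> real"
  assumes p: "0 < p" and r: "0 < r"
    and sign: "\<And>s j. s < r \<Longrightarrow> j < r \<Longrightarrow> \<sigma> s j \<in> {-1, 1}"
    and had: "\<And>j j'. j < r \<Longrightarrow> j' < r \<Longrightarrow> (\<Sum>s<r. \<sigma> s j * \<sigma> s j') = (if j = j' then real r else 0)"
    and orth: "\<And>c c'. c < d \<Longrightarrow> c' < d \<Longrightarrow>
      (\<Sum>ij\<in>{..<p} \<times> {..<r}. q ij c * q ij c') = (if c = c' then 1 else 0)"
begin

abbreviation J :: "(nat \<times> nat) set" where "J \<equiv> {..<p} \<times> {..<r}"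

definition U :: "(nat \<times> nat \<Rightarrow> real) set" where
  "U = PiE J (\<lambda>_. {-1, 1})"

definition R :: "(nat \<times> (nat \<Rightarrow> real)) set" where
  "R = {..<r} \<times> PiE {..<p} (\<lambda>_. {-1, 1})"

definition row :: "(nat \<times> nat \<Rightarrow> real) \<Rightarrow> nat \<times> (nat \<Rightarrow> real) \<Rightarrow> nat \<Rightarrow> real" where
  "row u \<rho> c = (\<Sum>(i, j)\<in>J. snd \<rho> i * \<sigma> (fst \<rho>) j * u (i, j) * q (i, j) c)"

lemma finite_U: "finite U" and finite_R: "finite R"
  unfolding U_def R_def by (intro finite_PiE finite_cartesian_product; simp)+

lemma card_U: "card U = 2 ^ (p * r)"
  by (simp add: U_def card_PiE card_cartesian_product numeral_2_eq_2)

lemma card_R: "card R = r * 2 ^ p"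
  by (simp add: R_def card_PiE card_cartesian_product numeral_2_eq_2)

lemma card_R_pos: "0 < real (card R)"
  using r by (simp add: card_R)

text \<open>All blocks share one sampled index, so Hadamard orthogonality cannot separate equal
  columns of different blocks; the block signs \<open>snd \<rho>\<close> do that. Within a block
  these signs square to 1 and Hadamard orthogonality separates the columns.\<close>

lemma row_isotropic:
  assumes u: "u \<in> U" and c: "c < d" "c' < d"
  shows "(\<Sum>\<rho>\<in>R. row u \<rho> c * row u \<rho> c') = (if c = c' then real (card R) else 0)"
proof -
  let ?S = "PiE {..<p} (\<lambda>_. {-1, 1 :: real})"
  define w where "w x y = u x * q x c * (u y * q y c')" for x y
  have "(\<Sum>\<rho>\<in>R. row u \<rho> c * row u \<rho> c')
      = (\<Sum>s<r. \<Sum>v\<in>?S. \<Sum>x\<in>J. \<Sum>y\<in>J. w x y * ((v (fst x) * v (fst y)) * (\<sigma> s (snd x) * \<sigma> s (snd y))))"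
    unfolding R_def
    by (subst sum.cartesian_product') (simp add: row_def sum_product case_prod_unfold w_def ac_simps)
  also have "\<dots> = (\<Sum>x\<in>J. \<Sum>y\<in>J. w x y * ((\<Sum>v\<in>?S. v (fst x) * v (fst y)) * (\<Sum>s<r. \<sigma> s (snd x) * \<sigma> s (snd y))))"
    by (subst sum_swap_pairs) (intro sum.cong refl sum_sum_mult)
  also have "\<dots> = (\<Sum>x\<in>J. \<Sum>y\<in>J. if x = y then real (card R) * (q x c * q x c') else 0)"
  proof (intro sum.cong refl)
    fix x y assume x: "x \<in> J" and y: "y \<in> J"
    have "u x \<in> {-1, 1}" using PiE_mem[OF u[unfolded U_def] x] .
    then have ux: "u x * u x = 1" by auto
    have "w x x = (u x * u x) * (q x c * q x c')" by (simp add: w_def ac_simps)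
    then have wx: "w x x = q x c * q x c'" using ux by simp
    show "w x y * ((\<Sum>v\<in>?S. v (fst x) * v (fst y)) * (\<Sum>s<r. \<sigma> s (snd x) * \<sigma> s (snd y)))
        = (if x = y then real (card R) * (q x c * q x c') else 0)"
    proof -
      have "(\<Sum>v\<in>?S. v (fst x) * v (fst y)) = (if fst x = fst y then 2 ^ p else 0)"
        using sum_sign_pair[of "{..<p}" "fst x" "fst y"] x y by (simp add: mem_Times_iff)
      moreover have "(\<Sum>s<r. \<sigma> s (snd x) * \<sigma> s (snd y)) = (if snd x = snd y then real r else 0)"
        using x y by (intro had) (simp_all add: mem_Times_iff)
      moreover have "x = y \<longleftrightarrow> fst x = fst y \<and> snd x = snd y" by (rule prod_eq_iff)
      ultimately show ?thesis using wx by (cases "x = y") (auto simp: card_R)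
    qed
  qed
  also have "\<dots> = real (card R) * (\<Sum>x\<in>J. q x c * q x c')"
    by (simp add: sum_distrib_left)
  finally show ?thesis by (simp add: orth[OF c])
qed

lemma sign_row:
  assumes "\<rho> \<in> R" "x \<in> J"
  shows "snd \<rho> (fst x) \<in> {-1, 1}" "\<sigma> (fst \<rho>) (snd x) \<in> {-1, 1}"
proof -
  have m: "fst \<rho> < r" "snd \<rho> \<in> PiE {..<p} (\<lambda>_. {-1, 1})" "fst x < p" "snd x < r"
    using assms by (simp_all add: R_def mem_Times_iff)
  show "snd \<rho> (fst x) \<in> {-1, 1}" using PiE_mem[OF m(2)] m(3) by simp
  show "\<sigma> (fst \<rho>) (snd x) \<in> {-1, 1}" by (rule sign[OF m(1,4)])
qed

text \<open>A crude Cauchy-Schwarz bound, meant for the long rows, where it is multiplied by their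
  tiny fraction.\<close>

lemma row_norm_le:
  assumes u: "u \<in> U" and \<rho>: "\<rho> \<in> R"
  shows "ip d (row u \<rho>) (row u \<rho>) \<le> real d * real (p * r)"
proof -
  have "row u \<rho> c * row u \<rho> c \<le> real (p * r)" if c: "c < d" for c
  proof -
    define e where "e x = snd \<rho> (fst x) * \<sigma> (fst \<rho>) (snd x) * u x" for x
    have e: "(e x)\<^sup>2 = 1" if "x \<in> J" for x
    proof -
      have "u x \<in> {-1, 1}" using PiE_mem[OF u[unfolded U_def] that] .
      moreover note sign_row[OF \<rho> that]
      ultimately
      show ?thesis by (auto simp: e_def)
    qed
    have "row u \<rho> c = (\<Sum>x\<in>J. e x * q x c)" by (simp add: row_def e_def case_prod_unfold)
    then have "row u \<rho> c * row u \<rho> c = (\<Sum>x\<in>J. e x * q x c)\<^sup>2" by (simp add: power2_eq_square)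
    also have "\<dots> \<le> (\<Sum>x\<in>J. (e x)\<^sup>2) * (\<Sum>x\<in>J. (q x c)\<^sup>2)" by (rule Cauchy_Schwarz_ineq_sum)
    also have "(\<Sum>x\<in>J. (q x c)\<^sup>2) = 1" using orth[OF c c] by (simp add: power2_eq_square)
    also have "(\<Sum>x\<in>J. (e x)\<^sup>2) = real (p * r)" using e by (simp add: card_cartesian_product)
    finally show ?thesis by simp
  qed
  then have "ip d (row u \<rho>) (row u \<rho>) \<le> (\<Sum>c<d. real (p * r))"
    unfolding ip_def by (intro sum_mono) auto
  then show ?thesis by simp
qed

text \<open>Multiplying \<open>u\<close> by the fixed signs of the row is an involution of
  \<open>U\<close>, so every row has the same norm distribution as the plain random signed
  sum.\<close>

lemma card_large_row_le:
  assumes \<rho>: "\<rho> \<in> R" and t: "0 < t"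
  shows "real (card {u \<in> U. (sqrt (real d) + t)\<^sup>2 < ip d (row u \<rho>) (row u \<rho>)})
    \<le> real (card U) * exp (- t\<^sup>2 / 4)"
proof -
  define e where "e x = snd \<rho> (fst x) * \<sigma> (fst \<rho>) (snd x)" for x
  define flip where "flip u = restrict (\<lambda>x. e x * u x) J" for u
  have e: "e x \<in> {-1, 1}" if "x \<in> J" for x
  proof -
    show ?thesis using sign_row[OF \<rho> that] by (auto simp: e_def)
  qed
  have flip_U: "flip u \<in> U" if "u \<in> U" for u
    unfolding flip_def U_def
  proof (rule restrict_PiE_iff[THEN iffD2], rule ballI)
    fix x assume x: "x \<in> J"
    have "u x \<in> {-1, 1}" using PiE_mem[OF that[unfolded U_def] x] .
    with e[OF x] show "e x * u x \<in> {-1, 1}" by auto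
  qed
  have flip_flip: "flip (flip u) = u" if "u \<in> U" for u
  proof
    fix x show "flip (flip u) x = u x"
    proof (cases "x \<in> J")
      case True
      then have "e x * e x = 1" using e[of x] by auto
      then show ?thesis using True by (simp add: flip_def flip: mult.assoc)
    next
      case False
      then show ?thesis using PiE_arb[OF that[unfolded U_def]] by (simp add: flip_def)
    qed
  qed
  have ipq: "ip d (row u \<rho>) (row u \<rho>) = (\<Sum>c<d. (\<Sum>x\<in>J. flip u x * q x c)\<^sup>2)" for u
    by (simp add: ip_def row_def flip_def e_def case_prod_unfold power2_eq_square ac_simps cong: sum.cong)
  let ?A = "{u \<in> U. (sqrt (real d) + t)\<^sup>2 < ip d (row u \<rho>) (row u \<rho>)}"
  let ?B = "{\<xi> \<in> PiE J (\<lambda>_. {-1, 1}). (sqrt (real d) + t)\<^sup>2 < (\<Sum>c<d. (\<Sum>x\<in>J. \<xi> x * q x c)\<^sup>2)}"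
  have "card ?A \<le> card ?B"
  proof (rule card_inj_on_le)
    show "inj_on flip ?A" using flip_flip by (intro inj_on_inverseI[where g = flip]) auto
    show "flip ` ?A \<subseteq> ?B" using flip_U unfolding ipq by (auto simp: U_def)
    show "finite ?B" using finite_U by (simp add: U_def)
  qed
  also have "real (card ?B) \<le> 2 ^ card J * exp (- t\<^sup>2 / 4)"
    by (rule sign_chaos_tail[OF _ t orth]) auto
  finally show ?thesis by (simp add: card_U card_cartesian_product)
qed

definition large :: "real \<Rightarrow> (nat \<times> nat \<Rightarrow> real) \<Rightarrow> (nat \<times> (nat \<Rightarrow> real)) set" where
  "large B u = {\<rho> \<in> R. B < ip d (row u \<rho>) (row u \<rho>)}"

text \<open>After exchanging the two counts, the mean fraction of long rows is at most the tail of a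
  single row, and Markov's inequality applies. This avoids the factor \<open>card R\<close>,
  exponential in \<open>p\<close>, of a union bound.\<close>

lemma card_many_large_le:
  assumes t: "0 < t" and \<gamma>: "0 < \<gamma>"
  shows "real (card {u \<in> U. \<gamma> * real (card R) < real (card (large ((sqrt (real d) + t)\<^sup>2) u))})
    \<le> real (card U) * (exp (- t\<^sup>2 / 4) / \<gamma>)"
proof -
  let ?B = "(sqrt (real d) + t)\<^sup>2"
  let ?A = "{u \<in> U. \<gamma> * real (card R) < real (card (large ?B u))}"
  have "real (card ?A) * (\<gamma> * real (card R)) = (\<Sum>u\<in>?A. \<gamma> * real (card R))" by simp
  also have "\<dots> \<le> (\<Sum>u\<in>?A. real (card (large ?B u)))" by (intro sum_mono) auto
  also have "\<dots> \<le> (\<Sum>u\<in>U. real (card (large ?B u)))" by (intro sum_mono2 finite_U) auto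
  also have "\<dots> = (\<Sum>u\<in>U. \<Sum>\<rho>\<in>R. if ?B < ip d (row u \<rho>) (row u \<rho>) then 1 else 0)"
    by (simp add: large_def sum.If_cases finite_R Int_def)
  also have "\<dots> = (\<Sum>\<rho>\<in>R. \<Sum>u\<in>U. if ?B < ip d (row u \<rho>) (row u \<rho>) then 1 else 0)"
    by (rule sum.swap)
  also have "\<dots> = (\<Sum>\<rho>\<in>R. real (card {u \<in> U. ?B < ip d (row u \<rho>) (row u \<rho>)}))"
    by (simp add: sum.If_cases finite_U Int_def)
  also have "\<dots> \<le> (\<Sum>\<rho>\<in>R. real (card U) * exp (- t\<^sup>2 / 4))"
    by (intro sum_mono card_large_row_le t)
  also have "\<dots> = real (card R) * (real (card U) * exp (- t\<^sup>2 / 4))" by simp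
  finally have "real (card R) * (real (card ?A) * \<gamma>) \<le> real (card R) * (real (card U) * exp (- t\<^sup>2 / 4))"
    by (simp add: ac_simps)
  then have "real (card ?A) * \<gamma> \<le> real (card U) * exp (- t\<^sup>2 / 4)"
    using card_R_pos by (simp only: mult_le_cancel_left_pos)
  then show ?thesis using \<gamma> by (simp add: field_simps)
qed

definition distorted :: "nat \<Rightarrow> real \<Rightarrow> (nat \<times> nat \<Rightarrow> real) \<Rightarrow> (nat \<Rightarrow> nat \<times> (nat \<Rightarrow> real)) \<Rightarrow> bool" where
  "distorted l \<epsilon> u f \<longleftrightarrow> (\<exists>x. \<epsilon> * ip d x x < \<bar>ip d x x - (\<Sum>a<l. (ip d (row u (f a)) x)\<^sup>2) / real l\<bar>)"

lemma card_distorted_le: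
  assumes u: "u \<in> U" and l: "0 < l" and B: "0 < B" and b: "0 < b" and \<epsilon>: "0 < \<epsilon>" "\<epsilon> < 1"
    and \<gamma>: "real (card (large B u)) \<le> \<gamma> * real (card R)" "\<gamma> \<le> 1"
    and \<eta>: "real d * real (p * r) * \<gamma> \<le> \<eta>"
  shows "real (card {f \<in> PiE {..<l} (\<lambda>_. R). distorted l \<epsilon> u f})
    \<le> real (card R) ^ l * (real l * \<gamma>
        + real d * exp (real l / B * (exp b - 1 - b * (1 + \<epsilon>)))
        + real d * exp (real l / B * (b * (1 - \<epsilon>) - (1 - exp (- b)) * (1 - \<eta>))))"
proof -
  let ?N = "real (card R)"
  \<comment> \<open>This scaling carries the threshold \<open>B\<close> for rows to the threshold
    \<open>b\<close> for \<open>z\<close>, which makes \<open>b\<close> the tuning parameter of the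
    Chernoff bound.\<close>
  define \<kappa> where "\<kappa> = b / B"
  have \<kappa>: "0 < \<kappa>" using b B by (simp add: \<kappa>_def)
  define z where "z \<rho> = (\<lambda>i. sqrt \<kappa> * row u \<rho> i)" for \<rho>
  have ipz: "ip d (z \<rho>) x = sqrt \<kappa> * ip d (row u \<rho>) x" for \<rho> x
    unfolding z_def by (rule ip_scale_left)
  have ipzz: "ip d (z \<rho>) (z \<rho>) = \<kappa> * ip d (row u \<rho>) (row u \<rho>)" for \<rho>
    using \<kappa> unfolding z_def ip_scale_left ip_scale_right by (simp flip: mult.assoc)
  interpret S: isotropic_sample d R z "\<kappa> * ?N" b
  proof
    show "finite R" by (rule finite_R)
    show "R \<noteq> {}" using card_R_pos by auto
    fix i j assume ij: "i < d" "j < d"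
    have "(\<Sum>\<rho>\<in>R. z \<rho> i * z \<rho> j) = \<kappa> * (\<Sum>\<rho>\<in>R. row u \<rho> i * row u \<rho> j)"
    proof -
      have "sqrt \<kappa> * a * (sqrt \<kappa> * b) = \<kappa> * (a * b)" for a b
      proof -
        have "sqrt \<kappa> * a * (sqrt \<kappa> * b) = (sqrt \<kappa> * sqrt \<kappa>) * (a * b)" by (simp only: ac_simps)
        then show ?thesis using \<kappa> by simp
      qed
      then show ?thesis by (simp only: z_def sum_distrib_left)
    qed
    then show "(\<Sum>\<rho>\<in>R. z \<rho> i * z \<rho> j) = (if i = j then \<kappa> * ?N else 0)"
      by (simp add: row_isotropic[OF u ij])
  qed (use b \<kappa> in simp_all)
  have large_iff: "b < ip d (z \<rho>) (z \<rho>) \<longleftrightarrow> B < ip d (row u \<rho>) (row u \<rho>)" for \<rho>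
  proof -
    have "b = \<kappa> * B" using B by (simp add: \<kappa>_def)
    then show ?thesis unfolding ipzz using \<kappa> by (simp only: mult_less_cancel_left_pos)
  qed
  have excess: "S.excess \<le> \<kappa> * \<eta> * ?N"
  proof -
    have "S.excess \<le> (\<Sum>\<rho>\<in>large B u. \<kappa> * (real d * real (p * r)))"
      unfolding S.excess_def large_iff large_def unfolding ipzz
      using u \<kappa> by (intro sum_mono mult_left_mono row_norm_le) auto
    also have "\<dots> = \<kappa> * (real d * real (p * r)) * real (card (large B u))" by simp
    also have "\<dots> \<le> \<kappa> * (real d * real (p * r)) * (\<gamma> * ?N)"
      using \<kappa> by (intro mult_left_mono \<gamma>) simp
    also have "\<dots> = \<kappa> * (real d * real (p * r) * \<gamma>) * ?N" by simp
    also have "\<dots> \<le> \<kappa> * \<eta> * ?N" using \<kappa> by (intro mult_right_mono mult_left_mono \<eta>) auto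
    finally show ?thesis .
  qed
  define T where "T = PiE {..<l} (\<lambda>_. R)"
  have finT: "finite T" and cardT: "real (card T) = ?N ^ l"
    unfolding T_def using finite_R by (auto intro!: finite_PiE simp: card_PiE)
  \<comment> \<open>Outside \<open>bad\<close> no long vector is drawn, so truncation leaves the
    sample unchanged and the two Chernoff events describe the true rows.\<close>
  define bad where "bad = {f \<in> T. \<exists>a<l. f a \<in> large B u}"
  define up where "up = {f \<in> T. \<exists>x. 0 < ip d x x \<and> \<kappa> * real l * (1 + \<epsilon>) * ip d x x \<le> (\<Sum>a<l. (ip d (S.trunc (f a)) x)\<^sup>2)}"
  define low where "low = {f \<in> T. \<exists>x. 0 < ip d x x \<and> (\<Sum>a<l. (ip d (S.trunc (f a)) x)\<^sup>2) \<le> \<kappa> * real l * (1 - \<epsilon>) * ip d x x}"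
  have sub: "{f \<in> T. distorted l \<epsilon> u f} \<subseteq> bad \<union> (up \<union> low)"
  proof
    fix f assume "f \<in> {f \<in> T. distorted l \<epsilon> u f}"
    then obtain x where fT: "f \<in> T"
      and x: "\<epsilon> * ip d x x < \<bar>ip d x x - (\<Sum>a<l. (ip d (row u (f a)) x)\<^sup>2) / real l\<bar>"
      by (auto simp: distorted_def)
    define Q where "Q = (\<Sum>a<l. (ip d (row u (f a)) x)\<^sup>2)"
    \<comment> \<open>If the norm were 0, all products with rows would vanish and the strict
      inequality in \<open>distorted\<close> would fail.\<close>
    have pos: "0 < ip d x x"
    proof (rule ccontr)
      assume "\<not> 0 < ip d x x"
      then have "ip d x x = 0" using ip_self_nonneg[of d x] by simp
      moreover have "(ip d w x)\<^sup>2 \<le> ip d w w * ip d x x" for w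
        by (rule psd_cauchy_schwarz[OF psd_id])
      ultimately have "ip d w x = 0" for w by simp
      then show False using x \<open>ip d x x = 0\<close> by simp
    qed
    show "f \<in> bad \<union> (up \<union> low)"
    proof (cases "f \<in> bad")
      case False
      have "(ip d (S.trunc (f a)) x)\<^sup>2 = \<kappa> * (ip d (row u (f a)) x)\<^sup>2" if "a < l" for a
      proof -
        have "f a \<in> R" using fT that by (auto simp: T_def)
        then have "\<not> B < ip d (row u (f a)) (row u (f a))"
          using False fT that by (auto simp: bad_def large_def)
        then have "S.trunc (f a) = z (f a)" using large_iff[of "f a"] by (simp add: S.trunc_def)
        then show ?thesis using \<kappa> by (simp add: ipz power_mult_distrib)
      qed
      then have tr: "(\<Sum>a<l. (ip d (S.trunc (f a)) x)\<^sup>2) = \<kappa> * Q"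
        by (simp add: Q_def sum_distrib_left)
      have "(1 + \<epsilon>) * ip d x x < Q / real l \<or> Q / real l < (1 - \<epsilon>) * ip d x x"
        using x unfolding Q_def[symmetric] by (auto simp: algebra_simps abs_real_def split: if_splits)
      then have "real l * (1 + \<epsilon>) * ip d x x \<le> Q \<or> Q \<le> real l * (1 - \<epsilon>) * ip d x x"
        using l by (auto simp: field_simps)
      then have "\<kappa> * (real l * (1 + \<epsilon>) * ip d x x) \<le> \<kappa> * Q \<or> \<kappa> * Q \<le> \<kappa> * (real l * (1 - \<epsilon>) * ip d x x)"
        using \<kappa> by (simp only: mult_le_cancel_left_pos)
      then show ?thesis using fT pos tr by (auto simp: up_def low_def mult.assoc)
    qed simp
  qed
  have "real (card {f \<in> T. distorted l \<epsilon> u f}) \<le> real (card (bad \<union> (up \<union> low)))"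
    using finT by (intro of_nat_mono card_mono sub) (auto simp: bad_def up_def low_def)
  also have "\<dots> \<le> real (card bad + (card up + card low))"
    using card_Un_le[of bad "up \<union> low"] card_Un_le[of up low] by (intro of_nat_mono) linarith
  finally have tot: "real (card {f \<in> T. distorted l \<epsilon> u f}) \<le> real (card bad) + (real (card up) + real (card low))"
    by simp
  have "real (card bad) \<le> ?N ^ l * (real l * \<gamma>)"
  proof -
    \<comment> \<open>The complement is a product set, so Bernoulli's inequality yields the union
      bound over the \<open>l\<close> draws.\<close>
    have "T - bad = PiE {..<l} (\<lambda>_. R - large B u)"
      by (auto simp: T_def bad_def PiE_def Pi_def)
    then have "card (T - bad) = card (R - large B u) ^ l" by (simp add: card_PiE)
    also have "card (R - large B u) = card R - card (large B u)"
      using finite_R by (intro card_Diff_subset) (auto simp: large_def)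
    finally have "real (card (T - bad)) = (?N - real (card (large B u))) ^ l"
      using finite_R by (simp add: of_nat_diff card_mono large_def)
    also have "\<dots> \<ge> (?N * (1 - \<gamma>)) ^ l"
      using \<gamma> mult_right_mono[OF \<gamma>(2), of ?N] by (intro power_mono) (auto simp: algebra_simps)
    also have "(?N * (1 - \<gamma>)) ^ l \<ge> ?N ^ l * (1 - real l * \<gamma>)"
      using Bernoulli_inequality[of "- \<gamma>" l] \<gamma>(2) by (simp add: power_mult_distrib mult_left_mono)
    finally have "real (card (T - bad)) \<ge> ?N ^ l * (1 - real l * \<gamma>)" by simp
    moreover have "card T = card bad + card (T - bad)"
      using finT by (intro card_Int_Diff[of T bad, simplified Int_absorb1, THEN trans])
        (auto simp: bad_def Int_absorb1 intro!: arg_cong2[where f = "(+)"] arg_cong[where f = card])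
    ultimately show ?thesis using cardT by (simp add: algebra_simps)
  qed
  moreover have "real (card up) \<le> ?N ^ l * (real d * exp (real l / B * (exp b - 1 - b * (1 + \<epsilon>))))"
  proof -
    have "real (card up) \<le> (?N * exp ((exp b - 1) / b * (\<kappa> * ?N) / ?N)) ^ l * (real d * exp (- (\<kappa> * real l * (1 + \<epsilon>))))"
      unfolding up_def T_def S.tuples_def[symmetric]
      using \<kappa> \<epsilon> by (intro S.matrix_chernoff_upper) simp
    also have "\<dots> = ?N ^ l * (real d * (exp (real l * ((exp b - 1) / b * \<kappa>)) * exp (- (\<kappa> * real l * (1 + \<epsilon>)))))"
    proof -
      have "(exp b - 1) / b * (\<kappa> * ?N) / ?N = (exp b - 1) / b * \<kappa>" using card_R_pos by simp
      then show ?thesis unfolding exp_of_nat_mult power_mult_distrib by (simp only: ac_simps)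
    qed
    also have "exp (real l * ((exp b - 1) / b * \<kappa>)) * exp (- (\<kappa> * real l * (1 + \<epsilon>)))
        = exp (real l / B * (exp b - 1 - b * (1 + \<epsilon>)))"
      unfolding exp_add[symmetric] \<kappa>_def using b B by (intro arg_cong[where f = exp]) (simp add: field_simps)
    finally show ?thesis .
  qed
  moreover have "real (card low) \<le> ?N ^ l * (real d * exp (real l / B * (b * (1 - \<epsilon>) - (1 - exp (- b)) * (1 - \<eta>))))"
  proof -
    define h where "h = (1 - exp (- b)) / b"
    have h: "0 \<le> h" using b by (simp add: h_def)
    have "real (card low) \<le> (?N * exp (- h * (\<kappa> * ?N - S.excess) / ?N)) ^ l * (real d * exp (\<kappa> * real l * (1 - \<epsilon>)))"
      unfolding low_def T_def S.tuples_def[symmetric] h_def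
      using \<kappa> \<epsilon> by (intro S.matrix_chernoff_lower) simp
    also have "\<dots> \<le> (?N * exp (- h * (\<kappa> * (1 - \<eta>)))) ^ l * (real d * exp (\<kappa> * real l * (1 - \<epsilon>)))"
    proof (intro mult_right_mono power_mono mult_left_mono)
      have "\<kappa> * (1 - \<eta>) \<le> (\<kappa> * ?N - S.excess) / ?N"
        using excess card_R_pos by (simp add: field_simps)
      then have "h * (\<kappa> * (1 - \<eta>)) \<le> h * ((\<kappa> * ?N - S.excess) / ?N)" by (intro mult_left_mono h)
      then show "exp (- h * (\<kappa> * ?N - S.excess) / ?N) \<le> exp (- h * (\<kappa> * (1 - \<eta>)))" by simp
    qed auto
    also have "\<dots> = ?N ^ l * (real d * (exp (real l * (- h * (\<kappa> * (1 - \<eta>)))) * exp (\<kappa> * real l * (1 - \<epsilon>))))"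
      unfolding exp_of_nat_mult power_mult_distrib by (simp only: ac_simps)
    also have "exp (real l * (- h * (\<kappa> * (1 - \<eta>)))) * exp (\<kappa> * real l * (1 - \<epsilon>))
        = exp (real l / B * (b * (1 - \<epsilon>) - (1 - exp (- b)) * (1 - \<eta>)))"
      unfolding exp_add[symmetric] \<kappa>_def h_def using b B by (intro arg_cong[where f = exp]) (simp add: field_simps)
    finally show ?thesis .
  qed
  ultimately show ?thesis using tot unfolding T_def by (simp add: algebra_simps)
qed

end

section \<open>Numerical exponents and the choice of constants\<close>

lemma exp_upper_exponent:
  fixes \<epsilon> :: real
  assumes "0 < \<epsilon>" "\<epsilon> < 1"
  shows "exp (\<epsilon> / 2) - 1 - \<epsilon> / 2 * (1 + \<epsilon>) \<le> - (\<epsilon>\<^sup>2 / 3.7)"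
proof -
  \<comment> \<open>At \<open>\<epsilon> / 2\<close> itself \<open>exp_bound\<close> would only give
    the exponent \<open>- \<epsilon>^2 / 4\<close>. Applied at half that argument and then squared,
    it is sharp enough for 3.7.\<close>
  define y where "y = \<epsilon> / 4"
  have y: "0 < y" "y < 1 / 4" "\<epsilon> = 4 * y" using assms by (simp_all add: y_def)
  have "exp (\<epsilon> / 2) = (exp y)\<^sup>2" by (simp add: y exp_double[symmetric])
  also have "\<dots> \<le> (1 + y + y\<^sup>2)\<^sup>2" using y by (intro power_mono exp_bound) auto
  also have "\<dots> = 1 + 2 * y + y\<^sup>2 * (3 + 2 * y + y\<^sup>2)" by (simp add: power2_eq_square algebra_simps)
  also have "\<dots> \<le> 1 + 2 * y + y\<^sup>2 * (3 + 2 * (1 / 4) + (1 / 4)\<^sup>2)"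
    using y by (intro add_left_mono mult_left_mono add_mono power_mono) auto
  finally have "exp (\<epsilon> / 2) - 1 - \<epsilon> / 2 * (1 + \<epsilon>) \<le> y\<^sup>2 * (57 / 16 - 8)"
    by (simp add: y(3) power2_eq_square algebra_simps)
  also have "\<dots> \<le> - (\<epsilon>\<^sup>2 / 3.7)"
    by (simp add: y(3) power2_eq_square)
  finally show ?thesis .
qed

lemma exp_lower_exponent:
  fixes \<epsilon> :: real
  assumes "0 < \<epsilon>" "\<epsilon> < 1"
  shows "\<epsilon> / 2 * (1 - \<epsilon>) - (1 - exp (- (\<epsilon> / 2))) * (1 - \<epsilon> / 100) \<le> - (\<epsilon>\<^sup>2 / 3.7)"
proof -
  define b where "b = \<epsilon> / 2"
  have b: "0 < b" "b < 1 / 2" "\<epsilon> = 2 * b" using assms by (simp_all add: b_def)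
  have "exp (- b) \<le> 1 - b + b\<^sup>2 / 2"
  proof -
    \<comment> \<open>The product equals \<open>1 + b ^ 4 / 4\<close>.\<close>
    have "1 \<le> (1 - b + b\<^sup>2 / 2) * (1 + b + b\<^sup>2 / 2)"
      using b by (simp add: power2_eq_square field_simps)
    also have "\<dots> \<le> (1 - b + b\<^sup>2 / 2) * exp b"
      using b exp_lower_Taylor_quadratic[of b] by (intro mult_left_mono) auto
    finally show ?thesis by (simp add: exp_minus field_simps)
  qed
  then have "b - b\<^sup>2 / 2 \<le> 1 - exp (- b)" by simp
  then have "(b - b\<^sup>2 / 2) * (1 - \<epsilon> / 100) \<le> (1 - exp (- b)) * (1 - \<epsilon> / 100)"
    using assms by (intro mult_right_mono) auto
  moreover have "b * (1 - \<epsilon>) - (b - b\<^sup>2 / 2) * (1 - \<epsilon> / 100) \<le> - (\<epsilon>\<^sup>2 / 3.7)"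
  proof -
    have "b * (1 - \<epsilon>) - (b - b\<^sup>2 / 2) * (1 - \<epsilon> / 100) = b\<^sup>2 * (1 / 2 - 2 + 1 / 50 - b / 100)"
      by (simp add: b(3) power2_eq_square field_simps)
    also have "\<dots> \<le> b\<^sup>2 * (- (4 / 3.7))" using b by (intro mult_left_mono) auto
    finally show ?thesis by (simp add: b(3) power2_eq_square)
  qed
  ultimately show ?thesis by (simp add: b_def)
qed

context srht_rows
begin

definition tuples :: "nat \<Rightarrow> (nat \<Rightarrow> nat \<times> (nat \<Rightarrow> real)) set" where
  "tuples l = PiE {..<l} (\<lambda>_. R)"

lemma finite_tuples: "finite (tuples l)"
  unfolding tuples_def by (intro finite_PiE finite_R) auto

lemma card_tuples: "real (card (tuples l)) = real (card R) ^ l"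
  by (simp add: tuples_def card_PiE)

text \<open>The few diagonals \<open>u\<close> with too many long rows are charged with all their
  tuples; the others fall under the bound for fixed \<open>u\<close>.\<close>

lemma card_distorted_total_le:
  assumes l: "0 < l" and t: "0 < t" and b: "0 < b" and \<epsilon>: "0 < \<epsilon>" "\<epsilon> < 1"
    and \<gamma>: "0 < \<gamma>" "\<gamma> \<le> 1"
    and \<eta>: "real d * real (p * r) * \<gamma> \<le> \<eta>"
  defines "B \<equiv> (sqrt (real d) + t)\<^sup>2"
  shows "real (card {(u, f) \<in> U \<times> tuples l. distorted l \<epsilon> u f})
    \<le> real (card (U \<times> tuples l)) * (exp (- t\<^sup>2 / 4) / \<gamma> + (real l * \<gamma>
        + real d * exp (real l / B * (exp b - 1 - b * (1 + \<epsilon>)))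
        + real d * exp (real l / B * (b * (1 - \<epsilon>) - (1 - exp (- b)) * (1 - \<eta>)))))"
    (is "_ \<le> _ * (_ + ?c)")
proof -
  have "0 < sqrt (real d) + t" using t real_sqrt_ge_zero[of "real d"] by linarith
  then have B: "0 < B" by (simp add: B_def)
  have c: "0 \<le> ?c" using \<gamma> by (intro add_nonneg_nonneg mult_nonneg_nonneg) auto
  define V where "V = {u \<in> U. \<gamma> * real (card R) < real (card (large B u))}"
  have V: "V \<subseteq> U" "finite V" using finite_U by (auto simp: V_def)
  have "{(u, f) \<in> U \<times> tuples l. distorted l \<epsilon> u f} = Sigma U (\<lambda>u. {f \<in> tuples l. distorted l \<epsilon> u f})"
    by auto
  then have "real (card {(u, f) \<in> U \<times> tuples l. distorted l \<epsilon> u f})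
      = (\<Sum>u\<in>U. real (card {f \<in> tuples l. distorted l \<epsilon> u f}))"
    using finite_U finite_tuples by (simp add: card_SigmaI)
  also have "\<dots> \<le> (\<Sum>u\<in>U. real (card (tuples l)) * ((if u \<in> V then 1 else 0) + ?c))"
  proof (intro sum_mono)
    fix u assume u: "u \<in> U"
    show "real (card {f \<in> tuples l. distorted l \<epsilon> u f}) \<le> real (card (tuples l)) * ((if u \<in> V then 1 else 0) + ?c)"
    proof (cases "u \<in> V")
      case True
      have "real (card {f \<in> tuples l. distorted l \<epsilon> u f}) \<le> real (card (tuples l)) * 1"
        using finite_tuples by (simp add: card_mono)
      also have "\<dots> \<le> real (card (tuples l)) * (1 + ?c)" using c by (intro mult_left_mono) auto
      finally show ?thesis using True by simp
    next
      case False
      then have "real (card (large B u)) \<le> \<gamma> * real (card R)" using u by (simp add: V_def)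
      then show ?thesis
        using False card_distorted_le[OF u l B b \<epsilon> _ \<gamma>(2) \<eta>] unfolding card_tuples
        by (simp add: tuples_def)
    qed
  qed
  also have "\<dots> = real (card (tuples l)) * (real (card V) + real (card U) * ?c)"
    using V finite_U by (simp add: sum_distrib_left[symmetric] sum.distrib sum.If_cases Int_absorb1)
  also have "\<dots> \<le> real (card (tuples l)) * (real (card U) * (exp (- t\<^sup>2 / 4) / \<gamma>) + real (card U) * ?c)"
    unfolding V_def B_def by (intro mult_left_mono add_right_mono card_many_large_le t \<gamma>) simp
  finally show ?thesis by (simp add: card_cartesian_product algebra_simps)
qed

lemma card_distorted_fraction_le:
  fixes \<epsilon> \<delta> :: real
  assumes \<epsilon>: "0 < \<epsilon>" "\<epsilon> < 1" and \<delta>: "0 < \<delta>" "\<delta> < 1" and d: "d \<ge> 1" and n: "n = p * r" "l \<le> n"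
    and l: "real l \<ge> 3.7 * (1 / \<epsilon>\<^sup>2) * (sqrt (real d) + 4 * sqrt (ln (real n / \<delta>) + 6.3))\<^sup>2
              * ln (5 * real d / \<delta>)"
  shows "real (card {(u, f) \<in> U \<times> tuples l. distorted l \<epsilon> u f}) \<le> \<delta> * real (card (U \<times> tuples l))"
proof -
  define L where "L = ln (real n / \<delta>) + 6.3"
  \<comment> \<open>Then \<open>t^2 / 4 = 4 * L\<close>, so a single row is long with probability at
    most \<open>exp (- 25.2) * (\<delta> / n) ^ 4\<close>, where 25.2 is 4 times 6.3.\<close>
  define t where "t = 4 * sqrt L"
  define B where "B = (sqrt (real d) + t)\<^sup>2"
  define \<Lambda> where "\<Lambda> = ln (5 * real d / \<delta>)"
  have n1: "1 \<le> real n" using p r n(1) by (simp add: Suc_le_eq flip: of_nat_mult)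
  have nd: "1 \<le> real n / \<delta>" using n1 \<delta> by (simp add: le_divide_eq)
  have L: "6.3 \<le> L" using ln_ge_zero[OF nd] by (simp add: L_def)
  have t: "0 < t" and t2: "t\<^sup>2 = 16 * L" using L by (simp_all add: t_def power_mult_distrib)
  have Bd: "real d + 100 \<le> B"
  proof -
    have "real d + t\<^sup>2 \<le> B" using t by (simp add: B_def power2_sum)
    then show ?thesis using L t2 by simp
  qed
  have "exp 1 \<le> 5 * real d / \<delta>"
  proof -
    have "exp 1 \<le> (3::real)" using exp_le by simp
    also have "3 \<le> 5 * real d" using d by simp
    also have "\<dots> \<le> 5 * real d / \<delta>" using \<delta> d by (simp add: le_divide_eq mult_left_le)
    finally show ?thesis .
  qed
  then have \<Lambda>1: "1 \<le> \<Lambda>" unfolding \<Lambda>_def using d \<delta> by (subst ln_ge_iff) auto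
  have m: "3.7 * \<Lambda> / \<epsilon>\<^sup>2 \<le> real l / B"
  proof -
    have "3.7 * (1 / \<epsilon>\<^sup>2) * B * \<Lambda> \<le> real l" using l unfolding B_def t_def L_def \<Lambda>_def .
    then show ?thesis using Bd by (simp add: field_simps)
  qed
  have eps1: "1 \<le> 1 / \<epsilon>\<^sup>2" "1 / \<epsilon> \<le> 1 / \<epsilon>\<^sup>2"
    using \<epsilon> mult_le_one[of \<epsilon> \<epsilon>] by (simp_all add: power2_eq_square field_simps)
  have lB: "3.7 / \<epsilon>\<^sup>2 * B \<le> real l"
  proof -
    have "3.7 / \<epsilon>\<^sup>2 * 1 \<le> 3.7 / \<epsilon>\<^sup>2 * \<Lambda>" using \<Lambda>1 by (intro mult_left_mono) auto
    then have "3.7 / \<epsilon>\<^sup>2 \<le> real l / B" using m by simp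
    then show ?thesis using Bd by (simp add: le_divide_eq)
  qed
  \<comment> \<open>The size of \<open>n\<close> is inherited from \<open>l\<close>: the hypotheses
    give \<open>n \<ge> l \<ge> 3.7 / \<epsilon>^2 * B\<close> with
    \<open>B \<ge> d + 100\<close>.\<close>
  have n_ge: "20 / \<epsilon> \<le> real n" and dn: "real d \<le> real n" and l0: "0 < l"
  proof -
    have "B * 1 \<le> B * (3.7 / \<epsilon>\<^sup>2)" using eps1 Bd by (intro mult_left_mono) auto
    then show "real d \<le> real n" "0 < l" using lB Bd n(2) by (auto simp: mult.commute)
    have "20 * (1 / \<epsilon>) \<le> (3.7 * 100) * (1 / \<epsilon>\<^sup>2)" using eps1 \<epsilon> by (intro mult_mono) auto
    also have "\<dots> \<le> 3.7 / \<epsilon>\<^sup>2 * B" using Bd \<epsilon> mult_left_mono[of 100 B "3.7 / \<epsilon>\<^sup>2"] by simp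
    also have "\<dots> \<le> real n" using lB n(2) by simp
    finally show "20 / \<epsilon> \<le> real n" by simp
  qed
  \<comment> \<open>One value for three estimates:
    \<open>l * \<gamma> \<le> n ^ 3 * \<gamma> = \<delta> / 5\<close> for hitting a long row;
    \<open>d * n * \<gamma> \<le> \<delta> / (5 * n) \<le> \<epsilon> / 100\<close> for the lost
    covariance, by \<open>n \<ge> 20 / \<epsilon>\<close>; and the row tail, a fourth power of
    \<open>\<delta> / n\<close>, can still be divided by it.\<close>
  define \<gamma> where "\<gamma> = \<delta> / (5 * real n ^ 3)"
  have \<gamma>: "0 < \<gamma>" "\<gamma> \<le> 1" 
  proof -
    have "1 \<le> real n ^ 3" using n1 by (rule one_le_power)
    then have "0 < 5 * real n ^ 3" "\<delta> \<le> 5 * real n ^ 3" using \<delta> by linarith+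
    then show "0 < \<gamma>" "\<gamma> \<le> 1"
      unfolding \<gamma>_def using \<delta>(1) by (simp_all only: divide_pos_pos divide_le_eq_1_pos)
  qed
  have \<eta>: "real d * real (p * r) * \<gamma> \<le> \<epsilon> / 100"
  proof -
    have "real d * real (p * r) * \<gamma> \<le> real n * real n * \<gamma>"
      using dn \<gamma> unfolding n(1)[symmetric] by (intro mult_right_mono) auto
    also have "\<dots> = \<delta> / (5 * real n)" using n1 by (simp add: \<gamma>_def power3_eq_cube)
    also have "\<dots> \<le> 1 / (5 * real n)" using \<delta> n1 by (intro divide_right_mono) auto
    also have "\<dots> \<le> \<epsilon> / 100" using n_ge \<epsilon> n1 by (simp add: field_simps)
    finally show ?thesis .
  qed
  have tail: "exp (- t\<^sup>2 / 4) / \<gamma> \<le> \<delta> / 5"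
  proof -
    have "exp (- t\<^sup>2 / 4) = exp (- (25.2 :: real)) * exp (- ln (real n / \<delta>)) ^ 4"
      by (simp add: t2 L_def exp_of_nat_mult[symmetric] exp_add[symmetric] field_simps)
    also have "exp (- ln (real n / \<delta>)) = \<delta> / real n"
      using nd \<delta> n1 by (simp add: exp_minus)
    finally have e: "exp (- t\<^sup>2 / 4) = exp (- (25.2 :: real)) * (\<delta> / real n) ^ 4" .
    have "25 \<le> exp (25.2 :: real)" using exp_ge_add_one_self[of "25.2"] by simp
    then have e25: "exp (- (25.2 :: real)) \<le> 1 / 25" by (simp add: exp_minus field_simps)
    have d4: "\<delta> ^ 4 \<le> \<delta> * \<delta>"
      using \<delta> power_decreasing[of 2 4 \<delta>] by (simp add: power2_eq_square)
    have "exp (- t\<^sup>2 / 4) \<le> 1 / 25 * (\<delta> / real n) ^ 4"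
      unfolding e using e25 \<delta> by (intro mult_right_mono) auto
    also have "\<dots> = 1 / 25 * \<delta> ^ 4 / real n ^ 4" by (simp add: power_divide)
    also have "\<dots> \<le> 1 / 25 * (\<delta> * \<delta>) / real n ^ 3"
      using d4 n1 \<delta> by (intro frac_le mult_left_mono power_increasing) auto
    also have "\<dots> = \<delta> / 5 * \<gamma>" by (simp add: \<gamma>_def)
    finally show ?thesis using \<gamma> by (simp add: divide_le_eq)
  qed
  have union: "real l * \<gamma> \<le> \<delta> / 5"
  proof -
    have "real l * \<gamma> \<le> real n ^ 3 * \<gamma>"
      using n(2) n1 \<gamma> self_le_power[of "real n" 3] by (intro mult_right_mono) auto
    then show ?thesis using n1 by (simp add: \<gamma>_def)
  qed
  have chernoff: "real d * exp (real l / B * x) \<le> \<delta> / 5" if "x \<le> - (\<epsilon>\<^sup>2 / 3.7)" for x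
  proof -
    have "real l / B * x \<le> real l / B * - (\<epsilon>\<^sup>2 / 3.7)" using that Bd by (intro mult_left_mono) auto
    also have "\<dots> \<le> 3.7 * \<Lambda> / \<epsilon>\<^sup>2 * - (\<epsilon>\<^sup>2 / 3.7)" using m by (intro mult_right_mono_neg) auto
    also have "\<dots> = - \<Lambda>" using \<epsilon> by simp
    finally have "real d * exp (real l / B * x) \<le> real d * exp (- \<Lambda>)" by (intro mult_left_mono) auto
    also have "\<dots> = \<delta> / 5" using d \<delta> by (simp add: \<Lambda>_def exp_minus)
    finally show ?thesis .
  qed
  \<comment> \<open>The common choice \<open>b = \<epsilon> / 2\<close> makes both exponents about
    \<open>- 3 * \<epsilon>^2 / 8\<close> for small \<epsilon> and at most
    \<open>- \<epsilon>^2 / 3.7\<close> throughout.\<close>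
  have "real (card {(u, f) \<in> U \<times> tuples l. distorted l \<epsilon> u f})
    \<le> real (card (U \<times> tuples l)) * (exp (- t\<^sup>2 / 4) / \<gamma> + (real l * \<gamma>
        + real d * exp (real l / B * (exp (\<epsilon> / 2) - 1 - \<epsilon> / 2 * (1 + \<epsilon>)))
        + real d * exp (real l / B * (\<epsilon> / 2 * (1 - \<epsilon>) - (1 - exp (- (\<epsilon> / 2))) * (1 - \<epsilon> / 100)))))"
    unfolding B_def using \<epsilon> by (intro card_distorted_total_le l0 t \<gamma> \<eta>) auto
  \<comment> \<open>Four sources of failure at \<open>\<delta> / 5\<close> each: too many long rows,
    a long row drawn, and the two Chernoff tails. The 5 inside
    \<open>ln (5 * real d / \<delta>)\<close> is chosen for the tails.\<close>
  also have "\<dots> \<le> real (card (U \<times> tuples l)) * (\<delta> / 5 + (\<delta> / 5 + \<delta> / 5 + \<delta> / 5))"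
    by (intro mult_left_mono add_mono tail union chernoff exp_upper_exponent exp_lower_exponent \<epsilon>) simp
  also have "\<dots> \<le> real (card (U \<times> tuples l)) * \<delta>" using \<delta> by (intro mult_left_mono) auto
  finally show ?thesis by (simp add: mult.commute)
qed

end

subsection \<open>Subspaces, matrices and events\<close>

text \<open>Independent subsets of \<open>V\<close> have at most \<open>n\<close> elements, so one
  of maximal cardinality exists, and it is a basis of \<open>V\<close> as a space in its own right.
  Span and independence relative to \<open>V\<close> agree with those of the ambient space.\<close>

lemma subspace_basis:
  assumes "V \<in> subspaces_of_dim n d"
  obtains A where "finite A" "card A = d" "A \<subseteq> carrier_vec n"
    "\<not> module.lin_dep class_ring (module_vec TYPE(real) n) A"
    "module.span class_ring (module_vec TYPE(real) n) A = V"
proof -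
  interpret vec_space "TYPE(real)" n .
  let ?W = "(module_vec TYPE(real) n)\<lparr>carrier := V\<rparr>"
  have sub: "VectorSpace.subspace class_ring V (module_vec TYPE(real) n)"
    and dim: "vectorspace.dim class_ring ?W = d"
    using assms by (auto simp: subspaces_of_dim_def)
  have subm: "submodule class_ring V (module_vec TYPE(real) n)"
    using sub by (simp add: subspace_def)
  have VC: "V \<subseteq> carrier_vec n"
    using submodule.subset[OF subm] by simp
  interpret W: vectorspace class_ring ?W
    by (rule subspace_is_vs[OF sub])
  let ?P = "\<lambda>A. A \<subseteq> V \<and> lin_indpt A"
  have bound: "finite A \<and> card A \<le> n" if "?P A" for A
  proof -
    have c: "A \<subseteq> carrier_vec n" using that VC by auto
    show ?thesis using li_le_dim[OF fin_dim c] that unfolding dim_is_n by simp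
  qed
  have "?P {}" unfolding lin_dep_def by blast
  then have "\<exists>A. ?P A \<and> (\<forall>B. ?P B \<longrightarrow> card B \<le> card A)"
    by (rule ex_has_greatest_nat[where b = "Suc n"]) (insert bound, simp add: less_Suc_eq_le)
  then obtain A where A_max: "?P A \<and> (\<forall>B. ?P B \<longrightarrow> card B \<le> card A)" by (elim exE)
  then have A: "?P A" by (rule conjunct1)
  have max: "card B \<le> card A" if "?P B" for B
    by (rule A_max[THEN conjunct2, THEN spec, THEN mp, OF that])
  have fA: "finite A" using bound A by blast
  have ld: "W.lin_dep S = lin_dep S" and sp: "W.span S = span S" if "S \<subseteq> V" for S
    using span_li_not_depend[OF that subm] by auto
  have "maximal A (\<lambda>S. S \<subseteq> carrier ?W \<and> W.lin_indpt S)"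
    unfolding maximal_def
  proof (intro conjI allI impI)
    show "A \<subseteq> carrier ?W" using A by simp
    show "W.lin_indpt A" using A ld by simp
    fix B assume B: "A \<subseteq> B \<and> B \<subseteq> carrier ?W \<and> W.lin_indpt B"
    then have "?P B" using ld[of B] by simp
    then have "card B \<le> card A" "finite B" using max bound by blast+
    with B show "B = A" using card_seteq[of B A] by blast
  qed
  then have b: "W.basis A" by (intro W.max_li_is_basis) auto
  have "card A = d" using W.dim_basis[OF fA b] dim by simp
  moreover have "span A = V" using b sp[of A] A by (simp add: W.basis_def)
  ultimately show thesis using that[of A] fA A VC by auto
qed

text \<open>Gram-Schmidt gives an orthogonal basis, which \<open>g\<close> normalizes. Coordinates
  are functions on all naturals of which only the first \<open>d\<close> values matter, so
  \<open>V\<close> is a plain range.\<close>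

lemma subspace_orthonormal_basis:
  assumes "V \<in> subspaces_of_dim n d"
  obtains q :: "nat \<Rightarrow> nat \<Rightarrow> real"
  where "\<And>c c'. c < d \<Longrightarrow> c' < d \<Longrightarrow> (\<Sum>t<n. q t c * q t c') = (if c = c' then 1 else 0)"
    and "V = range (\<lambda>x. Matrix.vec n (\<lambda>t. \<Sum>c<d. q t c * x c))"
proof -
  interpret cof_vec_space n "TYPE(real)" .
  obtain A where A: "finite A" "card A = d" "A \<subseteq> carrier_vec n" "lin_indpt A" "span A = V"
    using subspace_basis[OF assms] .
  obtain ws where ws: "set ws = A" "distinct ws" using finite_distinct_list[OF A(1)] by blast
  define us where "us = gram_schmidt n ws"
  note gs = gram_schmidt_result[OF _ ws(2) _ us_def, unfolded ws(1), OF A(3,4)]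
  have "length ws = d" using distinct_card[OF ws(2)] A(2) ws(1) by simp
  then have us: "span (set us) = V" "corthogonal us" "set us \<subseteq> carrier_vec n" "length us = d" "distinct us"
    using gs(1) gs(2,3,5) gs(4) unfolding A(5) by blast+
  define g where "g c = sqrt (\<Sum>t<n. (us ! c $ t)\<^sup>2)" for c
  have sp: "us ! c \<bullet>c us ! c' = (\<Sum>t<n. us ! c $ t * us ! c' $ t)" if "c' < d" for c c'
  proof -
    have "us ! c' \<in> carrier_vec n" using us that by auto
    then show ?thesis by (simp add: scalar_prod_def lessThan_atLeast0)
  qed
  have g: "g c \<noteq> 0" "(g c)\<^sup>2 = (\<Sum>t<n. us ! c $ t * us ! c $ t)" if "c < d" for c
  proof -
    have "(\<Sum>t<n. us ! c $ t * us ! c $ t) \<noteq> 0"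
      using corthogonalD[OF us(2), of c c] that us(4) sp[OF that] by simp
    then show "g c \<noteq> 0" by (simp add: g_def power2_eq_square)
    show "(g c)\<^sup>2 = (\<Sum>t<n. us ! c $ t * us ! c $ t)"
      unfolding g_def by (subst real_sqrt_pow2) (auto intro!: sum_nonneg simp: power2_eq_square)
  qed
  define q where "q t c = us ! c $ t / g c" for t c
  have orth: "(\<Sum>t<n. q t c * q t c') = (if c = c' then 1 else 0)" if "c < d" "c' < d" for c c'
  proof -
    have "(\<Sum>t<n. q t c * q t c') = (\<Sum>t<n. us ! c $ t * us ! c' $ t) / (g c * g c')"
      by (simp add: q_def sum_divide_distrib)
    moreover have "c \<noteq> c' \<Longrightarrow> (\<Sum>t<n. us ! c $ t * us ! c' $ t) = 0"
      using corthogonalD[OF us(2), of c c'] that us(4) sp[of c' c] by simp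
    ultimately show ?thesis using g[OF that(1)] by (auto simp: power2_eq_square)
  qed
  have bij: "bij_betw (\<lambda>c. us ! c) {..<d} (set us)"
    using us by (simp add: bij_betw_nth)
  have lc: "lincomb a (set us) = Matrix.vec n (\<lambda>t. \<Sum>c<d. a (us ! c) * us ! c $ t)" for a
  proof (rule eq_vecI)
    show "dim_vec (lincomb a (set us)) = dim_vec (Matrix.vec n (\<lambda>t. \<Sum>c<d. a (us ! c) * us ! c $ t))"
      using us(3) by (simp add: lincomb_dim)
    fix t assume "t < dim_vec (Matrix.vec n (\<lambda>t. \<Sum>c<d. a (us ! c) * us ! c $ t))"
    then have t: "t < n" by simp
    show "lincomb a (set us) $ t = Matrix.vec n (\<lambda>t. \<Sum>c<d. a (us ! c) * us ! c $ t) $ t"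
      using t lincomb_index[OF t us(3), of a]
        sum.reindex_bij_betw[OF bij, of "\<lambda>x. a x * x $ t"] by simp
  qed
  have V: "V = {lincomb a (set us) | a. a \<in> set us \<rightarrow> UNIV}"
    using finite_span[OF _ us(3)] unfolding us(1) by simp
  have "V = range (\<lambda>x. Matrix.vec n (\<lambda>t. \<Sum>c<d. q t c * x c))"
  proof (intro equalityI subsetI)
    fix x assume "x \<in> V"
    then obtain a where x: "x = lincomb a (set us)" unfolding V by blast
    have "x = Matrix.vec n (\<lambda>t. \<Sum>c<d. q t c * (a (us ! c) * g c))"
      unfolding x lc using g by (intro eq_vecI) (auto simp: q_def intro!: sum.cong)
    then show "x \<in> range (\<lambda>x. Matrix.vec n (\<lambda>t. \<Sum>c<d. q t c * x c))"
      by (intro image_eqI[where x = "\<lambda>c. a (us ! c) * g c"]) auto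
  next
    fix x assume "x \<in> range (\<lambda>x. Matrix.vec n (\<lambda>t. \<Sum>c<d. q t c * x c))"
    then obtain y where x: "x = Matrix.vec n (\<lambda>t. \<Sum>c<d. q t c * y c)" by blast
    \<comment> \<open>\<open>lincomb\<close> expects coefficients indexed by vectors; since
      \<open>us\<close> is distinct, the position of a vector can be recovered from the
      vector.\<close>
    define a where "a v = y (the_inv_into {..<d} (\<lambda>c. us ! c) v) / g (the_inv_into {..<d} (\<lambda>c. us ! c) v)" for v
    have "a (us ! c) = y c / g c" if "c < d" for c
      using that bij by (simp add: a_def the_inv_into_f_f bij_betw_def)
    then have "x = lincomb a (set us)"
      unfolding x lc by (intro eq_vecI) (auto simp: q_def intro!: sum.cong)
    then show "x \<in> V" unfolding V by blast
  qed
  with orth show thesis by (rule that)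
qed

section \<open>Block indices and Walsh-Hadamard entries\<close>

lemma sum_lessThan_mult: "(\<Sum>t<p * r. f t) = (\<Sum>i<p. \<Sum>j<r. f (i * r + j :: nat))"
proof (induction p)
  case (Suc p)
  have "{..<Suc p * r} = {..<p * r} \<union> {p * r..<p * r + r}" by auto
  then have "(\<Sum>t<Suc p * r. f t) = (\<Sum>t<p * r. f t) + (\<Sum>t\<in>{p * r..<p * r + r}. f t)"
    by (simp add: sum.union_disjoint ivl_disj_int)
  also have "(\<Sum>t\<in>{p * r..<p * r + r}. f t) = (\<Sum>j<r. f (p * r + j))"
    by (simp add: sum.atLeastLessThan_shift_0[of f "p * r"] atLeast0LessThan comp_def)
  finally show ?case using Suc by simp
qed simp

lemma div_mod_mult_add:
  fixes j r :: nat
  assumes "j < r" shows "(i * r + j) div r = i" "(i * r + j) mod r = j"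
  using assms by simp_all

lemma mult_add_less: "i < p \<Longrightarrow> j < r \<Longrightarrow> i * r + j < p * (r::nat)"
proof -
  assume "i < p" "j < r"
  then have "i * r + j < Suc i * r" by simp
  also have "\<dots> \<le> p * r" using \<open>i < p\<close> by (intro mult_le_mono1) simp
  finally show ?thesis .
qed

lemma hadamard_unscaled_carrier: "hadamard_unscaled k \<in> carrier_mat (2 ^ k) (2 ^ k)"
  by (induction k) (auto simp: kronecker_product_def mat_of_rows_list_def)

definition hadamard_entry :: "nat \<Rightarrow> nat \<Rightarrow> nat \<Rightarrow> real" where
  "hadamard_entry k s j = hadamard_unscaled k $$ (s, j)"

lemma hadamard_entry_0: "hadamard_entry 0 0 0 = 1"
  by (simp add: hadamard_entry_def)

lemma hadamard_entry_Suc: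
  assumes "a < 2" "b < 2" "s < 2 ^ k" "j < 2 ^ k"
  shows "hadamard_entry (Suc k) (a * 2 ^ k + s) (b * 2 ^ k + j) = (if a = 1 \<and> b = 1 then - 1 else 1) * hadamard_entry k s j"
proof -
  have c: "dim_row (hadamard_unscaled k) = 2 ^ k" "dim_col (hadamard_unscaled k) = 2 ^ k"
    using hadamard_unscaled_carrier[of k] by auto
  have lt: "a * 2 ^ k + s < 2 * 2 ^ k" "b * 2 ^ k + j < 2 * 2 ^ k"
    using assms by (intro mult_add_less; simp)+
  have ab: "a = 0 \<or> a = 1" "b = 0 \<or> b = 1" using assms by auto
  have "hadamard_entry (Suc k) (a * 2 ^ k + s) (b * 2 ^ k + j)
      = mat_of_rows_list 2 [[1, 1], [1, - 1]] $$ (a, b) * hadamard_entry k s j"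
    using lt assms div_mod_mult_add[of s "2 ^ k" a] div_mod_mult_add[of j "2 ^ k" b]
    by (simp add: hadamard_entry_def kronecker_product_def c mat_of_rows_list_def)
  also have "mat_of_rows_list 2 [[1, 1], [1, - 1]] $$ (a, b) = (if a = 1 \<and> b = 1 then - 1 else (1::real))"
    using ab by (auto simp: mat_of_rows_list_def)
  finally show ?thesis .
qed

lemma nat_split_block:
  assumes "s < 2 * 2 ^ k"
  obtains a s' where "s = a * 2 ^ k + s'" "a < 2" "s' < (2::nat) ^ k"
proof
  show "s = s div 2 ^ k * 2 ^ k + s mod 2 ^ k" by (rule div_mult_mod_eq[symmetric])
  show "s div 2 ^ k < 2" using assms by (simp add: less_mult_imp_div_less)
qed simp

lemma hadamard_entry_sign: "s < 2 ^ k \<Longrightarrow> j < 2 ^ k \<Longrightarrow> hadamard_entry k s j \<in> {-1, 1}"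
proof (induction k arbitrary: s j)
  case (Suc k)
  obtain a s' where s: "s = a * 2 ^ k + s'" "a < 2" "s' < 2 ^ k"
    by (rule nat_split_block[of s k]) (use Suc.prems(1) in auto)
  obtain b j' where j: "j = b * 2 ^ k + j'" "b < 2" "j' < 2 ^ k"
    by (rule nat_split_block[of j k]) (use Suc.prems(2) in auto)
  show ?case using Suc.IH[OF s(3) j(3)] unfolding s(1) j(1) hadamard_entry_Suc[OF s(2) j(2) s(3) j(3)] by auto
qed (simp add: hadamard_entry_0)

text \<open>Splitting off the leading binary digit of the summation index factors the sum into the 2
  by 2 case and the induction hypothesis.\<close>

lemma hadamard_entry_orthogonal:
  "j < 2 ^ k \<Longrightarrow> j' < 2 ^ k \<Longrightarrow> (\<Sum>s<2 ^ k. hadamard_entry k s j * hadamard_entry k s j') = (if j = j' then real (2 ^ k) else 0)"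
proof (induction k arbitrary: j j')
  case (Suc k)
  obtain b i where j: "j = b * 2 ^ k + i" "b < 2" "i < 2 ^ k"
    by (rule nat_split_block[of j k]) (use Suc.prems(1) in auto)
  obtain b' i' where j': "j' = b' * 2 ^ k + i'" "b' < 2" "i' < 2 ^ k"
    by (rule nat_split_block[of j' k]) (use Suc.prems(2) in auto)
  define e where "e a b = (if a = 1 \<and> b = 1 then - 1 else (1::real))" for a b :: nat
  have "(\<Sum>s<2 ^ Suc k. hadamard_entry (Suc k) s j * hadamard_entry (Suc k) s j')
      = (\<Sum>a<2. \<Sum>s<2 ^ k. hadamard_entry (Suc k) (a * 2 ^ k + s) j * hadamard_entry (Suc k) (a * 2 ^ k + s) j')"
    using sum_lessThan_mult[of "\<lambda>s. hadamard_entry (Suc k) s j * hadamard_entry (Suc k) s j'" 2 "2 ^ k"] by simp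
  also have "\<dots> = (\<Sum>a<2. \<Sum>s<2 ^ k. (e a b * e a b') * (hadamard_entry k s i * hadamard_entry k s i'))"
    unfolding j(1) j'(1) e_def
    by (intro sum.cong refl) (simp add: hadamard_entry_Suc[OF _ j(2) _ j(3)] hadamard_entry_Suc[OF _ j'(2) _ j'(3)])
  also have "\<dots> = (\<Sum>a<2. e a b * e a b') * (if i = i' then real (2 ^ k) else 0)"
    by (simp only: sum_distrib_left[symmetric] sum_distrib_right[symmetric] Suc.IH[OF j(3) j'(3)])
  also have "(\<Sum>a<2. e a b * e a b') = (if b = b' then 2 else 0)"
    using j(2) j'(2) by (auto simp: e_def numeral_2_eq_2 less_Suc_eq)
  finally have "(\<Sum>s<2 ^ Suc k. hadamard_entry (Suc k) s j * hadamard_entry (Suc k) s j')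
      = (if b = b' \<and> i = i' then real (2 ^ Suc k) else 0)" by simp
  moreover have "j = j' \<longleftrightarrow> b = b' \<and> i = i'"
    using div_mod_mult_add[OF j(3), of b] div_mod_mult_add[OF j'(3), of b'] j(1) j'(1) by metis
  ultimately show ?case by simp
qed (simp add: hadamard_entry_0)

text \<open>The scalings \<open>sqrt (r / l)\<close> and \<open>1 / sqrt r\<close> combine to
  \<open>1 / sqrt l\<close>. An index out of range gives a zero row of the sampling matrix; this
  case is kept because a random index is in range only almost surely.\<close>

lemma srht_block_entry:
  assumes "a < l" "j < 2 ^ k"
  shows "srht_block k l s u v $$ (a, j)
    = 1 / sqrt (real l) * (v a * (if s a < 2 ^ k then hadamard_entry k (s a) j else 0) * u j)"
proof -
  let ?r = "2 ^ k :: nat"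
  let ?W = "walsh_hadamard k"
  let ?S = "sampling_matrix l ?r s"
  have W: "?W \<in> carrier_mat ?r ?r"
    using hadamard_unscaled_carrier[of k] by (simp add: walsh_hadamard_def)
  have S: "?S \<in> carrier_mat l ?r" by (simp add: sampling_matrix_def)
  have DS: "mat_diag l v * ?S = Matrix.mat l ?r (\<lambda>(i, j). v i * ?S $$ (i, j))"
    by (rule mat_diag_mult_left[OF S])
  have DSW: "mat_diag l v * ?S * ?W \<in> carrier_mat l ?r" unfolding DS by (rule mult_carrier_mat[OF _ W]) simp
  have "(mat_diag l v * ?S * ?W * mat_diag ?r u) $$ (a, j) = (mat_diag l v * ?S * ?W) $$ (a, j) * u j"
    using assms by (simp add: mat_diag_mult_right[OF DSW])
  also have "(mat_diag l v * ?S * ?W) $$ (a, j) = (\<Sum>t<?r. v a * ?S $$ (a, t) * ?W $$ (t, j))"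
    unfolding DS using W assms by (simp add: scalar_prod_def lessThan_atLeast0)
  also have "\<dots> = (\<Sum>t<?r. if t = s a then v a * ?W $$ (t, j) else 0)"
    using assms by (intro sum.cong) (auto simp: sampling_matrix_def)
  also have "\<dots> = (if s a < ?r then v a * ?W $$ (s a, j) else 0)" by simp
  also have "\<dots> = (if s a < ?r then v a * (1 / sqrt (real ?r) * hadamard_entry k (s a) j) else 0)"
    using assms hadamard_unscaled_carrier[of k] by (simp add: walsh_hadamard_def hadamard_entry_def)
  finally have e: "(mat_diag l v * ?S * ?W * mat_diag ?r u) $$ (a, j)
      = 1 / sqrt (real ?r) * (v a * (if s a < ?r then hadamard_entry k (s a) j else 0) * u j)" by simp
  have "srht_block k l s u v $$ (a, j)
      = sqrt (real ?r / real l) * (mat_diag l v * ?S * ?W * mat_diag ?r u) $$ (a, j)"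
    unfolding srht_block_def using assms DSW by (subst index_smult_mat) (auto simp: mat_diag_def)
  also have "\<dots> = (sqrt (real ?r / real l) * (1 / sqrt (real ?r))) * (v a * (if s a < ?r then hadamard_entry k (s a) j else 0) * u j)"
    unfolding e by (simp only: mult.assoc)
  also have "sqrt (real ?r / real l) * (1 / sqrt (real ?r)) = 1 / sqrt (real l)"
    by (simp add: real_sqrt_divide)
  finally show ?thesis .
qed

lemma block_srht_matrix_entry:
  assumes "a < l" "i < p" "j < 2 ^ k"
  shows "block_srht_matrix p k l s u v $$ (a, i * 2 ^ k + j)
    = 1 / sqrt (real l) * (v i a * (if s a < 2 ^ k then hadamard_entry k (s a) j else 0) * u i j)"
  using assms mult_add_less[OF assms(2,3)] div_mod_mult_add[OF assms(3), of i]
  by (simp add: block_srht_matrix_def srht_block_entry)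

lemma norm2_vec_square: "(norm2_vec x)\<^sup>2 = (\<Sum>i<dim_vec x. (x $ i)\<^sup>2)"
  by (simp add: norm2_vec_def L2_set_def sum_nonneg)

lemma norm2_vec_orthonormal:
  fixes q :: "nat \<Rightarrow> nat \<Rightarrow> real" and x :: "nat \<Rightarrow> real"
  assumes orth: "\<And>c c'. c < d \<Longrightarrow> c' < d \<Longrightarrow> (\<Sum>t<n. q t c * q t c') = (if c = c' then 1 else 0)"
  shows "(norm2_vec (Matrix.vec n (\<lambda>t. \<Sum>c<d. q t c * x c)))\<^sup>2 = ip d x x"
proof -
  have "(norm2_vec (Matrix.vec n (\<lambda>t. \<Sum>c<d. q t c * x c)))\<^sup>2
      = (\<Sum>t<n. \<Sum>c<d. \<Sum>c'<d. x c * x c' * (q t c * q t c'))"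
    unfolding norm2_vec_square by (simp add: power2_eq_square sum_product ac_simps)
  also have "\<dots> = (\<Sum>c<d. \<Sum>c'<d. x c * x c' * (\<Sum>t<n. q t c * q t c'))"
    by (simp add: sum_distrib_left sum.swap[of _ "{..<n}"])
  also have "\<dots> = ip d x x"
    unfolding ip_def by (intro sum.cong) (auto simp: orth if_distrib cong: if_cong)
  finally show ?thesis .
qed

lemma norm2_vec_mult:
  fixes q :: "nat \<Rightarrow> nat \<Rightarrow> real" and x :: "nat \<Rightarrow> real"
  assumes "A \<in> carrier_mat l n"
  shows "(norm2_vec (A *\<^sub>v Matrix.vec n (\<lambda>t. \<Sum>c<d. q t c * x c)))\<^sup>2
    = (\<Sum>a<l. (ip d (\<lambda>c. \<Sum>t<n. A $$ (a, t) * q t c) x)\<^sup>2)"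
proof -
  have "(A *\<^sub>v Matrix.vec n (\<lambda>t. \<Sum>c<d. q t c * x c)) $ a = ip d (\<lambda>c. \<Sum>t<n. A $$ (a, t) * q t c) x"
    if "a < l" for a
  proof -
    have "(A *\<^sub>v Matrix.vec n (\<lambda>t. \<Sum>c<d. q t c * x c)) $ a = (\<Sum>t<n. A $$ (a, t) * (\<Sum>c<d. q t c * x c))"
      using assms that by (simp add: scalar_prod_def lessThan_atLeast0)
    also have "\<dots> = ip d (\<lambda>c. \<Sum>t<n. A $$ (a, t) * q t c) x"
      by (simp add: ip_def sum_distrib_left sum_distrib_right sum.swap[of _ "{..<n}"] mult.assoc)
    finally show ?thesis .
  qed
  then show ?thesis using assms by (simp add: norm2_vec_square)
qed

section \<open>Measurability of the embedding event and probabilities of outcomes\<close>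

lemma real_rational_approx:
  fixes x :: real
  obtains f :: "nat \<Rightarrow> real" where "\<And>m. f m \<in> \<rat>" "f \<longlonglongrightarrow> x"
proof -
  have "\<exists>y\<in>\<rat>. x < y \<and> y < x + 1 / real (Suc m)" for m
    by (rule Rats_dense_in_real) simp
  then obtain f where f: "\<And>m. f m \<in> \<rat>" "\<And>m. x < f m" "\<And>m. f m < x + 1 / real (Suc m)"
    by metis
  have "f \<longlonglongrightarrow> x"
  proof (rule tendsto_sandwich)
    show "\<forall>\<^sub>F m in sequentially. x \<le> f m" "\<forall>\<^sub>F m in sequentially. f m \<le> x + 1 / real (Suc m)"
      using f(2,3) by (auto intro: always_eventually less_imp_le)
    show "(\<lambda>m. x) \<longlonglongrightarrow> x" by simp
    show "(\<lambda>m. x + 1 / real (Suc m)) \<longlonglongrightarrow> x"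
      using LIMSEQ_inverse_real_of_nat_add[of x] by (simp add: inverse_eq_divide)
  qed
  with f(1) show thesis by (rule that)
qed

text \<open>The event is an uncountable intersection over \<open>x\<close>. Both sides are
  continuous in the first \<open>d\<close> coordinates, so rational coordinates suffice, and
  extensionality makes the set \<open>D\<close> of test vectors countable.\<close>

lemma sets_embedding_event:
  fixes w :: "'w \<Rightarrow> nat \<Rightarrow> nat \<Rightarrow> real"
  assumes w: "\<And>a c. a < l \<Longrightarrow> c < d \<Longrightarrow> (\<lambda>\<omega>. w \<omega> a c) \<in> borel_measurable M"
  shows "{\<omega> \<in> space M. \<forall>x. \<bar>ip d x x - (\<Sum>a<l. (ip d (w \<omega> a) x)\<^sup>2)\<bar> \<le> \<epsilon> * ip d x x} \<in> sets M"
proof -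
  let ?P = "\<lambda>\<omega> x. \<bar>ip d x x - (\<Sum>a<l. (ip d (w \<omega> a) x)\<^sup>2)\<bar> \<le> \<epsilon> * ip d x x"
  define D where "D = PiE {..<d} (\<lambda>_. \<rat> :: real set)"
  have D: "countable D" unfolding D_def by (intro countable_PiE countable_rat) auto
  have dense: "(\<forall>x. ?P \<omega> x) \<longleftrightarrow> (\<forall>x\<in>D. ?P \<omega> x)" for \<omega>
  proof (intro iffI allI)
    fix x :: "nat \<Rightarrow> real" assume H: "\<forall>x\<in>D. ?P \<omega> x"
    have "\<exists>f. (\<forall>m. f m \<in> \<rat>) \<and> f \<longlonglongrightarrow> x c" for c
      using real_rational_approx[of "x c"] by metis
    then obtain f where f: "\<And>c m. f c m \<in> \<rat>" "\<And>c. f c \<longlonglongrightarrow> x c" by metis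
    define y where "y m = restrict (\<lambda>c. f c m) {..<d}" for m
    have yD: "y m \<in> D" for m unfolding y_def D_def using f(1) by simp
    have lim: "(\<lambda>m. y m c) \<longlonglongrightarrow> x c" if "c < d" for c
      using f(2)[of c] that by (simp add: y_def)
    have l1: "(\<lambda>m. ip d v (y m)) \<longlonglongrightarrow> ip d v x" for v
      unfolding ip_def by (intro tendsto_intros lim) auto
    have l2: "(\<lambda>m. ip d (y m) (y m)) \<longlonglongrightarrow> ip d x x"
      unfolding ip_def by (intro tendsto_intros lim) auto
    show "?P \<omega> x"
    proof (rule LIMSEQ_le)
      show "(\<lambda>m. \<bar>ip d (y m) (y m) - (\<Sum>a<l. (ip d (w \<omega> a) (y m))\<^sup>2)\<bar>)
          \<longlonglongrightarrow> \<bar>ip d x x - (\<Sum>a<l. (ip d (w \<omega> a) x)\<^sup>2)\<bar>"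
        by (intro tendsto_intros l1 l2)
      show "(\<lambda>m. \<epsilon> * ip d (y m) (y m)) \<longlonglongrightarrow> \<epsilon> * ip d x x"
        by (intro tendsto_intros l2)
      show "\<exists>N. \<forall>m\<ge>N. \<bar>ip d (y m) (y m) - (\<Sum>a<l. (ip d (w \<omega> a) (y m))\<^sup>2)\<bar> \<le> \<epsilon> * ip d (y m) (y m)"
        using H yD by blast
    qed
  qed blast
  have m1: "(\<lambda>\<omega>. ip d (w \<omega> a) x) \<in> borel_measurable M" if "a < l" for a x
    unfolding ip_def by (intro borel_measurable_sum borel_measurable_times w that borel_measurable_const) auto
  have m2: "(\<lambda>\<omega>. \<Sum>a<l. (ip d (w \<omega> a) x)\<^sup>2) \<in> borel_measurable M" for x
    by (intro borel_measurable_sum borel_measurable_power m1) auto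
  have "{\<omega> \<in> space M. ?P \<omega> x} \<in> sets M" for x
    using m2[of x] by measurable
  then have "{\<omega> \<in> space M. \<forall>x\<in>D. ?P \<omega> x} \<in> sets M"
    by (rule sets.sets_Collect_countable_All'[OF _ D])
  then show ?thesis by (simp only: dense)
qed

text \<open>All admissible outcomes are equally likely, each with the reciprocal of their number as
  its probability; this turns probabilities into counts.\<close>

lemma (in prob_space) srht_outcome:
  fixes S :: "nat \<Rightarrow> 'a \<Rightarrow> nat" and D D' :: "nat \<Rightarrow> nat \<Rightarrow> 'a \<Rightarrow> real" and s :: "nat \<Rightarrow> nat"
    and u v :: "nat \<Rightarrow> nat \<Rightarrow> real"
  assumes S: "\<And>a. a < l \<Longrightarrow> uniform_index M r (S a)"
    and D: "\<And>i j. i < p \<Longrightarrow> j < r \<Longrightarrow> rademacher M (D i j)"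
    and D': "\<And>i a. i < p \<Longrightarrow> a < l \<Longrightarrow> rademacher M (D' i a)"
    and indep: "indep_vars (\<lambda>_. borel)
          (\<lambda>c. case c of Sampled a \<Rightarrow> (\<lambda>\<omega>. real (S a \<omega>)) | Diag i j \<Rightarrow> D i j | DiagTilde i a \<Rightarrow> D' i a)
          (srht_sources p r l)"
    and p: "0 < p" and r: "0 < r"
    and s: "\<And>a. a < l \<Longrightarrow> s a < r"
    and u: "\<And>i j. i < p \<Longrightarrow> j < r \<Longrightarrow> u i j \<in> {-1, 1}"
    and v: "\<And>i a. i < p \<Longrightarrow> a < l \<Longrightarrow> v i a \<in> {-1, 1}"
  defines "G \<equiv> {\<omega> \<in> space M. (\<forall>a<l. S a \<omega> = s a) \<and> (\<forall>i<p. \<forall>j<r. D i j \<omega> = u i j)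
      \<and> (\<forall>i<p. \<forall>a<l. D' i a \<omega> = v i a)}"
  shows "G \<in> events" and "prob G = 1 / (2 ^ (p * r) * (real r * 2 ^ p) ^ l)"
proof -
  define X where "X c = (case c of Sampled a \<Rightarrow> (\<lambda>\<omega>. real (S a \<omega>)) | Diag i j \<Rightarrow> D i j | DiagTilde i a \<Rightarrow> D' i a)" for c
  define x where "x c = (case c of Sampled a \<Rightarrow> real (s a) | Diag i j \<Rightarrow> u i j | DiagTilde i a \<Rightarrow> v i a)" for c
  define A where "A = Sampled ` {..<l}"
  define B where "B = (\<lambda>ij. Diag (fst ij) (snd ij)) ` ({..<p} \<times> {..<r})"
  define C where "C = (\<lambda>ia. DiagTilde (fst ia) (snd ia)) ` ({..<p} \<times> {..<l})"
  have I: "srht_sources p r l = A \<union> B \<union> C"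
    unfolding srht_sources_def A_def B_def C_def by force
  have fin: "finite A" "finite B" "finite C" by (simp_all add: A_def B_def C_def)
  have disj: "A \<inter> B = {}" "(A \<union> B) \<inter> C = {}" by (auto simp: A_def B_def C_def)
  \<comment> \<open>The product rule for independent variables needs a nonempty index set, and this
    index is available even for \<open>l = 0\<close>.\<close>
  have "Diag 0 0 \<in> B" unfolding B_def using p r by force
  then have ne: "A \<union> B \<union> C \<noteq> {}" by blast
  have indep': "indep_vars (\<lambda>_. borel) X (A \<union> B \<union> C)"
    using indep unfolding I X_def .
  have G: "G = (\<Inter>c\<in>A \<union> B \<union> C. X c -` {x c} \<inter> space M)"
  proof -
    have "(\<Inter>c\<in>A \<union> B \<union> C. X c -` {x c} \<inter> space M) = {\<omega> \<in> space M. \<forall>c\<in>A \<union> B \<union> C. X c \<omega> = x c}"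
      using ne by auto
    also have "\<dots> = G"
    proof -
      have "(\<forall>c\<in>A. X c \<omega> = x c) \<longleftrightarrow> (\<forall>a<l. S a \<omega> = s a)" for \<omega>
        by (auto simp: A_def X_def x_def)
      moreover have "(\<forall>c\<in>B. X c \<omega> = x c) \<longleftrightarrow> (\<forall>i<p. \<forall>j<r. D i j \<omega> = u i j)" for \<omega>
        by (force simp: B_def X_def x_def)
      moreover have "(\<forall>c\<in>C. X c \<omega> = x c) \<longleftrightarrow> (\<forall>i<p. \<forall>a<l. D' i a \<omega> = v i a)" for \<omega>
        by (force simp: C_def X_def x_def)
      ultimately show ?thesis unfolding G_def by (simp only: ball_Un conj_assoc)
    qed
    finally show ?thesis ..
  qed
  have rad: "prob (Y -` {e} \<inter> space M) = 1 / 2" if "rademacher M Y" "e \<in> {-1, 1}" for Y and e :: real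
  proof -
    have "Y -` {e} \<inter> space M = {\<omega> \<in> space M. Y \<omega> = e}" by auto
    then show ?thesis using that by (auto simp: rademacher_def)
  qed
  have unif: "prob (X (Sampled a) -` {x (Sampled a)} \<inter> space M) = 1 / real r" if "a < l" for a
  proof -
    have "X (Sampled a) -` {x (Sampled a)} \<inter> space M = {\<omega> \<in> space M. S a \<omega> = s a}"
      by (auto simp: X_def x_def)
    then show ?thesis using S[OF that] s[OF that] by (simp add: uniform_index_def)
  qed
  show "G \<in> events"
    unfolding G
  proof (rule sets.finite_INT)
    show "X c -` {x c} \<inter> space M \<in> events" if "c \<in> A \<union> B \<union> C" for c
      using indep' that by (intro measurable_sets[where A = borel]) (auto simp: indep_vars_def)
  qed (use fin ne in auto)
  have "prob G = (\<Prod>c\<in>A \<union> B \<union> C. prob (X c -` {x c} \<inter> space M))"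
    unfolding G by (rule indep_varsD_finite[OF indep' ne]) (use fin in auto)
  also have "\<dots> = (\<Prod>c\<in>A. prob (X c -` {x c} \<inter> space M)) * (\<Prod>c\<in>B. prob (X c -` {x c} \<inter> space M))
      * (\<Prod>c\<in>C. prob (X c -` {x c} \<inter> space M))"
    by (simp add: prod.union_disjoint fin disj)
  also have "(\<Prod>c\<in>A. prob (X c -` {x c} \<inter> space M)) = (1 / real r) ^ l"
    unfolding A_def by (subst prod.reindex) (auto simp: inj_on_def unif)
  also have "(\<Prod>c\<in>B. prob (X c -` {x c} \<inter> space M)) = (\<Prod>ij\<in>{..<p} \<times> {..<r}. 1 / 2)"
    unfolding B_def
  proof (subst prod.reindex)
    show "inj_on (\<lambda>ij. Diag (fst ij) (snd ij)) ({..<p} \<times> {..<r})" by (auto simp: inj_on_def)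
    show "prod ((\<lambda>c. prob (X c -` {x c} \<inter> space M)) \<circ> (\<lambda>ij. Diag (fst ij) (snd ij))) ({..<p} \<times> {..<r})
        = (\<Prod>ij\<in>{..<p} \<times> {..<r}. 1 / 2)"
      by (intro prod.cong refl) (auto simp: X_def x_def rad[OF D u])
  qed
  also have "(\<Prod>c\<in>C. prob (X c -` {x c} \<inter> space M)) = (\<Prod>ia\<in>{..<p} \<times> {..<l}. 1 / 2)"
    unfolding C_def
  proof (subst prod.reindex)
    show "inj_on (\<lambda>ia. DiagTilde (fst ia) (snd ia)) ({..<p} \<times> {..<l})" by (auto simp: inj_on_def)
    show "prod ((\<lambda>c. prob (X c -` {x c} \<inter> space M)) \<circ> (\<lambda>ia. DiagTilde (fst ia) (snd ia))) ({..<p} \<times> {..<l})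
        = (\<Prod>ia\<in>{..<p} \<times> {..<l}. 1 / 2)"
      by (intro prod.cong refl) (auto simp: X_def x_def rad[OF D' v])
  qed
  finally show "prob G = 1 / (2 ^ (p * r) * (real r * 2 ^ p) ^ l)"
    by (simp add: card_cartesian_product power_mult_distrib power_divide power_mult)
qed

lemma block_srht_matrix_carrier: "block_srht_matrix p k l s u v \<in> carrier_mat l (p * 2 ^ k)"
  by (simp add: block_srht_matrix_def)

section \<open>From counts of outcomes to the probability of a subspace embedding\<close>

theorem theorem2p1:
  fixes \<epsilon> \<delta> :: real and d p k r n l :: nat
    and M :: "'w measure" and \<Omega> :: "'w \<Rightarrow> real Matrix.mat"
  assumes "0 < \<epsilon>" and "\<epsilon> < 1" and "0 < \<delta>" and "\<delta> < 1" and "d \<ge> 1"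
    and "p \<ge> 1" and "r = 2 ^ k" and "n = p * r"
    and "block_SRHT M p k l \<Omega>"
    and "n \<ge> l"
    and "real l \<ge> 3.7 * (1 / \<epsilon>\<^sup>2) * (sqrt (real d) + 4 * sqrt (ln (real n / \<delta>) + 6.3))\<^sup>2
                   * ln (5 * real d / \<delta>)"
  shows "OSE M l n \<epsilon> \<delta> d \<Omega>"
proof -
  obtain S D D' where ps: "prob_space M"
    and S: "\<And>a. a < l \<Longrightarrow> uniform_index M r (S a)"
    and D: "\<And>i j. i < p \<Longrightarrow> j < r \<Longrightarrow> rademacher M (D i j)"
    and D': "\<And>i a. i < p \<Longrightarrow> a < l \<Longrightarrow> rademacher M (D' i a)"
    and indep: "prob_space.indep_vars M (\<lambda>_. borel)
          (\<lambda>c. case c of Sampled a \<Rightarrow> (\<lambda>\<omega>. real (S a \<omega>)) | Diag i j \<Rightarrow> D i j | DiagTilde i a \<Rightarrow> D' i a)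
          (srht_sources p r l)"
    and \<Omega>: "\<And>\<omega>. \<omega> \<in> space M \<Longrightarrow>
        \<Omega> \<omega> = block_srht_matrix p k l (\<lambda>a. S a \<omega>) (\<lambda>i j. D i j \<omega>) (\<lambda>i a. D' i a \<omega>)"
    using assms(9) unfolding block_SRHT_def assms(7) by blast
  interpret prob_space M by (rule ps)
  have r: "0 < r" and p: "0 < p" using assms by simp_all
  have carrier: "\<Omega> \<omega> \<in> carrier_mat l n" if "\<omega> \<in> space M" for \<omega>
    using block_srht_matrix_carrier unfolding \<Omega>[OF that] assms(7,8) .
  have entry: "\<Omega> \<omega> $$ (a, i * r + j)
      = 1 / sqrt (real l) * (D' i a \<omega> * (if S a \<omega> < r then hadamard_entry k (S a \<omega>) j else 0) * D i j \<omega>)"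
    if "\<omega> \<in> space M" "a < l" "i < p" "j < r" for \<omega> a i j
    using block_srht_matrix_entry[of a l i p j k] that unfolding \<Omega>[OF that(1)] assms(7) by simp
  have rad_measurable: "Y \<in> borel_measurable M" if "rademacher M Y" for Y :: "'w \<Rightarrow> real"
    using that unfolding rademacher_def by (rule conjunct1)
  have entry_measurable: "(\<lambda>\<omega>. \<Omega> \<omega> $$ (a, t)) \<in> borel_measurable M" if a: "a < l" and t: "t < n" for a t
  proof -
    have ij: "t div r < p" "t mod r < r"
      using t r assms(8) by (simp_all add: less_mult_imp_div_less)
    have "(\<lambda>\<omega>. if S a \<omega> < r then hadamard_entry k (S a \<omega>) (t mod r) else 0) \<in> borel_measurable M"
    proof (rule measurable_compose[where g = "\<lambda>x. if x < r then hadamard_entry k x (t mod r) else 0"])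
      show "S a \<in> measurable M (count_space UNIV)"
        using S[OF a] unfolding uniform_index_def by (rule conjunct1)
    qed (rule borel_measurable_count_space)
    moreover have "D (t div r) (t mod r) \<in> borel_measurable M" "D' (t div r) a \<in> borel_measurable M"
      by (rule rad_measurable[OF D[OF ij]], rule rad_measurable[OF D'[OF ij(1) a]])
    ultimately have "(\<lambda>\<omega>. 1 / sqrt (real l) * (D' (t div r) a \<omega>
        * (if S a \<omega> < r then hadamard_entry k (S a \<omega>) (t mod r) else 0) * D (t div r) (t mod r) \<omega>)) \<in> borel_measurable M"
      by (intro borel_measurable_times borel_measurable_const)
    then show ?thesis
      by (rule measurable_cong[THEN iffD2, rotated]) (use entry[OF _ a ij] in \<open>simp only: div_mult_mod_eq\<close>)
  qed
  have rm: "random_matrix M l n \<Omega>"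
    unfolding random_matrix_def using carrier entry_measurable by simp
  have "1 - \<delta> \<le> measure M {\<omega> \<in> space M.
          \<forall>x\<in>V. \<bar>(norm2_vec x)\<^sup>2 - (norm2_vec (\<Omega> \<omega> *\<^sub>v x))\<^sup>2\<bar> \<le> \<epsilon> * (norm2_vec x)\<^sup>2}"
    if V: "V \<in> subspaces_of_dim n d" for V
  proof -
    obtain q :: "nat \<Rightarrow> nat \<Rightarrow> real"
      where orth: "\<And>c c'. c < d \<Longrightarrow> c' < d \<Longrightarrow> (\<Sum>t<n. q t c * q t c') = (if c = c' then 1 else 0)"
        and V_eq: "V = range (\<lambda>x. Matrix.vec n (\<lambda>t. \<Sum>c<d. q t c * x c))"
      by (rule subspace_orthonormal_basis[OF V]) (rule that)
    define q' where "q' ij = q (fst ij * r + snd ij)" for ij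
    interpret rows: srht_rows p r d "hadamard_entry k" q'
    proof
      show "0 < p" "0 < r" by fact+
      show "hadamard_entry k s j \<in> {-1, 1}" if "s < r" "j < r" for s j
        using hadamard_entry_sign that unfolding assms(7) .
      show "(\<Sum>s<r. hadamard_entry k s j * hadamard_entry k s j') = (if j = j' then real r else 0)" if "j < r" "j' < r" for j j'
        using hadamard_entry_orthogonal that unfolding assms(7) .
      show "(\<Sum>ij\<in>{..<p} \<times> {..<r}. q' ij c * q' ij c') = (if c = c' then 1 else 0)" if "c < d" "c' < d" for c c'
        using orth[OF that] unfolding assms(8) sum_lessThan_mult sum.cartesian_product' by (simp add: q'_def)
    qed
    define w where "w \<omega> a c = (\<Sum>t<n. \<Omega> \<omega> $$ (a, t) * q t c)" for \<omega> a c
    define E where "E = {\<omega> \<in> space M. \<forall>x. \<bar>ip d x x - (\<Sum>a<l. (ip d (w \<omega> a) x)\<^sup>2)\<bar> \<le> \<epsilon> * ip d x x}"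
    have E_eq: "{\<omega> \<in> space M. \<forall>x\<in>V. \<bar>(norm2_vec x)\<^sup>2 - (norm2_vec (\<Omega> \<omega> *\<^sub>v x))\<^sup>2\<bar> \<le> \<epsilon> * (norm2_vec x)\<^sup>2} = E"
      unfolding E_def V_eq w_def
      by (intro Collect_cong conj_cong refl)
         (simp add: norm2_vec_orthonormal[OF orth] norm2_vec_mult[OF carrier])
    have "(\<lambda>\<omega>. w \<omega> a c) \<in> borel_measurable M" if "a < l" for a c
      unfolding w_def using that
      by (intro borel_measurable_sum borel_measurable_times entry_measurable borel_measurable_const) auto
    then have E: "E \<in> events" unfolding E_def by (rule sets_embedding_event)
    \<comment> \<open>The events of a single outcome. They need not exhaust \<open>space M\<close>,
      since the random variables may take other values on a null set.\<close>
    define G where "G = (\<lambda>(u, f). {\<omega> \<in> space M. (\<forall>a<l. S a \<omega> = fst (f a)) \<and> (\<forall>i<p. \<forall>j<r. D i j \<omega> = u (i, j))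
      \<and> (\<forall>i<p. \<forall>a<l. D' i a \<omega> = snd (f a) i)})"
    have f_mem: "fst (f a) < r" "snd (f a) \<in> PiE {..<p} (\<lambda>_. {-1, 1})" if "f \<in> rows.tuples l" "a < l" for f a
    proof -
      have "f a \<in> rows.R" using PiE_mem[OF that(1)[unfolded rows.tuples_def], of a] that(2) by simp
      then show "fst (f a) < r" "snd (f a) \<in> PiE {..<p} (\<lambda>_. {-1, 1})"
        by (simp_all add: rows.R_def mem_Times_iff)
    qed
    have G: "G (u, f) \<in> events" "prob (G (u, f)) = 1 / real (card (rows.U \<times> rows.tuples l))"
      if u: "u \<in> rows.U" and f: "f \<in> rows.tuples l" for u f
    proof -
      have uu: "u (i, j) \<in> {-1, 1}" if "i < p" "j < r" for i j
        using PiE_mem[OF u[unfolded rows.U_def], of "(i, j)"] that by simp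
      have vv: "snd (f a) i \<in> {-1, 1}" if "i < p" "a < l" for i a
        using PiE_mem[OF f_mem(2)[OF f that(2)], of i] that by simp
      note out = srht_outcome[OF S D D' indep p r, where s = "\<lambda>a. fst (f a)" and u = "\<lambda>i j. u (i, j)"
          and v = "\<lambda>i a. snd (f a) i", OF _ _ _ _ _ f_mem(1)[OF f] uu vv]
      show "G (u, f) \<in> events" unfolding G_def prod.case by (rule out(1))
      have "prob (G (u, f)) = 1 / (2 ^ (p * r) * (real r * 2 ^ p) ^ l)"
        unfolding G_def prod.case by (rule out(2))
      also have "2 ^ (p * r) * (real r * 2 ^ p) ^ l = real (card (rows.U \<times> rows.tuples l))"
        by (simp add: card_cartesian_product rows.card_tuples rows.card_R rows.card_U)
      finally show "prob (G (u, f)) = 1 / real (card (rows.U \<times> rows.tuples l))" .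
    qed
    have G_E: "G (u, f) \<subseteq> E" if u: "u \<in> rows.U" and f: "f \<in> rows.tuples l" and nd: "\<not> rows.distorted l \<epsilon> u f" for u f
    proof
      fix \<omega> assume "\<omega> \<in> G (u, f)"
      then have \<omega>: "\<omega> \<in> space M" "\<And>a. a < l \<Longrightarrow> S a \<omega> = fst (f a)"
          "\<And>i j. i < p \<Longrightarrow> j < r \<Longrightarrow> D i j \<omega> = u (i, j)" "\<And>i a. i < p \<Longrightarrow> a < l \<Longrightarrow> D' i a \<omega> = snd (f a) i"
        by (auto simp: G_def)
      have w_row: "w \<omega> a = (\<lambda>c. 1 / sqrt (real l) * rows.row u (f a) c)" if a: "a < l" for a
      proof
        fix c
        have "w \<omega> a c = (\<Sum>i<p. \<Sum>j<r. \<Omega> \<omega> $$ (a, i * r + j) * q (i * r + j) c)"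
          unfolding w_def assms(8) by (rule sum_lessThan_mult)
        also have "\<dots> = (\<Sum>i<p. \<Sum>j<r. 1 / sqrt (real l)
            * (snd (f a) i * hadamard_entry k (fst (f a)) j * u (i, j) * q' (i, j) c))"
          using a f_mem(1)[OF f a] by (intro sum.cong refl) (simp add: entry \<omega> q'_def)
        also have "\<dots> = 1 / sqrt (real l) * rows.row u (f a) c"
          unfolding rows.row_def sum.cartesian_product' prod.case by (simp only: sum_distrib_left)
        finally show "w \<omega> a c = 1 / sqrt (real l) * rows.row u (f a) c" .
      qed
      have "(ip d (w \<omega> a) x)\<^sup>2 = (ip d (rows.row u (f a)) x)\<^sup>2 / real l" if "a < l" for a x
        unfolding w_row[OF that] ip_scale_left by (simp add: power_mult_distrib power_divide)
      then have "(\<Sum>a<l. (ip d (w \<omega> a) x)\<^sup>2) = (\<Sum>a<l. (ip d (rows.row u (f a)) x)\<^sup>2) / real l" for x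
        by (simp add: sum_divide_distrib)
      then show "\<omega> \<in> E" using nd \<omega>(1) by (simp add: E_def rows.distorted_def not_less)
    qed
    define T where "T = rows.U \<times> rows.tuples l"
    define Bad where "Bad = {(u, f) \<in> T. rows.distorted l \<epsilon> u f}"
    have finT: "finite T" unfolding T_def by (intro finite_cartesian_product rows.finite_U rows.finite_tuples)
    have Bad: "real (card Bad) \<le> \<delta> * real (card T)"
      unfolding Bad_def T_def using assms by (intro rows.card_distorted_fraction_le) auto
    have cardT: "0 < real (card T)"
      using r by (simp add: T_def card_cartesian_product rows.card_tuples rows.card_R rows.card_U)
    have disj: "disjoint_family_on G (T - Bad)"
      unfolding disjoint_family_on_def
    proof (intro ballI impI)
      fix x y assume x: "x \<in> T - Bad" and y: "y \<in> T - Bad" and "x \<noteq> y"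
      obtain u f u' f' where xy: "x = (u, f)" "y = (u', f')" by (cases x, cases y)
      have mem: "u \<in> rows.U" "f \<in> rows.tuples l" "u' \<in> rows.U" "f' \<in> rows.tuples l"
        using x y by (auto simp: xy T_def)
      show "G x \<inter> G y = {}"
      proof (rule ccontr)
        assume "G x \<inter> G y \<noteq> {}"
        then have eq: "\<And>i j. i < p \<Longrightarrow> j < r \<Longrightarrow> u (i, j) = u' (i, j)" "\<And>a. a < l \<Longrightarrow> fst (f a) = fst (f' a)"
            "\<And>i a. i < p \<Longrightarrow> a < l \<Longrightarrow> snd (f a) i = snd (f' a) i"
          by (auto simp: xy G_def)
        have "u = u'"
          by (rule PiE_ext[OF mem(1,3)[unfolded rows.U_def]]) (auto simp: eq)
        moreover have "f = f'"
        proof (rule PiE_ext[OF mem(2,4)[unfolded rows.tuples_def]])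
          fix a assume "a \<in> {..<l}"
          then have a: "a < l" by simp
          have "snd (f a) = snd (f' a)"
            by (rule PiE_ext[OF f_mem(2)[OF mem(2) a] f_mem(2)[OF mem(4) a]]) (simp add: eq a)
          then show "f a = f' a" using eq(2)[OF a] by (simp add: prod_eq_iff)
        qed
        ultimately show False using \<open>x \<noteq> y\<close> xy by simp
      qed
    qed
    \<comment> \<open>Only a lower bound for \<open>prob E\<close> is wanted, so it is enough to add
      up the equally likely good outcomes, which are disjoint and contained in
      \<open>E\<close>.\<close>
    have "(1 - \<delta>) * real (card T) \<le> real (card (T - Bad))"
      using Bad finT by (subst card_Diff_subset) (auto simp: Bad_def of_nat_diff card_mono algebra_simps intro: finite_subset)
    then have "1 - \<delta> \<le> real (card (T - Bad)) * (1 / real (card T))"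
      using cardT by (simp add: field_simps)
    also have "\<dots> = (\<Sum>x\<in>T - Bad. 1 / real (card T))" by simp
    also have "\<dots> = (\<Sum>x\<in>T - Bad. prob (G x))"
      using G(2) by (intro sum.cong) (auto simp: T_def)
    also have "\<dots> = prob (\<Union>x\<in>T - Bad. G x)"
      using G(1) disj finT by (intro finite_measure_finite_Union[symmetric]) (auto simp: T_def)
    also have "\<dots> \<le> prob E"
      using G_E E by (intro finite_measure_mono) (auto simp: T_def Bad_def)
    finally show ?thesis unfolding E_eq .
  qed
  then show ?thesis unfolding OSE_def using ps rm by blast
qed

end
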